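(* Let $E_0 \in \mathcal{HB}$ and let $\{\lambda_n\}_{n\in\mathbb{Z}} \subset \mathbb{R}$ be a sampling sequence for $\mathcal{H}(E_0)$. Let $E, F \in \mathcal{HB}$ be such that $\mathcal{H}(E_0)$ and $\mathcal{H}(E)$ coincide as sets with equivalent norms, and such that $\{\lambda_n\}$ constitutes the zero sequence of $EF + E^{*}F^{*}$. Assume $E_0, E, F$ have no real zeros. Then the sequence $$\left\{ \frac{\overline{F(\lambda_n)}\,F(\cdot)\,K_{E_0}(\lambda_n,\cdot)}{\sqrt{K_{EF}(\lambda_n,\lambda_n)}} \oplus \frac{E(\lambda_n)\,E_0^{*}(\cdot)\,K_F(\lambda_n,\cdot)}{\sqrt{K_{EF}(\lambda_n,\lambda_n)}} \right\}_{n}$$ is a Riesz basis of a closed subspace $\mathcal{K}_0 \subset \mathcal{H}(E_0F)$.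
   Context: For an entire function $f$ put $f^{*}(z) := \overline{f(\bar z)}$. $\mathcal{HB}$ (the Hermite–Biehler class) is the set of entire functions $E$ satisfying $|E(\bar z)| < |E(z)|$ for all $z \in \mathbb{C}^{+} = \{z : \operatorname{Im} z > 0\}$. An analytic function on $\mathbb{C}^{+}$ is of bounded type if it is a quotient of two bounded analytic functions on $\mathbb{C}^{+}$; its mean type is $\limsup_{y\to+\infty} \frac{\log|f(iy)|}{y}$. For $E \in \mathcal{HB}$, the de Branges space $\mathcal{H}(E)$ is the Hilbert space of all entire functions $f$ such that $\|f\|_E^2 := \int_{\mathbb{R}} |f(t)/E(t)|^2\,dt < \infty$ and both $f/E$ and $f^{*}/E$ are of bounded type and nonpositive mean type in $\mathbb{C}^{+}$; the inner product is $\langle f,g\rangle_E = \int_{\mathbb{R}} f(t)\overline{g(t)}\,|E(t)|^{-2}\,dt$. It has reproducing kernel $K_E(w,z) = \frac{\overline{E(w)}E(z) - E(\bar w)E^{*}(z)}{2\pi i(\bar w - z)}$ (extended by continuity to $z=\bar w$), so $f(w) = \langle f, K_E(w,\cdot)\rangle_E$ for all $f\in\mathcal{H}(E)$, $w \in \mathbb{C}$. Products of elements of $\mathcal{HB}$ are in $\mathcal{HB}$, and $K_F, K_{EF}, K_{E_0}$ denote the corresponding kernels. A sequence $\{\lambda_n\} \subset \mathbb{R}$ is a sampling sequence for $\mathcal{H}(E_0)$ if there exist constants $A, B > 0$ such that $A\|f\|_{E_0}^2 \le \sum_n |f(\lambda_n)|^2 \le B\|f\|_{E_0}^2$ for all $f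 \in \mathcal{H}(E_0)$. The symbol $\oplus$ denotes the sum in $\mathcal{H}(E_0F)$ of an element of $F\cdot\mathcal{H}(E_0) = \{fF : f\in\mathcal{H}(E_0)\}$ and an element of $E_0^{*}\cdot\mathcal{H}(F) = \{gE_0^{*} : g \in\mathcal{H}(F)\}$, which are mutually orthogonal subspaces of $\mathcal{H}(E_0F)$. A frame for a Hilbert space $H$ is a sequence $\{f_n\}$ with $A\|f\|^2 \le \sum_n |\langle f,f_n\rangle|^2 \le B\|f\|^2$ for all $f \in H$ and some $0<A\le B<\infty$; a Riesz basis is a frame which is a basis. *)

theory Defs
  imports "HOL-Complex_Analysis.Complex_Analysis"
begin

definition upper_half :: "complex set" where
  "upper_half = {z. Im z > 0}"

definition star :: "(complex \<Rightarrow> complex) \<Rightarrow> complex \<Rightarrow> complex" where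
  "star f = (\<lambda>z. cnj (f (cnj z)))"

definition HB :: "(complex \<Rightarrow> complex) set" where
  "HB = {E. E holomorphic_on UNIV \<and> (\<forall>z\<in>upper_half. cmod (E (cnj z)) < cmod (E z))}"

text \<open>\<open>f = g / h\<close> as meromorphic functions, with \<open>h\<close> not identically zero. The product form
  avoids the convention \<open>x / 0 = 0\<close> at zeros of \<open>h\<close>.\<close>

definition bounded_type :: "(complex \<Rightarrow> complex) \<Rightarrow> bool" where
  "bounded_type f \<longleftrightarrow> f holomorphic_on upper_half \<and>
     (\<exists>g h. g holomorphic_on upper_half \<and> bounded (g ` upper_half) \<and>
            h holomorphic_on upper_half \<and> bounded (h ` upper_half) \<and>
            (\<exists>z\<in>upper_half. h z \<noteq> 0) \<and>
            (\<forall>z\<in>upper_half. f z * h z = g z))"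

text \<open>The case distinction implements \<open>log 0 = -\<infinity>\<close>; in HOL, \<open>ln 0 = 0\<close>.\<close>

definition mean_type :: "(complex \<Rightarrow> complex) \<Rightarrow> ereal" where
  "mean_type f = Limsup at_top (\<lambda>y::real.
     if f (\<i> * of_real y) = 0 then -\<infinity> else ereal (ln (cmod (f (\<i> * of_real y))) / y))"

definition dB :: "(complex \<Rightarrow> complex) \<Rightarrow> (complex \<Rightarrow> complex) set" where
  "dB E = {f. f holomorphic_on UNIV \<and>
     integrable lborel (\<lambda>t::real. (cmod (f (of_real t) / E (of_real t)))\<^sup>2) \<and>
     bounded_type (\<lambda>z. f z / E z) \<and> mean_type (\<lambda>z. f z / E z) \<le> 0 \<and>
     bounded_type (\<lambda>z. star f z / E z) \<and> mean_type (\<lambda>z. star f z / E z) \<le> 0}"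

definition dB_norm :: "(complex \<Rightarrow> complex) \<Rightarrow> (complex \<Rightarrow> complex) \<Rightarrow> real" where
  "dB_norm E f = sqrt (LINT t|lborel. (cmod (f (of_real t) / E (of_real t)))\<^sup>2)"

definition dB_inner ::
  "(complex \<Rightarrow> complex) \<Rightarrow> (complex \<Rightarrow> complex) \<Rightarrow> (complex \<Rightarrow> complex) \<Rightarrow> complex" where
  "dB_inner E f g = (LINT t|lborel.
     f (of_real t) * cnj (g (of_real t)) / of_real ((cmod (E (of_real t)))\<^sup>2))"

definition dB_quot :: "(complex \<Rightarrow> complex) \<Rightarrow> complex \<Rightarrow> complex \<Rightarrow> complex" where
  "dB_quot E w z =
     (cnj (E w) * E z - E (cnj w) * star E z) / (2 * of_real pi * \<i> * (cnj w - z))"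

definition dB_kernel :: "(complex \<Rightarrow> complex) \<Rightarrow> complex \<Rightarrow> complex \<Rightarrow> complex" where
  "dB_kernel E w z = (if z = cnj w then Lim (at (cnj w)) (dB_quot E w) else dB_quot E w z)"

definition equal_with_equiv_norms :: "(complex \<Rightarrow> complex) \<Rightarrow> (complex \<Rightarrow> complex) \<Rightarrow> bool" where
  "equal_with_equiv_norms E\<^sub>0 E \<longleftrightarrow> dB E\<^sub>0 = dB E \<and>
     (\<exists>a b. 0 < a \<and> 0 < b \<and>
        (\<forall>f\<in>dB E\<^sub>0. a * dB_norm E\<^sub>0 f \<le> dB_norm E f \<and> dB_norm E f \<le> b * dB_norm E\<^sub>0 f))"

definition sampling_sequence :: "(complex \<Rightarrow> complex) \<Rightarrow> (int \<Rightarrow> real) \<Rightarrow> bool" where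
  "sampling_sequence E lam \<longleftrightarrow>
     (\<exists>A B. 0 < A \<and> 0 < B \<and>
       (\<forall>f\<in>dB E.
          (\<lambda>n. (cmod (f (of_real (lam n))))\<^sup>2) summable_on UNIV \<and>
          A * (dB_norm E f)\<^sup>2 \<le> (\<Sum>\<^sub>\<infinity>n. (cmod (f (of_real (lam n))))\<^sup>2) \<and>
          (\<Sum>\<^sub>\<infinity>n. (cmod (f (of_real (lam n))))\<^sup>2) \<le> B * (dB_norm E f)\<^sup>2))"

text \<open>The sequence lists exactly the zeros of the entire function \<open>f\<close>, each as often as its
  multiplicity; at points that are not zeros \<open>zorder f w = 0\<close>.\<close>

definition zero_sequence :: "(complex \<Rightarrow> complex) \<Rightarrow> (int \<Rightarrow> real) \<Rightarrow> bool" where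
  "zero_sequence f lam \<longleftrightarrow>
     (\<forall>w. finite {n. complex_of_real (lam n) = w} \<and>
          int (card {n. complex_of_real (lam n) = w}) = zorder f w)"

definition dB_closed_subspace :: "(complex \<Rightarrow> complex) \<Rightarrow> (complex \<Rightarrow> complex) set \<Rightarrow> bool" where
  "dB_closed_subspace E K \<longleftrightarrow> K \<subseteq> dB E \<and>
     (\<lambda>z. 0) \<in> K \<and>
     (\<forall>f\<in>K. \<forall>g\<in>K. (\<lambda>z. f z + g z) \<in> K) \<and>
     (\<forall>c. \<forall>f\<in>K. (\<lambda>z. c * f z) \<in> K) \<and>
     (\<forall>u. \<forall>f\<in>dB E. (\<forall>n::nat. u n \<in> K) \<longrightarrow>
        (\<lambda>n. dB_norm E (\<lambda>z. u n z - f z)) \<longlonglongrightarrow> 0 \<longrightarrow> f \<in> K)"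

definition dB_frame ::
  "(complex \<Rightarrow> complex) \<Rightarrow> (complex \<Rightarrow> complex) set \<Rightarrow> (int \<Rightarrow> complex \<Rightarrow> complex) \<Rightarrow> bool" where
  "dB_frame E K \<phi> \<longleftrightarrow> (\<forall>n. \<phi> n \<in> K) \<and>
     (\<exists>A B. 0 < A \<and> A \<le> B \<and>
       (\<forall>f\<in>K.
          (\<lambda>n. (cmod (dB_inner E f (\<phi> n)))\<^sup>2) summable_on UNIV \<and>
          A * (dB_norm E f)\<^sup>2 \<le> (\<Sum>\<^sub>\<infinity>n. (cmod (dB_inner E f (\<phi> n)))\<^sup>2) \<and>
          (\<Sum>\<^sub>\<infinity>n. (cmod (dB_inner E f (\<phi> n)))\<^sup>2) \<le> B * (dB_norm E f)\<^sup>2))"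

definition dB_schauder_basis ::
  "(complex \<Rightarrow> complex) \<Rightarrow> (complex \<Rightarrow> complex) set \<Rightarrow> (nat \<Rightarrow> complex \<Rightarrow> complex) \<Rightarrow> bool" where
  "dB_schauder_basis E K g \<longleftrightarrow> (\<forall>k. g k \<in> K) \<and>
     (\<forall>f\<in>K. \<exists>!c::nat \<Rightarrow> complex.
        (\<lambda>N. dB_norm E (\<lambda>z. f z - (\<Sum>k<N. c k * g k z))) \<longlonglongrightarrow> 0)"

text \<open>A frame that is a basis. The index set \<open>\<int>\<close> has no canonical order of summation; the basis
  property is required for every enumeration of it, which for frames is equivalent to requiring it
  for one.\<close>

definition dB_riesz_basis ::
  "(complex \<Rightarrow> complex) \<Rightarrow> (complex \<Rightarrow> complex) set \<Rightarrow> (int \<Rightarrow> complex \<Rightarrow> complex) \<Rightarrow> bool" where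
  "dB_riesz_basis E K \<phi> \<longleftrightarrow> dB_frame E K \<phi> \<and>
     (\<forall>e :: nat \<Rightarrow> int. bij e \<longrightarrow> dB_schauder_basis E K (\<lambda>k. \<phi> (e k)))"

end

theory Submission
  imports Defs "HOL-Real_Asymp.Real_Asymp" "HOL-Probability.Sinc_Integral"
begin

text \<open>Write \<open>x\<^sub>n\<close> for the real points \<open>lam n\<close>, \<open>H(E)\<close> for the space \<open>dB E\<close>, \<open>E*\<close> for \<open>star E\<close> and
\<open>K\<^bsub>E\<^esub>(x, \<cdot>)\<close> for the kernel of \<open>H(E)\<close> at the point \<open>x\<close>.

For real \<open>x\<close> the kernel of \<open>H(EF)\<close> splits as
\<open>K\<^bsub>EF\<^esub>(x, \<cdot>) = cnj F(x) F K\<^bsub>E\<^esub>(x, \<cdot>) + E(x) E* K\<^bsub>F\<^esub>(x, \<cdot>)\<close> (lemma \<open>kernel_mult\<close>), along the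
orthogonal decomposition of \<open>H(EF)\<close> into \<open>F H(E)\<close> and \<open>E* H(F)\<close>. The kernel \<open>K\<^bsub>EF\<^esub>\<close> vanishes at
pairs of distinct real zeros of \<open>EF + E*F*\<close>, and these zeros are simple, so the functions
\<open>K\<^bsub>EF\<^esub>(x\<^sub>n, \<cdot>)\<close>, divided by the square roots of \<open>K\<^bsub>EF\<^esub>(x\<^sub>n, x\<^sub>n)\<close>, are orthonormal. The sequence of
the theorem is the image of this orthonormal sequence under a map to \<open>H(E\<^sub>0F)\<close> that carries the
second summand isometrically to \<open>E\<^sub>0* H(F)\<close> and sends \<open>K\<^bsub>E\<^esub>(x\<^sub>n, \<cdot>)\<close> to \<open>K\<^bsub>E\<^sub>0\<^esub>(x\<^sub>n, \<cdot>)\<close> on the first one: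
there it is the adjoint of the identity map from \<open>H(E\<^sub>0)\<close> to \<open>H(E)\<close>, which is bounded with bounded
inverse because the norms are equivalent. Such a map sends an orthonormal sequence to a Riesz basis
of a closed subspace.

The argument works with finite linear combinations. Let \<open>f\<^sub>0\<close> and \<open>f\<^sub>1\<close> be combinations of the
\<open>K\<^bsub>E\<^sub>0\<^esub>(x\<^sub>n, \<cdot>)\<close> and of the \<open>K\<^bsub>E\<^esub>(x\<^sub>n, \<cdot>)\<close> with the same coefficients. The reproducing property in both
spaces gives \<open>\<parallel>f\<^sub>0\<parallel>\<^sup>2 = \<langle>f\<^sub>0, f\<^sub>1\<rangle>\<close>, with the norm of \<open>H(E\<^sub>0)\<close> on the left and the inner product of
\<open>H(E)\<close> on the right. By Cauchy--Schwarz and the equivalence of norms, the norm of \<open>f\<^sub>0\<close> in \<open>H(E\<^sub>0)\<close>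
is bounded by a constant times the norm of \<open>f\<^sub>1\<close> in \<open>H(E)\<close>, and conversely by symmetry (lemma
\<open>representer_combination_le\<close>). With the orthogonality of the two summands (lemma \<open>pythagoras\<close>)
this bounds the norm of a combination of the given functions, above and below, by the \<open>\<ell>\<^sup>2\<close> norm of
its coefficients. Two-sided bounds of this kind make a sequence a frame and an unconditional basis
of its closed span (locale \<open>riesz_sequence\<close>).

The analytic input is the reproducing formula for arbitrary elements of \<open>H(E)\<close> and the orthogonality
of \<open>F H(E)\<close> and \<open>E* H(F)\<close>. Both say that certain functions that are holomorphic in the upper
half-plane, continuous up to the real axis and integrable on it have integral zero over the real
line (lemma \<open>integral_eq_0_upper_half_plane\<close>). The two conditions that define \<open>H(E)\<close> enter as
follows. A quotient \<open>u = g / h\<close> of bounded functions satisfies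
\<open>|u(z)| \<le> exp (C (1 + |z|\<^sup>2) / Im z)\<close>: dividing out zeros of \<open>h\<close> reduces this to Harnack's inequality
for \<open>- ln |h|\<close>. A primitive \<open>V\<close> of \<open>u\<close> is bounded on the real axis when \<open>u\<close> is integrable there. An
explicit harmonic majorant on half-discs then improves the growth of \<open>V\<close> to an exponential of a
multiple of \<open>Im z\<close>, and nonpositive mean type makes \<open>V\<close> bounded. For bounded \<open>V\<close> the integral of
\<open>u = V'\<close> over the real line can be pushed to infinity.\<close>

section \<open>Growth of functions of bounded type\<close>

text \<open>The non-strict bound is stable under limits and under division by Blaschke factors. It follows from
the strict form for \<open>r f\<close> as \<open>r\<close> increases to \<open>1\<close>.\<close>

lemma Schwarz_Lemma_weak:
  assumes holf: "f holomorphic_on ball 0 1" and f0: "f 0 = 0"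
    and le: "\<And>z. norm z < 1 \<Longrightarrow> norm (f z) \<le> 1" and w: "norm w < 1"
  shows "norm (f w) \<le> norm w"
proof -
  have *: "r * norm (f w) \<le> norm w" if r: "0 < r" "r < 1" for r :: real
  proof -
    have "norm (of_real r * f w) \<le> norm w"
    proof (rule Schwarz_Lemma(1)[OF _ _ _ w, of "\<lambda>z. of_real r * f z"])
      show "(\<lambda>z. of_real r * f z) holomorphic_on ball 0 1"
        by (intro holomorphic_intros holf)
      show "norm (of_real r * f z) < 1" if "norm z < 1" for z
      proof -
        have "r * norm (f z) \<le> r * 1" using le[OF that] r by (intro mult_left_mono) auto
        moreover have "norm (of_real r * f z) = r * norm (f z)" using r by (simp add: norm_mult)
        ultimately show ?thesis using r by linarith
      qed
    qed (simp add: f0)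
    then show ?thesis using r by (simp add: norm_mult)
  qed
  have "\<forall>\<^sub>F r in at_left (1::real). r * norm (f w) \<le> norm w"
    using eventually_at_left_real[of 0 "1::real"] * by (auto elim!: eventually_mono)
  moreover have "((\<lambda>r. r * norm (f w)) \<longlongrightarrow> 1 * norm (f w)) (at_left (1::real))"
    by (intro tendsto_intros)
  ultimately have "1 * norm (f w) \<le> norm w"
    by (intro tendsto_upperbound[of "\<lambda>r. r * norm (f w)" _ "at_left (1::real)"]) auto
  then show ?thesis by simp
qed

text \<open>Schwarz--Pick at a zero: composing with the disc automorphism that moves \<open>0\<close> to \<open>a\<close> reduces this to
the Schwarz lemma.\<close>

lemma norm_le_Moebius_at_zero:
  assumes holf: "f holomorphic_on ball 0 1"
    and le: "\<And>z. norm z < 1 \<Longrightarrow> norm (f z) \<le> 1"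
    and a: "norm a < 1" "f a = 0" and z: "norm z < 1"
  shows "norm (f z) \<le> norm (Moebius_function 0 a z)"
proof -
  let ?m = "Moebius_function 0 (-a)"
  have m: "norm (?m x) < 1" if "norm x < 1" for x
    using Moebius_function_norm_lt_1[of "-a" x 0] a that by simp
  have "norm ((f \<circ> ?m) (Moebius_function 0 a z)) \<le> norm (Moebius_function 0 a z)"
  proof (rule Schwarz_Lemma_weak)
    show "(f \<circ> ?m) holomorphic_on ball 0 1"
      by (rule holomorphic_on_compose_gen[OF Moebius_function_holomorphic holf]) (use a m in auto)
    show "(f \<circ> ?m) 0 = 0" using a by (simp add: Moebius_function_of_zero)
    show "norm ((f \<circ> ?m) x) \<le> 1" if "norm x < 1" for x using le[OF m[OF that]] by simp
    show "norm (Moebius_function 0 a z) < 1" using a z by (intro Moebius_function_norm_lt_1)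
  qed
  moreover have "?m (Moebius_function 0 a z) = z"
    using a z by (intro Moebius_function_compose) auto
  ultimately show ?thesis by simp
qed

lemma norm_le_at_puncture:
  assumes "f holomorphic_on S" "open S" "a \<in> S"
    and "\<And>z. z \<in> S \<Longrightarrow> z \<noteq> a \<Longrightarrow> norm (f z) \<le> (B::real)"
  shows "norm (f a) \<le> B"
proof (rule tendsto_upperbound)
  have "isCont f a" using holomorphic_on_imp_continuous_on[OF assms(1)] assms(2,3) by (simp add: continuous_on_eq_continuous_at)
  then show "((\<lambda>z. norm (f z)) \<longlongrightarrow> norm (f a)) (at a)"
    by (intro tendsto_norm) (simp add: isCont_def)
  show "\<forall>\<^sub>F z in at a. norm (f z) \<le> B"
    using eventually_at_in_open[OF assms(2,3)] assms(4) by (auto elim!: eventually_mono)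
qed auto

text \<open>Harnack's inequality for the nonnegative harmonic function \<open>- ln |k|\<close>. It comes from the Schwarz
lemma applied to the Cayley transform of a branch of \<open>ln k\<close>, which takes values in a half-plane;
the shift by \<open>\<eta> > 0\<close> makes that half-plane open.\<close>

lemma Harnack_zero_free:
  assumes holk: "k holomorphic_on ball 0 s" and s: "s > 0"
    and nz: "\<And>z. norm z < s \<Longrightarrow> k z \<noteq> 0" and le: "\<And>z. norm z < s \<Longrightarrow> norm (k z) \<le> 1"
    and w: "norm w < s"
  shows "ln (1 / norm (k w)) \<le> (s + norm w) / (s - norm w) * ln (1 / norm (k 0))"
proof -
  obtain L where holL: "L holomorphic_on ball 0 s" and L: "\<And>z. z \<in> ball 0 s \<Longrightarrow> exp (L z) = k z"
    using holomorphic_logarithm_exists[of "ball 0 s" k 0] holk nz s by auto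
  have ReL: "ln (1 / norm (k z)) = - Re (L z)" if "norm z < s" for z
    using L[of z, symmetric] that by (simp add: ln_div)
  have ReL0: "Re (L z) \<le> 0" if "norm z < s" for z
    using ReL[OF that] le[OF that] nz[OF that] ln_le_zero_iff[of "cmod (k z)"] by (simp add: ln_div)
  define \<rho> where "\<rho> = norm w / s"
  have \<rho>: "0 \<le> \<rho>" "\<rho> < 1" using s w by (auto simp: \<rho>_def)
  have *: "\<eta> - Re (L w) \<le> (1 + \<rho>) / (1 - \<rho>) * (\<eta> - Re (L 0))" if \<eta>: "\<eta> > 0" for \<eta> :: real
  proof -
    define P where "P = (\<lambda>z. L (of_real s * z) - of_real \<eta>)"
    have in_ball: "norm (of_real s * z) < s" if "norm z < 1" for z :: complex
      using that s by (simp add: norm_mult)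
    have ReP: "Re (P z) < 0" if "norm z < 1" for z
      using ReL0[OF in_ball[OF that]] \<eta> by (simp add: P_def)
    have den: "P z + cnj (P 0) \<noteq> 0" if "norm z < 1" for z
    proof
      assume "P z + cnj (P 0) = 0"
      then have "Re (P z + cnj (P 0)) = 0" by simp
      then show False using ReP[OF that] ReP[of 0] by simp
    qed
    have "norm ((P (w / of_real s) - P 0) / (P (w / of_real s) + cnj (P 0))) \<le> norm (w / of_real s)"
    proof (rule Schwarz_Lemma_weak[of "\<lambda>z. (P z - P 0) / (P z + cnj (P 0))"])
      have "(\<lambda>z. L (of_real s * z)) holomorphic_on ball 0 1"
        by (rule holomorphic_on_compose_gen[OF _ holL, unfolded o_def])
           (use in_ball in \<open>auto intro!: holomorphic_intros\<close>)
      then show "(\<lambda>z. (P z - P 0) / (P z + cnj (P 0))) holomorphic_on ball 0 1"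
        unfolding P_def by (intro holomorphic_intros) (use den in \<open>auto simp: P_def\<close>)
      show "norm ((P z - P 0) / (P z + cnj (P 0))) \<le> 1" if z: "norm z < 1" for z
      proof -
        have "(norm (P z - P 0))\<^sup>2 \<le> (norm (P z + cnj (P 0)))\<^sup>2"
          using mult_neg_neg[OF ReP[OF z] ReP[of 0]]
          unfolding cmod_power2 by (simp add: power2_eq_square algebra_simps)
        then have "norm (P z - P 0) \<le> norm (P z + cnj (P 0))"
          by (rule power2_le_imp_le) simp
        then show ?thesis using den[OF z] by (simp add: norm_divide)
      qed
      show "norm (w / of_real s) < 1" using s w by (simp add: norm_divide)
    qed simp
    then have 1: "norm (P (w / of_real s) - P 0) \<le> \<rho> * norm (P (w / of_real s) + cnj (P 0))"
      using den[of "w / of_real s"] s w by (simp add: norm_divide \<rho>_def divide_simps split: if_splits)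
    have Pw: "P (w / of_real s) = L w - of_real \<eta>" using s by (simp add: P_def)
    have P0: "P 0 = L 0 - of_real \<eta>" by (simp add: P_def)
    define A where "A = \<eta> - Re (L w)"
    define A0 where "A0 = \<eta> - Re (L 0)"
    define N where "N = norm (L w - L 0)"
    have A0: "A0 > 0" using ReL0[of 0] \<eta> s by (simp add: A0_def)
    have "P (w / of_real s) + cnj (P 0) = (L w - L 0) - of_real (2 * A0)"
      by (simp add: Pw P0 A0_def complex_eq_iff)
    then have "norm (P (w / of_real s) + cnj (P 0)) \<le> N + 2 * A0"
      using norm_triangle_ineq4[of "L w - L 0" "of_real (2 * A0)"] A0 by (simp add: N_def)
    then have "N \<le> \<rho> * (N + 2 * A0)"
      using 1 \<rho> mult_left_mono[of "norm (P (w / of_real s) + cnj (P 0))" "N + 2 * A0" \<rho>]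
      by (simp add: Pw P0 N_def)
    moreover have "A - A0 \<le> N"
      using abs_Re_le_cmod[of "L w - L 0"] by (simp add: A_def A0_def N_def)
    then have "(1 - \<rho>) * (A - A0) \<le> (1 - \<rho>) * N" using \<rho> by (intro mult_left_mono) auto
    ultimately have "A * (1 - \<rho>) \<le> (1 + \<rho>) * A0" by (simp add: algebra_simps)
    then show ?thesis using \<rho> by (simp add: A_def A0_def field_simps)
  qed
  have "- Re (L w) \<le> (1 + \<rho>) / (1 - \<rho>) * (- Re (L 0))"
  proof (rule tendsto_le)
    show "((\<lambda>\<eta>. \<eta> - Re (L w)) \<longlongrightarrow> - Re (L w)) (at_right 0)"
      by (rule tendsto_eq_intros refl | use \<rho> in simp)+
    show "((\<lambda>\<eta>. (1 + \<rho>) / (1 - \<rho>) * (\<eta> - Re (L 0))) \<longlongrightarrow> (1 + \<rho>) / (1 - \<rho>) * (- Re (L 0))) (at_right 0)"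
      by (rule tendsto_eq_intros refl | use \<rho> in simp)+
    show "\<forall>\<^sub>F \<eta> in at_right 0. \<eta> - Re (L w) \<le> (1 + \<rho>) / (1 - \<rho>) * (\<eta> - Re (L 0))"
      using eventually_at_right_less[of "0::real"] by (rule eventually_mono) (use * in auto)
  qed simp
  moreover have "(1 + \<rho>) / (1 - \<rho>) = (s + norm w) / (s - norm w)"
    using s w by (simp add: \<rho>_def field_simps)
  ultimately show ?thesis using ReL[OF w] ReL[of 0] s by simp
qed

text \<open>A zero \<open>a\<close> of \<open>h\<close> in the disc of radius \<open>s\<close> is divided out of \<open>h\<close> and of \<open>g = u h\<close>, which leaves \<open>u\<close>
unchanged. This multiplies \<open>|h 0|\<close> by \<open>1 / |a| > 1 / s\<close> while \<open>h\<close> stays bounded by \<open>1\<close>. So the zeros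
are exhausted after at most \<open>n\<close> steps, and Harnack's inequality applies to what is left of \<open>h\<close>.\<close>

lemma quotient_bound_small_disc:
  assumes s: "0 < s" "s < 1" and w: "norm w < s"
  shows "\<lbrakk>g holomorphic_on ball 0 1; h holomorphic_on ball 0 1; u holomorphic_on ball 0 1;
    \<And>z. norm z < 1 \<Longrightarrow> norm (g z) \<le> 1; \<And>z. norm z < 1 \<Longrightarrow> norm (h z) \<le> 1;
    \<And>z. norm z < 1 \<Longrightarrow> u z * h z = g z; norm (h 0) > s ^ n\<rbrakk>
    \<Longrightarrow> norm (u w) \<le> exp ((s + norm w) / (s - norm w) * ln (1 / norm (h 0)))"
proof (induction n arbitrary: g h)
  case 0
  then have "norm (h 0) > 1" "norm (h 0) \<le> 1" by auto
  then show ?case by simp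
next
  case (Suc n)
  note hol = Suc.prems(1-3) and gle = Suc.prems(4) and hle = Suc.prems(5) and eq = Suc.prems(6)
  have h0: "h 0 \<noteq> 0" using Suc.prems(7) zero_less_power[OF s(1), of "Suc n"] by auto
  show ?case
  proof (cases "\<exists>a. norm a < s \<and> h a = 0")
    case False
    have "ln (1 / norm (h w)) \<le> (s + norm w) / (s - norm w) * ln (1 / norm (h 0))"
      by (rule Harnack_zero_free)
         (use False hol hle s w in \<open>auto intro: holomorphic_on_subset\<close>)
    then have "exp (ln (1 / norm (h w))) \<le> exp ((s + norm w) / (s - norm w) * ln (1 / norm (h 0)))"
      by simp
    moreover have hw: "h w \<noteq> 0" using False w by auto
    have "norm (u w) \<le> 1 / norm (h w)"
    proof -
      have "norm (u w) * norm (h w) \<le> 1" using eq[of w] gle[of w] w s by (simp flip: norm_mult)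
      then show ?thesis using hw by (simp add: field_simps)
    qed
    ultimately show ?thesis using hw by simp
  next
    case True
    then obtain a where a: "norm a < s" "h a = 0" by auto
    have a1: "norm a < 1" using a s by simp
    have a0: "a \<noteq> 0" using a h0 by auto
    define H where "H = (\<lambda>z. h z * (1 - cnj a * z))"
    have holH: "H holomorphic_on ball 0 1" unfolding H_def by (intro holomorphic_intros hol)
    define k where "k = (\<lambda>z. if z = a then deriv H a else H z / (z - a))"
    have holk: "k holomorphic_on ball 0 1"
    proof (rule pole_theorem_open_0[OF holH open_ball])
      show "H z = (z - a) * k z" if "z \<in> ball 0 1 - {a}" for z using that by (auto simp: k_def)
      show "k a = deriv H a" "H a = 0" using a by (auto simp: k_def H_def)
    qed
    have den: "1 - cnj a * z \<noteq> 0" if "norm z < 1" for z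
    proof
      assume "1 - cnj a * z = 0"
      then have "norm (cnj a * z) = 1" by simp
      moreover have "norm (cnj a * z) < 1"
        using norm_mult_less[of "cnj a" 1 z 1] that a1 by simp
      ultimately show False by simp
    qed
    \<comment> \<open>|(z - a) / (1 - cnj a z)| dominates every function bounded by 1 that vanishes at a,
        so dividing a Blaschke factor out of h and g keeps both bounds.\<close>
    have divide: "norm (f z * (1 - cnj a * z) / (z - a)) \<le> 1"
      if f: "f holomorphic_on ball 0 1" "\<And>z. norm z < 1 \<Longrightarrow> norm (f z) \<le> 1" "f a = 0"
        and z: "norm z < 1" "z \<noteq> a" for f z
    proof -
      have "norm (f z) \<le> norm ((z - a) / (1 - cnj a * z))"
        using norm_le_Moebius_at_zero[OF f(1,2) a1 f(3) z(1)]
        by (simp add: Moebius_function_simple)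
      then have "norm (f z) * norm (1 - cnj a * z) \<le> norm (z - a)"
        using den[OF z(1)] by (simp add: norm_divide divide_simps split: if_splits)
      then show ?thesis using z by (simp add: norm_divide norm_mult del: complex_cnj_mult)
    qed
    have kle: "norm (k z) \<le> 1" if z: "norm z < 1" for z
    proof (cases "z = a")
      case True
      show ?thesis unfolding True
        by (rule norm_le_at_puncture[OF holk]) (use a1 divide[OF hol(2) hle a(2)] in \<open>auto simp: k_def H_def\<close>)
    qed (use divide[OF hol(2) hle a(2) z] in \<open>auto simp: k_def H_def\<close>)
    have ga: "g a = 0" using eq[OF a1] a by simp
    have uk: "norm (u z * k z) \<le> 1" if z: "norm z < 1" "z \<noteq> a" for z
      using divide[OF hol(1) gle ga z] z eq[OF z(1)] by (simp add: k_def H_def mult.assoc[symmetric])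
    have ukle: "norm (u z * k z) \<le> 1" if z: "norm z < 1" for z
    proof (cases "z = a")
      case True
      have "(\<lambda>z. u z * k z) holomorphic_on ball 0 1" by (intro holomorphic_intros hol holk)
      then show ?thesis unfolding True
        by (rule norm_le_at_puncture) (use a1 uk in auto)
    qed (use uk z in auto)
    have k0: "norm (k 0) = norm (h 0) / norm a" using a0 by (simp add: k_def H_def norm_divide)
    have k0s: "norm (k 0) > s ^ n"
    proof -
      have "s ^ n * norm a \<le> s ^ n * s" using a s by (intro mult_left_mono) auto
      also have "\<dots> < norm (h 0)" using Suc.prems(7) by (simp add: mult.commute)
      finally show ?thesis using a0 by (simp add: k0 field_simps)
    qed
    have k0h: "norm (k 0) \<ge> norm (h 0)"
      using a0 a1 h0 by (simp add: k0 field_simps mult_left_le)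
    have "norm (u w) \<le> exp ((s + norm w) / (s - norm w) * ln (1 / norm (k 0)))"
      by (rule Suc.IH[of "\<lambda>z. u z * k z" k])
         (use holk hol kle ukle k0s in \<open>auto intro!: holomorphic_intros\<close>)
    also have "\<dots> \<le> exp ((s + norm w) / (s - norm w) * ln (1 / norm (h 0)))"
    proof -
      have "ln (1 / norm (k 0)) \<le> ln (1 / norm (h 0))"
        using k0h h0 order_less_le_trans[of 0 "norm (h 0)" "norm (k 0)"] by (simp add: ln_div)
      moreover have "(s + norm w) / (s - norm w) \<ge> 0" using w s by simp
      ultimately show ?thesis using mult_left_mono exp_le_cancel_iff by blast
    qed
    finally show ?thesis .
  qed
qed

lemma quotient_bound_disc:
  assumes "g holomorphic_on ball 0 1" "h holomorphic_on ball 0 1" "u holomorphic_on ball 0 1"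
    and "\<And>z. norm z < 1 \<Longrightarrow> norm (g z) \<le> 1" "\<And>z. norm z < 1 \<Longrightarrow> norm (h z) \<le> 1"
    and "\<And>z. norm z < 1 \<Longrightarrow> u z * h z = g z" and h0: "h 0 \<noteq> 0" and w: "norm w < 1"
  shows "norm (u w) \<le> exp ((1 + norm w) / (1 - norm w) * ln (1 / norm (h 0)))"
proof -
  have *: "norm (u w) \<le> exp ((s + norm w) / (s - norm w) * ln (1 / norm (h 0)))"
    if s: "norm w < s" "s < 1" for s
  proof -
    have s0: "0 < s" using s(1) norm_ge_zero[of w] by linarith
    obtain n where "s ^ n < norm (h 0)"
      using real_arch_pow_inv[of "norm (h 0)" s] h0 s by auto
    then show ?thesis
      using quotient_bound_small_disc[OF s0 s(2) s(1) assms(1-6)] by blast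
  qed
  show ?thesis
  proof (rule tendsto_lowerbound)
    show "((\<lambda>s. exp ((s + norm w) / (s - norm w) * ln (1 / norm (h 0)))) \<longlongrightarrow>
        exp ((1 + norm w) / (1 - norm w) * ln (1 / norm (h 0)))) (at_left 1)"
      using w by (intro tendsto_intros) auto
    show "\<forall>\<^sub>F s in at_left 1. norm (u w) \<le> exp ((s + norm w) / (s - norm w) * ln (1 / norm (h 0)))"
      using eventually_at_left_real[OF w] * by (auto elim!: eventually_mono)
  qed simp
qed

text \<open>The growth of the exponential of a positive harmonic function in the upper half-plane: up to
constants, \<open>(1 + |z|\<^sup>2) / Im z\<close> dominates the Poisson kernel of every boundary point, infinity
included.\<close>

definition poisson_growth :: "(complex \<Rightarrow> complex) \<Rightarrow> bool" where
  "poisson_growth u \<longleftrightarrow>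
     (\<exists>C\<ge>0. \<forall>z. Im z > 0 \<longrightarrow> cmod (u z) \<le> exp (C * ((1 + (cmod z)\<^sup>2) / Im z)))"

text \<open>The Cayley transform \<open>w = (z - a) / (z - cnj a)\<close> centred at a point \<open>a\<close> with \<open>h a \<noteq> 0\<close> carries the
disc estimate to the half-plane, where
\<open>(1 + |w|) / (1 - |w|) \<le> |z - cnj a|\<^sup>2 / (Im z * Im a)\<close>.\<close>

lemma bounded_type_imp_poisson_growth:
  assumes "bounded_type u"
  shows "poisson_growth u"
proof -
  have UH: "upper_half = {z. Im z > 0}" by (simp add: upper_half_def)
  obtain g h where holu: "u holomorphic_on upper_half"
    and g: "g holomorphic_on upper_half" "bounded (g ` upper_half)"
    and h: "h holomorphic_on upper_half" "bounded (h ` upper_half)"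
    and ex: "\<exists>z\<in>upper_half. h z \<noteq> 0" and eq: "\<forall>z\<in>upper_half. u z * h z = g z"
    using assms unfolding bounded_type_def by blast
  obtain a where a: "Im a > 0" "h a \<noteq> 0" using ex by (auto simp: UH)
  obtain B1 B2 where B1: "\<And>z. Im z > 0 \<Longrightarrow> norm (g z) \<le> B1" and B2: "\<And>z. Im z > 0 \<Longrightarrow> norm (h z) \<le> B2"
    using g(2) h(2) unfolding bounded_iff by (auto simp: UH)
  define B where "B = max 1 (max B1 B2)"
  have B: "B \<ge> 1" "\<And>z. Im z > 0 \<Longrightarrow> norm (g z) \<le> B" "\<And>z. Im z > 0 \<Longrightarrow> norm (h z) \<le> B"
    using B1 B2 by (force simp: B_def)+
  define m where "m = (\<lambda>w. (a - cnj a * w) / (1 - w))"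
  have Im_m: "Im (m w) > 0" if w: "norm w < 1" for w
  proof -
    have w1: "1 - w \<noteq> 0" using w by auto
    have "Im (m w) = Im ((a - cnj a * w) * cnj (1 - w)) / (norm (1 - w))\<^sup>2"
      unfolding m_def by (subst complex_div_cnj) (simp add: Im_divide_of_real flip: of_real_power)
    also have "Im ((a - cnj a * w) * cnj (1 - w)) = Im a * (1 - (norm w)\<^sup>2)"
      unfolding cmod_power2 by (simp add: power2_eq_square algebra_simps)
    finally show ?thesis
      using a w w1 by (simp add: abs_square_less_1)
  qed
  have holm: "m holomorphic_on ball 0 1"
    unfolding m_def by (intro holomorphic_intros) auto
  have comp: "(\<lambda>w. f (m w)) holomorphic_on ball 0 1" if "f holomorphic_on upper_half" for f
    by (rule holomorphic_on_compose_gen[OF holm that, unfolded o_def]) (auto simp: UH Im_m)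
  define c where "c = ln (1 / norm (h a / of_real B))"
  have ha: "norm (h a / of_real B) \<le> 1" "h a / of_real B \<noteq> 0"
    using B(1) B(3)[OF a(1)] a(2) by (auto simp: norm_divide)
  have c0: "c \<ge> 0" unfolding c_def using ha by (intro ln_ge_zero) (simp add: field_simps)
  have main: "norm (u z) \<le> exp (c * ((norm (z - cnj a))\<^sup>2 / (Im z * Im a)))" if z: "Im z > 0" for z
  proof -
    have zne: "z - cnj a \<noteq> 0" using z a by (auto simp: complex_eq_iff)
    define w where "w = (z - a) / (z - cnj a)"
    have id: "(norm (z - cnj a))\<^sup>2 - (norm (z - a))\<^sup>2 = 4 * Im z * Im a"
      unfolding cmod_power2 by (simp add: power2_eq_square algebra_simps)
    then have w2: "1 - (norm w)\<^sup>2 = 4 * Im z * Im a / (norm (z - cnj a))\<^sup>2"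
      using zne by (simp add: w_def norm_divide power_divide diff_divide_eq_iff)
    have "1 - (norm w)\<^sup>2 > 0" unfolding w2 using z a zne by simp
    then have w1: "norm w < 1" by (simp add: abs_square_less_1)
    have mw: "m w = z"
    proof -
      have aa: "a - cnj a \<noteq> 0" using a by (simp add: complex_eq_iff)
      have 1: "1 - w = (a - cnj a) / (z - cnj a)" using zne by (simp add: w_def field_simps)
      have 2: "a - cnj a * w = z * ((a - cnj a) / (z - cnj a))" using zne by (simp add: w_def field_simps)
      show ?thesis unfolding m_def 1 2 using zne aa by simp
    qed
    have "norm (u (m w)) \<le> exp ((1 + norm w) / (1 - norm w) * ln (1 / norm (h (m 0) / of_real B)))"
    proof (rule quotient_bound_disc[of "\<lambda>w. g (m w) / of_real B" "\<lambda>w. h (m w) / of_real B" "\<lambda>w. u (m w)"])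
      show "(\<lambda>w. g (m w) / of_real B) holomorphic_on ball 0 1"
        "(\<lambda>w. h (m w) / of_real B) holomorphic_on ball 0 1" "(\<lambda>w. u (m w)) holomorphic_on ball 0 1"
        using B(1) by (auto intro!: holomorphic_intros comp g h holu)
      fix z :: complex assume z: "norm z < 1"
      show "norm (g (m z) / of_real B) \<le> 1" "norm (h (m z) / of_real B) \<le> 1"
        using B Im_m[OF z] by (auto simp: norm_divide)
      show "u (m z) * (h (m z) / of_real B) = g (m z) / of_real B"
        using eq Im_m[OF z] by (simp add: UH)
    next
      show "h (m 0) / of_real B \<noteq> 0" using ha by (simp add: m_def)
    qed (rule w1)
    also have "\<dots> = exp ((1 + norm w) / (1 - norm w) * c)" by (simp add: m_def c_def)
    also have "\<dots> \<le> exp (c * ((norm (z - cnj a))\<^sup>2 / (Im z * Im a)))"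
    proof -
      have "(1 + norm w) / (1 - norm w) = (1 + norm w)\<^sup>2 / (1 - (norm w)\<^sup>2)"
      proof -
        have "1 - (norm w)\<^sup>2 = (1 - norm w) * (1 + norm w)" "1 + norm w \<noteq> 0"
          using norm_ge_zero[of w] by (simp add: power2_eq_square algebra_simps, linarith)
        then show ?thesis by (simp add: power2_eq_square)
      qed
      also have "\<dots> \<le> 2\<^sup>2 / (1 - (norm w)\<^sup>2)"
        using w1 \<open>1 - (norm w)\<^sup>2 > 0\<close> by (intro divide_right_mono power_mono) auto
      also have "\<dots> = (norm (z - cnj a))\<^sup>2 / (Im z * Im a)"
        unfolding w2 using zne z a by (simp add: field_simps)
      finally have "(1 + norm w) / (1 - norm w) \<le> (norm (z - cnj a))\<^sup>2 / (Im z * Im a)" .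
      from mult_left_mono[OF this c0] show ?thesis by (simp add: mult.commute)
    qed
    finally show ?thesis by (simp add: mw)
  qed
  define C where "C = c * (2 * (1 + (norm a)\<^sup>2) / Im a)"
  have "norm (u z) \<le> exp (C * ((1 + (norm z)\<^sup>2) / Im z))" if z: "Im z > 0" for z
  proof -
    have "(norm (z - cnj a))\<^sup>2 \<le> (norm z + norm a)\<^sup>2"
      using norm_triangle_ineq4[of z "cnj a"] by (intro power_mono) auto
    also have "\<dots> \<le> 2 * (norm z)\<^sup>2 + 2 * (norm a)\<^sup>2"
      using sum_squares_bound[of "norm z" "norm a"] by (simp add: power2_sum)
    also have "\<dots> \<le> 2 * (1 + (norm a)\<^sup>2) * (1 + (norm z)\<^sup>2)"
      by (simp add: algebra_simps)
    finally have "(norm (z - cnj a))\<^sup>2 / (Im z * Im a) \<le>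
        2 * (1 + (norm a)\<^sup>2) * (1 + (norm z)\<^sup>2) / (Im z * Im a)"
      using z a by (intro divide_right_mono) auto
    then have "c * ((norm (z - cnj a))\<^sup>2 / (Im z * Im a)) \<le> C * ((1 + (norm z)\<^sup>2) / Im z)"
      using mult_left_mono[OF _ c0] by (fastforce simp: C_def field_simps)
    then show ?thesis using main[OF z] by (meson exp_le_cancel_iff order_trans)
  qed
  moreover have "C \<ge> 0" using c0 a by (simp add: C_def)
  ultimately show ?thesis unfolding poisson_growth_def by blast
qed

section \<open>A Phragmen-Lindelof principle in the upper half-plane\<close>

lemma le_limit_at_right_0:
  fixes f :: "real \<Rightarrow> real"
  assumes "(f \<longlongrightarrow> L) (at_right 0)" and "\<And>\<epsilon>. \<epsilon> > 0 \<Longrightarrow> c \<le> f \<epsilon>"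
  shows "c \<le> L"
  using assms(1)
proof (rule tendsto_lowerbound)
  show "\<forall>\<^sub>F \<epsilon> in at_right 0. c \<le> f \<epsilon>"
    using eventually_at_right_less[of "0::real"] by (rule eventually_mono) (rule assms(2))
qed simp

context
  fixes D T :: "complex set" and u p :: "complex \<Rightarrow> complex" and M :: real
  assumes D: "open D" "closed T" "D \<subseteq> T"
    and p: "p holomorphic_on UNIV" "\<And>z. z \<in> D \<Longrightarrow> Im (p z) > 0" "\<And>\<rho>. bounded {z \<in> D. cmod (p z) \<le> \<rho>}"
    and u: "continuous_on T u" "u holomorphic_on D"
    and M: "M > 0" "\<And>z. z \<in> T - D \<Longrightarrow> cmod (u z) \<le> M"
begin

text \<open>The majorant is explicit: \<open>\<Psi> \<rho> w = \<rho>\<^sup>2 * Im w * (1 / |w - \<rho>|\<^sup>2 + 1 / |w + \<rho>|\<^sup>2)\<close> is positive and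
harmonic in the half-disc \<open>|w| < \<rho>\<close>, \<open>Im w > 0\<close>, equals \<open>|w|\<^sup>2 / Im w\<close> on the arc \<open>|w| = \<rho>\<close>, and tends
to \<open>2 * Im w\<close> as \<open>\<rho>\<close> tends to infinity. The maximum principle compares \<open>ln |u|\<close> with
\<open>ln M + c * \<Psi> \<rho> (p z)\<close>. The map \<open>p\<close> lets the same argument serve a half-plane, with \<open>p z = z\<close>, and
the two quadrants, with \<open>p z = \<plusminus> z\<^sup>2\<close>.\<close>

lemma phragmen_lindelof:
  assumes growth: "\<And>z. z \<in> D \<Longrightarrow> R \<le> cmod (p z) \<Longrightarrow> cmod (u z) \<le> M * exp (c * ((cmod (p z))\<^sup>2 / Im (p z)))"
    and c: "c \<ge> 0" and z: "z \<in> D"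
  shows "cmod (u z) \<le> M * exp (2 * c * Im (p z))"
proof -
  define \<Psi> where "\<Psi> = (\<lambda>\<rho> w. \<rho>\<^sup>2 * (Im w / ((Re w - \<rho>)\<^sup>2 + (Im w)\<^sup>2) + Im w / ((Re w + \<rho>)\<^sup>2 + (Im w)\<^sup>2)))"
  have \<Psi>0: "\<Psi> \<rho> w \<ge> 0" if "Im w > 0" for \<rho> w using that by (simp add: \<Psi>_def)
  have \<Psi>_circle: "\<Psi> \<rho> w = (cmod w)\<^sup>2 / Im w" if w: "Im w > 0" "cmod w = \<rho>" for \<rho> w
  proof -
    define x where "x = Re w"
    define y where "y = Im w"
    have r: "\<rho>\<^sup>2 = x\<^sup>2 + y\<^sup>2" using cmod_power2[of w] w(2) by (simp add: x_def y_def)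
    have y: "y > 0" using w by (simp add: y_def)
    have ne: "(x - \<rho>)\<^sup>2 + y\<^sup>2 \<noteq> 0" "(x + \<rho>)\<^sup>2 + y\<^sup>2 \<noteq> 0"
      using y by (simp_all add: sum_power2_eq_zero_iff)
    have prod: "((x - \<rho>)\<^sup>2 + y\<^sup>2) * ((x + \<rho>)\<^sup>2 + y\<^sup>2) = 4 * \<rho>\<^sup>2 * y\<^sup>2" using r by algebra
    have sum: "((x - \<rho>)\<^sup>2 + y\<^sup>2) + ((x + \<rho>)\<^sup>2 + y\<^sup>2) = 4 * \<rho>\<^sup>2" using r by algebra
    have "y / ((x - \<rho>)\<^sup>2 + y\<^sup>2) + y / ((x + \<rho>)\<^sup>2 + y\<^sup>2)
        = y * (((x - \<rho>)\<^sup>2 + y\<^sup>2) + ((x + \<rho>)\<^sup>2 + y\<^sup>2)) / (((x - \<rho>)\<^sup>2 + y\<^sup>2) * ((x + \<rho>)\<^sup>2 + y\<^sup>2))"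
      using ne by (simp add: add_frac_eq distrib_left) (simp add: algebra_simps)?
    also have "\<dots> = 1 / y" unfolding prod sum using y r sum_power2_gt_zero_iff[of x y] by (simp add: power2_eq_square[of y])
    finally show ?thesis using w by (simp add: \<Psi>_def x_def y_def)
  qed
  define \<Phi> where "\<Phi> = (\<lambda>\<rho> w. \<i> * of_real (\<rho>\<^sup>2) * (inverse (w - of_real \<rho>) + inverse (w + of_real \<rho>)))"
  have Re\<Phi>: "Re (\<Phi> \<rho> w) = \<Psi> \<rho> w" for \<rho> w
    by (simp add: \<Phi>_def \<Psi>_def algebra_simps)
  have u_contD: "continuous_on D u" using u(1) D(3) continuous_on_subset by blast
  have cont_p: "continuous_on A p" for A
    using holomorphic_on_imp_continuous_on[OF p(1)] continuous_on_subset by blast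
  have claim: "cmod (u z) \<le> (M + \<epsilon>) * exp (c * \<Psi> \<rho> (p z))"
    if \<epsilon>: "\<epsilon> > 0" and \<rho>: "\<rho> > R" "\<rho> > cmod (p z)" for \<epsilon> \<rho>
  proof (cases "cmod (u z) \<le> M + \<epsilon>")
    case True
    have "(M + \<epsilon>) * 1 \<le> (M + \<epsilon>) * exp (c * \<Psi> \<rho> (p z))"
      using M \<epsilon> c \<Psi>0[OF p(2)[OF z]] by (intro mult_left_mono) auto
    with True show ?thesis by simp
  next
    case False
    \<comment> \<open>The condition |u| > M + \<epsilon> keeps the closure of S inside D, and so away from the points
      where the majorant is singular.\<close>
    define S where "S = {z \<in> D. cmod (p z) < \<rho> \<and> M + \<epsilon> < cmod (u z)}"
    have zS: "z \<in> S" using False z \<rho> by (simp add: S_def)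
    have "open ({z \<in> D. cmod (p z) < \<rho>} \<inter> {z \<in> D. M + \<epsilon> < cmod (u z)})"
    proof (intro open_Int)
      show "open {z \<in> D. cmod (p z) < \<rho>}"
        using continuous_open_preimage[OF continuous_on_norm[OF cont_p] D(1), of "{..<\<rho>}" ]
        by (simp add: vimage_def Int_def)
      show "open {z \<in> D. M + \<epsilon> < cmod (u z)}"
        using continuous_open_preimage[OF continuous_on_norm[OF u_contD] D(1), of "{M + \<epsilon><..}"]
        by (simp add: vimage_def Int_def)
    qed
    also have "{z \<in> D. cmod (p z) < \<rho>} \<inter> {z \<in> D. M + \<epsilon> < cmod (u z)} = S" by (auto simp: S_def)
    finally have openS: "open S" .
    define Q where "Q = {z \<in> T. cmod (p z) \<le> \<rho>} \<inter> {z \<in> T. M + \<epsilon> \<le> cmod (u z)}"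
    have "closed Q" unfolding Q_def
    proof (intro closed_Int)
      show "closed {z \<in> T. cmod (p z) \<le> \<rho>}"
        using continuous_closed_preimage[OF continuous_on_norm[OF cont_p] D(2), of "{..\<rho>}" ]
        by (simp add: vimage_def Int_def)
      show "closed {z \<in> T. M + \<epsilon> \<le> cmod (u z)}"
        using continuous_closed_preimage[OF continuous_on_norm[OF u(1)] D(2), of "{M + \<epsilon>..}"]
        by (simp add: vimage_def Int_def)
    qed
    moreover have "S \<subseteq> Q" using D(3) by (auto simp: S_def Q_def)
    ultimately have clS: "closure S \<subseteq> Q" by (simp add: closure_minimal)
    have QD: "Q \<subseteq> D" using M(2) \<epsilon> by (force simp: Q_def)
    define f where "f = (\<lambda>z. u z * exp (- (of_real c * \<Phi> \<rho> (p z))))"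
    have holf: "f holomorphic_on D" unfolding f_def \<Phi>_def
    proof (intro holomorphic_intros u(2) holomorphic_on_subset[OF p(1)] subset_UNIV)
      fix z assume "z \<in> D"
      with p(2) have "Im (p z) > 0" by auto
      then show "p z - of_real \<rho> \<noteq> 0" "p z + of_real \<rho> \<noteq> 0" by (auto simp: complex_eq_iff)
    qed
    have normf: "cmod (f z) = cmod (u z) * exp (- (c * \<Psi> \<rho> (p z)))" for z
      by (simp add: f_def norm_mult Re\<Phi>)
    have "cmod (f z) \<le> M + \<epsilon>"
    proof (rule maximum_modulus_frontier[of f S])
      show "f holomorphic_on interior S"
        by (rule holomorphic_on_subset[OF holf]) (use interior_subset S_def in auto)
      show "continuous_on (closure S) f"
        by (rule continuous_on_subset[OF holomorphic_on_imp_continuous_on[OF holf]]) (use clS QD in auto)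
      show "bounded S" by (rule bounded_subset[OF p(3)[of \<rho>]]) (auto simp: S_def)
      fix x assume "x \<in> frontier S"
      then have x: "x \<in> Q" "x \<in> D" "x \<notin> S" using clS QD openS by (auto simp: frontier_def interior_open)
      then have Im: "Im (p x) > 0" using p(2) by auto
      consider "cmod (u x) = M + \<epsilon>" | "cmod (p x) = \<rho>" using x by (force simp: Q_def S_def)
      then show "cmod (f x) \<le> M + \<epsilon>"
      proof cases
        case 1
        have "exp (- (c * \<Psi> \<rho> (p x))) \<le> 1" using c \<Psi>0[OF Im] by simp
        then have "(M + \<epsilon>) * exp (- (c * \<Psi> \<rho> (p x))) \<le> (M + \<epsilon>) * 1" using M \<epsilon> by (intro mult_left_mono) auto
        then show ?thesis by (simp add: normf 1)
      next
        case 2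
        have "cmod (u x) \<le> M * exp (c * \<Psi> \<rho> (p x))"
          using growth[OF x(2)] 2 \<rho> \<Psi>_circle[OF Im 2] by simp
        then have "cmod (f x) \<le> M * exp (c * \<Psi> \<rho> (p x)) * exp (- (c * \<Psi> \<rho> (p x)))"
          unfolding normf by (intro mult_right_mono) auto
        then show ?thesis using \<epsilon> by (simp add: mult.assoc flip: exp_add)
      qed
    qed (rule zS)
    then have "cmod (f z) * exp (c * \<Psi> \<rho> (p z)) \<le> (M + \<epsilon>) * exp (c * \<Psi> \<rho> (p z))"
      by (intro mult_right_mono) auto
    then show ?thesis by (simp add: normf mult.assoc flip: exp_add)
  qed
  have lim: "((\<lambda>\<rho>. \<Psi> \<rho> w) \<longlongrightarrow> 2 * Im w) at_top" for w
    unfolding \<Psi>_def by real_asymp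
  have "cmod (u z) \<le> (M + \<epsilon>) * exp (c * (2 * Im (p z)))" if \<epsilon>: "\<epsilon> > 0" for \<epsilon>
  proof (rule tendsto_lowerbound)
    show "((\<lambda>\<rho>. (M + \<epsilon>) * exp (c * \<Psi> \<rho> (p z))) \<longlongrightarrow> (M + \<epsilon>) * exp (c * (2 * Im (p z)))) at_top"
      by (intro tendsto_intros lim)
    show "\<forall>\<^sub>F \<rho> in at_top. cmod (u z) \<le> (M + \<epsilon>) * exp (c * \<Psi> \<rho> (p z))"
      using eventually_gt_at_top[of R] eventually_gt_at_top[of "cmod (p z)"]
      by eventually_elim (use claim[OF \<epsilon>] in auto)
  qed simp
  note * = this
  have "cmod (u z) \<le> (M + 0) * exp (c * (2 * Im (p z)))"
  proof (rule le_limit_at_right_0)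
    show "((\<lambda>\<epsilon>. (M + \<epsilon>) * exp (c * (2 * Im (p z)))) \<longlongrightarrow> (M + 0) * exp (c * (2 * Im (p z)))) (at_right 0)"
      by (intro tendsto_intros)
  qed (rule *)
  then show ?thesis by (simp add: mult_ac)
qed

lemma phragmen_lindelof_bounded:
  assumes growth: "\<And>c. c > 0 \<Longrightarrow> \<exists>\<rho>. \<forall>z\<in>D. \<rho> \<le> cmod (p z) \<longrightarrow> cmod (u z) \<le> M * exp (c * cmod (p z))"
    and z: "z \<in> D"
  shows "cmod (u z) \<le> M"
proof -
  have *: "cmod (u z) \<le> M * exp (2 * c * Im (p z))" if c: "c > 0" for c
  proof -
    obtain \<rho> where \<rho>: "\<And>z. z \<in> D \<Longrightarrow> \<rho> \<le> cmod (p z) \<Longrightarrow> cmod (u z) \<le> M * exp (c * cmod (p z))"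
      using growth[OF c] by blast
    show ?thesis
    proof (rule phragmen_lindelof[OF _ _ z, of \<rho>])
      fix x assume x: "x \<in> D" "\<rho> \<le> cmod (p x)"
      have "cmod (p x) * Im (p x) \<le> cmod (p x) * cmod (p x)"
        using abs_Im_le_cmod[of "p x"] by (intro mult_left_mono) auto
      then have "cmod (p x) \<le> (cmod (p x))\<^sup>2 / Im (p x)"
        using p(2)[OF x(1)] by (simp add: field_simps power2_eq_square)
      then have "c * cmod (p x) \<le> c * ((cmod (p x))\<^sup>2 / Im (p x))" using c by (intro mult_left_mono) auto
      then have "M * exp (c * cmod (p x)) \<le> M * exp (c * ((cmod (p x))\<^sup>2 / Im (p x)))"
        using M(1) by simp
      with \<rho>[OF x] show "cmod (u x) \<le> M * exp (c * ((cmod (p x))\<^sup>2 / Im (p x)))" by linarith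
    qed (use c in auto)
  qed
  have "cmod (u z) \<le> M * exp (2 * 0 * Im (p z))"
  proof (rule le_limit_at_right_0)
    show "((\<lambda>c. M * exp (2 * c * Im (p z))) \<longlongrightarrow> M * exp (2 * 0 * Im (p z))) (at_right 0)"
      by (intro tendsto_intros)
  qed (rule *)
  then show ?thesis by simp
qed

end

text \<open>Equivalent to \<open>mean_type u \<le> 0\<close> (lemma \<open>mean_type_le_0_iff\<close>), but without the case distinction at
zeros of \<open>u\<close>.\<close>

definition nonpos_type :: "(complex \<Rightarrow> complex) \<Rightarrow> bool" where
  "nonpos_type u \<longleftrightarrow> (\<forall>\<epsilon>>0. \<forall>\<^sub>F y in at_top. cmod (u (\<i> * of_real y)) \<le> exp (\<epsilon> * y))"

text \<open>Three applications of the Phragmen-Lindelof principle. The growth hypothesis is first improved to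
\<open>|V z| \<le> M * exp (4 * C * Im z)\<close>. Then \<open>W z = V z * exp (\<i> * \<epsilon> * z)\<close> is bounded on the imaginary
axis because of the mean type of \<open>V\<close>, hence in both quadrants, where it has order one and any order
below two would do. A bounded \<open>W\<close> is bounded by its supremum \<open>M\<close> on the real axis, and \<open>\<epsilon>\<close> tends
to \<open>0\<close>.\<close>

lemma bounded_upper_half_plane:
  assumes contV: "continuous_on {z. Im z \<ge> 0} V" and holV: "V holomorphic_on {z. Im z > 0}"
    and real: "\<And>z. Im z = 0 \<Longrightarrow> cmod (V z) \<le> M" and M: "M \<ge> 1"
    and growth: "poisson_growth V" and type: "nonpos_type V" and z: "Im z \<ge> 0"
  shows "cmod (V z) \<le> M"
proof -
  note half = open_halfspace_Im_gt[of 0] closed_halfspace_Im_ge[of 0]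
  obtain C where C: "C \<ge> 0" "\<And>z. Im z > 0 \<Longrightarrow> cmod (V z) \<le> exp (C * ((1 + (cmod z)\<^sup>2) / Im z))"
    using growth by (auto simp: poisson_growth_def)
  have expo: "cmod (V z) \<le> M * exp (4 * C * Im z)" if "Im z > 0" for z
  proof -
    have "cmod (V z) \<le> M * exp (2 * (2 * C) * Im z)"
    proof (rule phragmen_lindelof[where p = "\<lambda>z. z" and R = 1 and T = "{z. Im z \<ge> 0}" and D = "{z. Im z > 0}"])
      show "bounded {z \<in> {z. 0 < Im z}. cmod z \<le> \<rho>}" for \<rho>
        by (rule bounded_subset[of "cball 0 \<rho>"]) auto
      fix z assume z: "z \<in> {z. 0 < Im z}" "1 \<le> cmod z"
      have "1 + (cmod z)\<^sup>2 \<le> 2 * (cmod z)\<^sup>2" using z(2) by (simp add: one_le_power)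
      then have "C * ((1 + (cmod z)\<^sup>2) / Im z) \<le> C * (2 * (cmod z)\<^sup>2 / Im z)"
        using z C(1) by (intro mult_left_mono divide_right_mono) auto
      then have "cmod (V z) \<le> exp (2 * C * ((cmod z)\<^sup>2 / Im z))"
        using C(2)[of z] z by (simp add: mult.assoc order_trans)
      also have "\<dots> \<le> M * exp (2 * C * ((cmod z)\<^sup>2 / Im z))" using M by simp
      finally show "cmod (V z) \<le> M * exp (2 * C * ((cmod z)\<^sup>2 / Im z))" .
    qed (use half contV holV real M C that in \<open>auto intro!: holomorphic_intros\<close>)
    then show ?thesis by simp
  qed
  have expo0: "cmod (V z) \<le> M * exp (4 * C * Im z)" if "Im z \<ge> 0" for z
    using expo[of z] real[of z] that by (cases "Im z = 0") auto
  have eps: "cmod (V z) \<le> M * exp (\<epsilon> * Im z)" if \<epsilon>: "\<epsilon> > 0" for \<epsilon>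
  proof -
    define W where "W = (\<lambda>z. V z * exp (\<i> * of_real \<epsilon> * z))"
    have normW: "cmod (W z) = cmod (V z) * exp (- (\<epsilon> * Im z))" for z
      by (simp add: W_def norm_mult)
    have contW: "continuous_on {z. Im z \<ge> 0} W" unfolding W_def by (intro continuous_intros contV)
    have holW: "W holomorphic_on {z. Im z > 0}" unfolding W_def by (intro holomorphic_intros holV)
    have WV: "cmod (W z) \<le> cmod (V z)" if "Im z \<ge> 0" for z
      using that \<epsilon> by (simp add: normW mult_left_le)
    obtain Y where Y: "\<And>y. y \<ge> Y \<Longrightarrow> cmod (V (\<i> * of_real y)) \<le> exp (\<epsilon> * y)"
      using type \<epsilon> unfolding nonpos_type_def eventually_at_top_linorder by blast
    define M' where "M' = M * exp (4 * C * \<bar>Y\<bar>)"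
    have MM': "M \<le> M'" using M C(1) by (simp add: M'_def)
    have axis: "cmod (W z) \<le> M'" if z: "Re z = 0" "Im z \<ge> 0" for z
    proof (cases "Im z \<ge> Y")
      case True
      have "z = \<i> * of_real (Im z)" using z by (simp add: complex_eq_iff)
      then have "cmod (V z) \<le> exp (\<epsilon> * Im z)" using Y[OF True] by simp
      then have "cmod (W z) \<le> exp (\<epsilon> * Im z) * exp (- (\<epsilon> * Im z))"
        unfolding normW by (intro mult_right_mono) auto
      then show ?thesis using MM' M by (simp flip: exp_add)
    next
      case False
      have "cmod (V z) \<le> M * exp (4 * C * Im z)" using expo0 z by auto
      also have "\<dots> \<le> M'" unfolding M'_def using M C(1) False z by (simp add: mult_left_mono)
      finally show ?thesis using WV[of z] z by linarith
    qed
    have quadrant: "cmod (W z) \<le> M'" if \<sigma>: "\<sigma> = 1 \<or> \<sigma> = -1" and z: "\<sigma> * Re z > 0" "Im z > 0" for \<sigma> z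
    proof (rule phragmen_lindelof_bounded[where u = W and p = "\<lambda>z. of_real \<sigma> * z\<^sup>2" and D = "{z. \<sigma> * Re z > 0 \<and> Im z > 0}"
          and T = "{z. \<sigma> * Re z \<ge> 0 \<and> Im z \<ge> 0}"])
      show "open {z. 0 < \<sigma> * Re z \<and> 0 < Im z}" "closed {z. 0 \<le> \<sigma> * Re z \<and> 0 \<le> Im z}"
        by (intro open_Collect_conj open_Collect_less closed_Collect_conj closed_Collect_le continuous_intros)+
      show "bounded {z \<in> {z. 0 < \<sigma> * Re z \<and> 0 < Im z}. cmod (of_real \<sigma> * z\<^sup>2) \<le> \<rho>}" for \<rho>
      proof (rule bounded_subset[of "cball 0 (sqrt \<rho>)"])
        show "{z \<in> {z. 0 < \<sigma> * Re z \<and> 0 < Im z}. cmod (of_real \<sigma> * z\<^sup>2) \<le> \<rho>} \<subseteq> cball 0 (sqrt \<rho>)"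
          using \<sigma> by (auto simp: norm_mult norm_power intro!: real_le_rsqrt)
      qed auto
      show "continuous_on {z. 0 \<le> \<sigma> * Re z \<and> 0 \<le> Im z} W"
        by (rule continuous_on_subset[OF contW]) auto
      show "W holomorphic_on {z. 0 < \<sigma> * Re z \<and> 0 < Im z}"
        by (rule holomorphic_on_subset[OF holW]) auto
      show "M' > 0" using M MM' by linarith
      show "0 < Im (of_real \<sigma> * z\<^sup>2)" if "z \<in> {z. 0 < \<sigma> * Re z \<and> 0 < Im z}" for z
        using that mult_pos_pos[of "\<sigma> * Re z" "Im z"] by (simp add: power2_eq_square algebra_simps)
      show "cmod (W z) \<le> M'"
        if "z \<in> {z. 0 \<le> \<sigma> * Re z \<and> 0 \<le> Im z} - {z. 0 < \<sigma> * Re z \<and> 0 < Im z}" for z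
      proof -
        have "\<sigma> * Re z = 0 \<or> Im z = 0" "Im z \<ge> 0" using that by auto
        then have "Re z = 0 \<or> Im z = 0" "Im z \<ge> 0" using \<sigma> by auto
        then show ?thesis using axis[of z] WV[of z] real[of z] MM' by auto
      qed
      show "\<exists>\<rho>. \<forall>z\<in>{z. 0 < \<sigma> * Re z \<and> 0 < Im z}. \<rho> \<le> cmod (of_real \<sigma> * z\<^sup>2) \<longrightarrow>
          cmod (W z) \<le> M' * exp (c * cmod (of_real \<sigma> * z\<^sup>2))" if c: "c > 0" for c
      proof (intro exI ballI impI)
        fix z assume z: "z \<in> {z. 0 < \<sigma> * Re z \<and> 0 < Im z}" and "(4 * C / c)\<^sup>2 \<le> cmod (of_real \<sigma> * z\<^sup>2)"
        then have "(4 * C / c)\<^sup>2 \<le> (cmod z)\<^sup>2" using \<sigma> by (auto simp: norm_mult norm_power)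
        then have "4 * C / c \<le> cmod z" by (rule power2_le_imp_le) simp
        then have "4 * C * cmod z \<le> c * cmod z * cmod z" using c by (intro mult_right_mono) (auto simp: field_simps)
        then have *: "4 * C * cmod z \<le> c * cmod (of_real \<sigma> * z\<^sup>2)"
          using \<sigma> by (auto simp: norm_mult norm_power power2_eq_square mult.assoc)
        have "cmod (W z) \<le> M * exp (4 * C * Im z)" using WV[of z] expo0[of z] z by auto
        also have "\<dots> \<le> M * exp (4 * C * cmod z)"
          using M C(1) abs_Im_le_cmod[of z] by (simp add: mult_left_mono)
        also have "\<dots> \<le> M' * exp (c * cmod (of_real \<sigma> * z\<^sup>2))"
          using MM' M * by (intro mult_mono) auto
        finally show "cmod (W z) \<le> M' * exp (c * cmod (of_real \<sigma> * z\<^sup>2))" .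
      qed
    qed (use z in \<open>auto intro!: holomorphic_intros\<close>)
    have WM': "cmod (W z) \<le> M'" if "Im z > 0" for z
      using axis[of z] quadrant[of 1 z] quadrant[of "-1" z] that by (cases "Re z" "0::real" rule: linorder_cases) auto
    have WM: "cmod (W z) \<le> M" if z: "Im z > 0" for z
    proof (rule phragmen_lindelof_bounded[where u = W and p = "\<lambda>z. z" and D = "{z. Im z > 0}" and T = "{z. Im z \<ge> 0}"])
      show "bounded {z \<in> {z. 0 < Im z}. cmod z \<le> \<rho>}" for \<rho>
        by (rule bounded_subset[of "cball 0 \<rho>"]) auto
      show "cmod (W z) \<le> M" if "z \<in> {z. 0 \<le> Im z} - {z. 0 < Im z}" for z
        using WV[of z] real[of z] that by auto
      show "\<exists>\<rho>. \<forall>z\<in>{z. 0 < Im z}. \<rho> \<le> cmod z \<longrightarrow> cmod (W z) \<le> M * exp (c * cmod z)" if c: "c > 0" for c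
      proof (intro exI ballI impI)
        fix z assume z: "z \<in> {z. 0 < Im z}" and "4 * C * \<bar>Y\<bar> / c \<le> cmod z"
        then have "exp (4 * C * \<bar>Y\<bar>) \<le> exp (c * cmod z)" using c by (simp add: field_simps)
        then have "M' \<le> M * exp (c * cmod z)" using M by (simp add: M'_def)
        then show "cmod (W z) \<le> M * exp (c * cmod z)" using WM'[of z] z by auto
      qed
    qed (use half contW holW M z in \<open>auto intro!: holomorphic_intros\<close>)
    have "cmod (W z) \<le> M" using WM[of z] WV[of z] real[of z] z by (cases "Im z = 0") auto
    then have "cmod (W z) * exp (\<epsilon> * Im z) \<le> M * exp (\<epsilon> * Im z)" by (intro mult_right_mono) auto
    then show ?thesis by (simp add: normW mult.assoc flip: exp_add)
  qed
  have "cmod (V z) \<le> M * exp (0 * Im z)"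
  proof (rule le_limit_at_right_0)
    show "((\<lambda>\<epsilon>. M * exp (\<epsilon> * Im z)) \<longlongrightarrow> M * exp (0 * Im z)) (at_right 0)"
      by (intro tendsto_intros)
  qed (rule eps)
  then show ?thesis by simp
qed

section \<open>Vanishing of boundary integrals\<close>

lemma bounded_primitive_type:
  assumes V: "\<And>z. Im z \<ge> 0 \<Longrightarrow> (V has_field_derivative u z) (at z within {z. Im z \<ge> 0})"
    and u: "nonpos_type u" "continuous_on {z. Im z \<ge> 0} u"
  shows "nonpos_type V"
  unfolding nonpos_type_def
proof (intro allI impI)
  fix \<epsilon> :: real assume \<epsilon>: "\<epsilon> > 0"
  obtain Y where Y: "\<And>y. y \<ge> Y \<Longrightarrow> cmod (u (\<i> * of_real y)) \<le> exp (\<epsilon> / 2 * y)"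
    using u(1) half_gt_zero[OF \<epsilon>] unfolding nonpos_type_def eventually_at_top_linorder by blast
  define Y' where "Y' = max Y 0"
  have bound: "cmod (V (\<i> * of_real y)) \<le> cmod (V (\<i> * of_real Y')) + (y - Y') * exp (\<epsilon> / 2 * y)"
    if y: "y \<ge> Y'" for y
  proof -
    let ?S = "closed_segment (\<i> * of_real Y') (\<i> * of_real y)"
    have seg: "\<exists>t. x = \<i> * of_real t \<and> Y' \<le> t \<and> t \<le> y" if x: "x \<in> ?S" for x
    proof -
      obtain s where s: "0 \<le> s" "s \<le> 1" "x = (1 - s) *\<^sub>R (\<i> * of_real Y') + s *\<^sub>R (\<i> * of_real y)"
        using x unfolding in_segment by blast
      have "x = \<i> * of_real (Y' + s * (y - Y'))" unfolding s(3) by (simp add: complex_eq_iff algebra_simps)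
      moreover have "0 \<le> s * (y - Y')" "s * (y - Y') \<le> 1 * (y - Y')"
        using s y by (intro mult_nonneg_nonneg mult_right_mono; simp)+
      ultimately show ?thesis by (intro exI[of _ "Y' + s * (y - Y')"]) simp
    qed
    have "cmod (V (\<i> * of_real y) - V (\<i> * of_real Y')) \<le> exp (\<epsilon> / 2 * y) * cmod (\<i> * of_real y - \<i> * of_real Y')"
    proof (rule field_differentiable_bound[of ?S V u])
      fix x assume "x \<in> ?S"
      from seg[OF this] obtain t where t: "x = \<i> * of_real t" "Y' \<le> t" "t \<le> y" by blast
      have sub: "?S \<subseteq> {z. Im z \<ge> 0}"
      proof
        fix x assume "x \<in> ?S"
        from seg[OF this] show "x \<in> {z. Im z \<ge> 0}" by (auto simp: Y'_def)
      qed
      show "(V has_field_derivative u x) (at x within ?S)"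
        by (rule DERIV_subset[OF V sub]) (use t in \<open>auto simp: Y'_def\<close>)
      have "cmod (u x) \<le> exp (\<epsilon> / 2 * t)" using Y[of t] t by (auto simp: Y'_def)
      also have "\<dots> \<le> exp (\<epsilon> / 2 * y)" using t \<epsilon> by simp
      finally show "cmod (u x) \<le> exp (\<epsilon> / 2 * y)" .
    qed auto
    moreover have "cmod (\<i> * of_real y - \<i> * of_real Y') = y - Y'"
    proof -
      have "\<i> * of_real y - \<i> * of_real Y' = \<i> * of_real (y - Y')" by (simp add: algebra_simps)
      then show ?thesis using y by (simp only: norm_mult norm_ii norm_of_real) simp
    qed
    ultimately have "cmod (V (\<i> * of_real y) - V (\<i> * of_real Y')) \<le> (y - Y') * exp (\<epsilon> / 2 * y)"
      by (simp only: mult.commute)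
    then show ?thesis
      using norm_triangle_sub[of "V (\<i> * of_real y)" "V (\<i> * of_real Y')"] by linarith
  qed
  have "\<forall>\<^sub>F y in at_top. cmod (V (\<i> * of_real Y')) + (y - Y') * exp (\<epsilon> / 2 * y) \<le> exp (\<epsilon> * y)"
    using \<epsilon> by real_asymp
  then show "\<forall>\<^sub>F y in at_top. cmod (V (\<i> * of_real y)) \<le> exp (\<epsilon> * y)"
    using eventually_ge_at_top[of Y'] by eventually_elim (use bound in force)
qed

text \<open>On the segment from \<open>\<i>\<close> to \<open>z\<close> the quotient \<open>(1 + |w|\<^sup>2) / Im w\<close> is largest at \<open>z\<close>: with \<open>G\<close> its value
at \<open>z\<close>, the convex function \<open>1 + |w|\<^sup>2\<close> lies below the linear function \<open>G * Im w\<close> at both ends. So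
integrating \<open>u\<close> along that segment preserves the growth.\<close>

lemma poisson_growth_primitive:
  assumes V: "\<And>z. Im z \<ge> 0 \<Longrightarrow> (V has_field_derivative u z) (at z within {z. Im z \<ge> 0})"
    and u: "poisson_growth u"
  shows "poisson_growth V"
proof -
  obtain C where C: "C \<ge> 0" "\<And>z. Im z > 0 \<Longrightarrow> cmod (u z) \<le> exp (C * ((1 + (cmod z)\<^sup>2) / Im z))"
    using u by (auto simp: poisson_growth_def)
  define A where "A = ln (1 + cmod (V \<i>))"
  have A: "A \<ge> 0" "exp A = 1 + cmod (V \<i>)" by (auto simp: A_def add_pos_nonneg)
  have "cmod (V z) \<le> exp ((C + 2 + A) * ((1 + (cmod z)\<^sup>2) / Im z))" if z: "Im z > 0" for z
  proof -
    define G where "G = (1 + (cmod z)\<^sup>2) / Im z"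
    \<comment> \<open>G is at least |z| and at least 2, so exp (2 * G) absorbs the length of the segment.\<close>
    have Gz: "1 + (cmod z)\<^sup>2 = G * Im z" using z by (simp add: G_def)
    have nz: "cmod z > 0" using z by auto
    have "G \<ge> (1 + (cmod z)\<^sup>2) / cmod z"
      unfolding G_def using z abs_Im_le_cmod[of z] by (intro divide_left_mono mult_pos_pos) (auto simp: add_nonneg_nonneg)
    then have G1: "G * cmod z \<ge> 1 + (cmod z)\<^sup>2" using nz by (simp add: field_simps)
    have G2: "G \<ge> 2"
    proof (rule ccontr)
      assume "\<not> G \<ge> 2"
      then have "G * cmod z < 2 * cmod z" using nz by (intro mult_strict_right_mono) auto
      then show False using G1 sum_squares_bound[of 1 "cmod z"] by simp
    qed
    have "cmod z * cmod z \<le> G * cmod z" using G1 unfolding power2_eq_square by linarith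
    then have Gz1: "cmod z \<le> G" using nz by simp
    let ?S = "closed_segment \<i> z"
    have Simp: "x \<in> {z. Im z \<ge> 0} \<and> Im x > 0 \<and> 1 + (cmod x)\<^sup>2 \<le> G * Im x" if x: "x \<in> ?S" for x
    proof -
      obtain s where s: "0 \<le> s" "s \<le> 1" "x = (1 - s) *\<^sub>R \<i> + s *\<^sub>R z"
        using x unfolding in_segment by blast
      have Imx: "Im x = (1 - s) + s * Im z" using s by simp
      have "cmod x \<le> (1 - s) + s * cmod z"
        using norm_triangle_ineq[of "(1 - s) *\<^sub>R \<i>" "s *\<^sub>R z"] s by simp
      then have "(cmod x)\<^sup>2 \<le> ((1 - s) + s * cmod z)\<^sup>2" by (intro power_mono) auto
      also have "\<dots> \<le> (1 - s) + s * (cmod z)\<^sup>2"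
      proof -
        have "(1 - s) + s * (cmod z)\<^sup>2 - ((1 - s) + s * cmod z)\<^sup>2 = s * (1 - s) * (1 - cmod z)\<^sup>2"
          by (simp add: power2_eq_square algebra_simps)
        moreover have "s * (1 - s) * (1 - cmod z)\<^sup>2 \<ge> 0" using s by (intro mult_nonneg_nonneg) auto
        ultimately show ?thesis by linarith
      qed
      finally have "1 + (cmod x)\<^sup>2 \<le> (1 - s) * 2 + s * (1 + (cmod z)\<^sup>2)" by (simp add: algebra_simps)
      also have "\<dots> \<le> (1 - s) * G + s * (G * Im z)"
        using s G2 by (intro add_mono mult_left_mono) (auto simp: Gz)
      finally have *: "1 + (cmod x)\<^sup>2 \<le> G * Im x" by (simp add: Imx algebra_simps)
      have "G * Im x > 0" using * zero_le_power2[of "cmod x"] by linarith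
      then have "Im x > 0" using G2 by (simp add: zero_less_mult_iff)
      with * show ?thesis by auto
    qed
    have "cmod (V z - V \<i>) \<le> exp (C * G) * cmod (z - \<i>)"
    proof (rule field_differentiable_bound[of ?S V u])
      fix x assume x: "x \<in> ?S"
      show "(V has_field_derivative u x) (at x within ?S)"
      proof (rule DERIV_subset[OF V])
        show "Im x \<ge> 0" using Simp[OF x] by auto
        show "?S \<subseteq> {z. Im z \<ge> 0}" using Simp by blast
      qed
      have "(1 + (cmod x)\<^sup>2) / Im x \<le> G" using Simp[OF x] by (simp add: field_simps)
      then have "exp (C * ((1 + (cmod x)\<^sup>2) / Im x)) \<le> exp (C * G)" using C(1) by (simp add: mult_left_mono del: times_divide_eq_right)
      then show "cmod (u x) \<le> exp (C * G)" using C(2)[of x] Simp[OF x] by (meson order_trans)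
    qed auto
    also have "\<dots> \<le> exp (C * G) * (2 * G)"
    proof -
      have "cmod (z - \<i>) \<le> cmod z + 1" using norm_triangle_ineq4[of z \<i>] by simp
      then show ?thesis using Gz1 G2 by (intro mult_left_mono) auto
    qed
    also have "\<dots> \<le> exp (C * G) * (exp (2 * G) - 1)"
    proof (rule mult_left_mono)
      show "2 * G \<le> exp (2 * G) - 1" using exp_ge_add_one_self[of "2 * G"] by linarith
    qed simp
    finally have "cmod (V z) \<le> cmod (V \<i>) + exp (C * G) * (exp (2 * G) - 1)"
      using norm_triangle_sub[of "V z" "V \<i>"] by linarith
    also have "\<dots> \<le> (1 + cmod (V \<i>)) * (exp (C * G) * exp (2 * G))"
    proof -
      have "1 \<le> exp (C * G)" "1 \<le> exp (2 * G)" using C(1) G2 by auto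
      then have "1 * 1 \<le> exp (C * G) * exp (2 * G)" by (intro mult_mono) auto
      then have "cmod (V \<i>) * 1 \<le> cmod (V \<i>) * (exp (C * G) * exp (2 * G))"
        by (intro mult_left_mono) auto
      moreover have "exp (C * G) * (exp (2 * G) - 1) \<le> exp (C * G) * exp (2 * G)"
        by (intro mult_left_mono) auto
      ultimately show ?thesis by (simp only: distrib_right mult_1 mult_1_right)
    qed
    also have "\<dots> = exp (A + C * G + 2 * G)" by (simp add: A(2) exp_add)
    also have "\<dots> \<le> exp ((C + 2 + A) * G)"
    proof -
      have "A * 1 \<le> A * G" using A G2 by (intro mult_left_mono) auto
      then show ?thesis by (simp add: algebra_simps)
    qed
    finally show ?thesis by (simp add: G_def)
  qed
  moreover have "C + 2 + A \<ge> 0" using C(1) A by simp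
  ultimately show ?thesis unfolding poisson_growth_def by blast
qed

lemma real_line_FTC:
  assumes V: "\<And>z. Im z \<ge> 0 \<Longrightarrow> (V has_field_derivative u z) (at z within {z. Im z \<ge> 0})"
    and u: "continuous_on {z. Im z \<ge> 0} u" and ab: "a \<le> b"
  shows "(LINT t|lborel. indicator {a..b} t *\<^sub>R u (of_real t)) = V (of_real b) - V (of_real a)"
proof (rule integral_FTC_atLeastAtMost[OF ab])
  show "continuous_on {a..b} (\<lambda>t. u (of_real t))"
    by (rule continuous_on_compose2[OF u]) (auto intro!: continuous_intros)
  fix t
  have "(V \<circ> of_real has_vector_derivative (1 * u (of_real t))) (at t within {a..b})"
  proof (rule field_vector_diff_chain_within)
    show "((of_real :: real \<Rightarrow> complex) has_vector_derivative 1) (at t within {a..b})"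
      by (auto intro!: derivative_eq_intros)
    show "(V has_field_derivative u (of_real t)) (at (of_real t) within of_real ` {a..b})"
      by (rule DERIV_subset[OF V]) auto
  qed
  then show "((\<lambda>t. V (of_real t)) has_vector_derivative u (of_real t)) (at t within {a..b})"
    by (simp add: o_def)
qed

lemma convex_upper: "convex {z. Im z \<ge> 0}"
  by (rule convex_halfspace_Im_ge)

text \<open>A primitive \<open>V\<close> of \<open>u\<close> is bounded on the real axis, hence in the half-plane. With the cut-off
\<open>\<phi> T z = \<i> * T / (z + \<i> * T)\<close> one has \<open>u * \<phi> T = (V * \<phi> T)' - V * (\<phi> T)'\<close>. The integral of
\<open>u * \<phi> T\<close> over \<open>[-R, R]\<close> therefore consists of boundary terms of size \<open>O(T / R)\<close> and of the integral
of \<open>V * (\<phi> T)'\<close>, which is moved to the other three sides of a rectangle and is \<open>O(T / R)\<close> as well.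
With \<open>T = n + 2\<close> and \<open>R = T\<^sup>2\<close> both vanish in the limit, whereas \<open>\<phi> T\<close> tends boundedly to \<open>1\<close> on the
real axis.\<close>

lemma integral_eq_0_upper_half_plane:
  assumes cont: "continuous_on {z. Im z \<ge> 0} u" and hol: "u holomorphic_on {z. Im z > 0}"
    and growth: "poisson_growth u" and type: "nonpos_type u"
    and int: "integrable lborel (\<lambda>t. u (complex_of_real t))"
  shows "(LINT t|lborel. u (of_real t)) = 0"
proof -
  let ?H = "{z. Im z \<ge> 0}"
  have intH: "interior ?H = {z. Im z > 0}"
    using interior_halfspace_ge[of "\<i>::complex" 0] by (simp add: inner_complex_def)
  have diff: "f field_differentiable at x" if "f holomorphic_on {z. Im z > 0}" "x \<in> interior ?H - {}" for f x
    using that holomorphic_on_imp_differentiable_at[OF that(1) open_halfspace_Im_gt] by (auto simp: intH)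
  obtain V where V: "\<And>z. Im z \<ge> 0 \<Longrightarrow> (V has_field_derivative u z) (at z within ?H)"
    using holomorphic_convex_primitive[OF convex_upper _ cont, of "{}"] diff[OF hol] by auto
  have contV: "continuous_on ?H V" using V by (auto intro!: DERIV_continuous_on)
  have holV: "V holomorphic_on {z. Im z > 0}" unfolding holomorphic_on_def field_differentiable_def
  proof
    fix z assume z: "z \<in> {z. Im z > 0}"
    show "\<exists>f'. (V has_field_derivative f') (at z within {z. Im z > 0})"
      by (rule exI, rule DERIV_subset[OF V]) (use z in auto)
  qed
  define I where "I = (LINT t|lborel. cmod (u (of_real t)))"
  define M where "M = cmod (V 0) + I + 1"
  have realV: "cmod (V (of_real x)) \<le> M" for x :: real
  proof -
    have *: "cmod (V (of_real b) - V (of_real a)) \<le> I" if "a \<le> b" for a b :: real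
    proof -
      have eq: "V (of_real b) - V (of_real a) = (LINT t|lborel. indicator {a..b} t *\<^sub>R u (of_real t))"
        by (rule real_line_FTC[OF V cont that, symmetric])
      have "cmod (V (of_real b) - V (of_real a)) \<le> (LINT t|lborel. cmod (indicator {a..b} t *\<^sub>R u (of_real t)))"
        unfolding eq by (rule integral_norm_bound)
      also have "\<dots> \<le> I" unfolding I_def
      proof (rule integral_mono)
        show "integrable lborel (\<lambda>t. cmod (indicator {a..b} t *\<^sub>R u (of_real t)))"
          by (intro integrable_norm integrable_mult_indicator int) auto
      qed (use int in \<open>auto simp: indicator_def intro!: integrable_norm\<close>)
      finally show ?thesis .
    qed
    have "cmod (V (of_real x) - V 0) \<le> I"
      using *[of 0 x] *[of x 0] by (cases "x \<ge> 0") (auto simp: norm_minus_commute)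
    then show ?thesis using norm_triangle_sub[of "V (of_real x)" "V 0"] by (simp add: M_def)
  qed
  have I0: "I \<ge> 0" by (simp add: I_def)
  have M1: "M \<ge> 1" using I0 by (simp add: M_def)
  have VM: "cmod (V z) \<le> M" if "Im z \<ge> 0" for z
  proof (rule bounded_upper_half_plane[OF contV holV _ M1 poisson_growth_primitive[OF V growth] bounded_primitive_type[OF V type cont] that])
    show "cmod (V z) \<le> M" if "Im z = 0" for z
      using realV[of "Re z"] that by (simp add: complex_is_Real_iff)
  qed
  define \<phi> where "\<phi> = (\<lambda>T z. \<i> * of_real T / (z + \<i> * of_real T))"
  have den: "z + \<i> * of_real T \<noteq> 0" if "T > 0" "Im z \<ge> 0" for T z
    using that by (auto simp: complex_eq_iff)
  have est: "cmod (LINT t|lborel. indicator {-R..R} t *\<^sub>R (u (of_real t) * \<phi> T (of_real t)))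
      \<le> 2 * (M * T / (R - T)) + 4 * R * (M * T / (R - T)\<^sup>2)" if T: "T > 0" "T < R" for T R
  proof -
    have R: "R > 0" using T by simp
    define v where "v = (\<lambda>z. V z * (- \<i> * of_real T / (z + \<i> * of_real T)\<^sup>2))"
    have contv: "continuous_on ?H v" unfolding v_def
      by (intro continuous_intros contV) (use den[OF T(1)] in auto)
    have holv: "v holomorphic_on {z. Im z > 0}" unfolding v_def
      by (intro holomorphic_intros holV) (use den[OF T(1)] in auto)
    obtain P where P: "\<And>z. Im z \<ge> 0 \<Longrightarrow> (P has_field_derivative v z) (at z within ?H)"
      using holomorphic_convex_primitive[OF convex_upper _ contv, of "{}"] diff[OF holv] by auto
    define Q where "Q = (\<lambda>z. V z * \<phi> T z - P z)"
    have Q: "(Q has_field_derivative (u z * \<phi> T z)) (at z within ?H)" if z: "Im z \<ge> 0" for z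
    proof -
      have "(\<phi> T has_field_derivative (- \<i> * of_real T / (z + \<i> * of_real T)\<^sup>2)) (at z within ?H)"
        unfolding \<phi>_def using den[OF T(1) z]
        by (auto intro!: derivative_eq_intros simp: power2_eq_square)
      from DERIV_diff[OF DERIV_mult[OF V[OF z] this] P[OF z]]
      show ?thesis unfolding Q_def v_def by (rule DERIV_cong) (simp add: mult.commute)
    qed
    have intQ: "(LINT t|lborel. indicator {-R..R} t *\<^sub>R (u (of_real t) * \<phi> T (of_real t))) = Q (of_real R) - Q (of_real (-R))"
    proof (rule real_line_FTC[where u = "\<lambda>z. u z * \<phi> T z"])
      show "continuous_on ?H (\<lambda>z. u z * \<phi> T z)" unfolding \<phi>_def
        by (intro continuous_intros cont) (use den[OF T(1)] in auto)
    qed (use Q R in auto)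
    have far: "cmod (z + \<i> * of_real T) \<ge> R - T" if "cmod z \<ge> R" for z
      using norm_triangle_ineq4[of "z + \<i> * of_real T" "\<i> * of_real T"] that T by (simp add: norm_mult)
    have Vphi: "cmod (V z * \<phi> T z) \<le> M * T / (R - T)" if z: "Im z \<ge> 0" "cmod z \<ge> R" for z
    proof -
      have "cmod (V z) * T / cmod (z + \<i> * of_real T) \<le> M * T / (R - T)"
        using VM[OF z(1)] far[OF z(2)] T M1 by (intro frac_le mult_right_mono mult_nonneg_nonneg) auto
      then show ?thesis using T by (simp add: \<phi>_def norm_mult norm_divide)
    qed
    have vb: "cmod (v z) \<le> M * T / (R - T)\<^sup>2" if z: "Im z \<ge> 0" "cmod z \<ge> R" for z
    proof -
      have "cmod (V z) * T / (cmod (z + \<i> * of_real T))\<^sup>2 \<le> M * T / (R - T)\<^sup>2"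
        using VM[OF z(1)] far[OF z(2)] T M1 by (intro frac_le mult_right_mono mult_nonneg_nonneg power_mono) auto
      then show ?thesis using T by (simp add: v_def norm_mult norm_divide norm_power)
    qed
    have seg: "cmod (P b - P a) \<le> M * T / (R - T)\<^sup>2 * cmod (b - a)"
      if "\<And>z. z \<in> closed_segment a b \<Longrightarrow> Im z \<ge> 0 \<and> cmod z \<ge> R" for a b
      by (rule field_differentiable_bound[of "closed_segment a b" P v])
         (use that vb in \<open>auto intro!: DERIV_subset[OF P]\<close>)
    define p1 where "p1 = Complex R 0"
    define p2 where "p2 = Complex R R"
    define p3 where "p3 = Complex (-R) R"
    define p4 where "p4 = Complex (-R) 0"
    have R_le: "cmod z \<ge> R" if "\<bar>Re z\<bar> = R \<or> \<bar>Im z\<bar> = R" for z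
      using abs_Re_le_cmod[of z] abs_Im_le_cmod[of z] that by auto
    have s1: "cmod (P p1 - P p2) \<le> M * T / (R - T)\<^sup>2 * cmod (p1 - p2)"
    proof (rule seg)
      fix z assume "z \<in> closed_segment p2 p1"
      then obtain w where w: "0 \<le> w" "w \<le> 1" "z = (1 - w) *\<^sub>R p2 + w *\<^sub>R p1"
        unfolding in_segment by blast
      have "Re z = R" "Im z = (1 - w) * R" unfolding w(3) p1_def p2_def by (simp_all add: algebra_simps)
      then show "Im z \<ge> 0 \<and> cmod z \<ge> R" using R w(1,2) R_le[of z] by simp
    qed
    have s2: "cmod (P p2 - P p3) \<le> M * T / (R - T)\<^sup>2 * cmod (p2 - p3)"
    proof (rule seg)
      fix z assume "z \<in> closed_segment p3 p2"
      then obtain w where w: "0 \<le> w" "w \<le> 1" "z = (1 - w) *\<^sub>R p3 + w *\<^sub>R p2"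
        unfolding in_segment by blast
      have "Re z = w * R - (1 - w) * R" "Im z = R" unfolding w(3) p2_def p3_def by (simp_all add: algebra_simps)
      then show "Im z \<ge> 0 \<and> cmod z \<ge> R" using R w(1,2) R_le[of z] by simp
    qed
    have s3: "cmod (P p3 - P p4) \<le> M * T / (R - T)\<^sup>2 * cmod (p3 - p4)"
    proof (rule seg)
      fix z assume "z \<in> closed_segment p4 p3"
      then obtain w where w: "0 \<le> w" "w \<le> 1" "z = (1 - w) *\<^sub>R p4 + w *\<^sub>R p3"
        unfolding in_segment by blast
      have "Re z = - R" "Im z = w * R" unfolding w(3) p3_def p4_def by (simp_all add: algebra_simps)
      then show "Im z \<ge> 0 \<and> cmod z \<ge> R" using R w(1,2) R_le[of z] by simp
    qed
    have d: "cmod (p1 - p2) = R" "cmod (p2 - p3) = 2 * R" "cmod (p3 - p4) = R"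
      using R by (auto simp: p1_def p2_def p3_def p4_def cmod_def real_sqrt_mult)
    have "P p1 - P p4 = (P p1 - P p2) + (P p2 - P p3) + (P p3 - P p4)" by simp
    then have "cmod (P p1 - P p4) \<le> cmod (P p1 - P p2) + cmod (P p2 - P p3) + cmod (P p3 - P p4)"
      using norm_triangle_ineq[of "P p1 - P p2" "P p2 - P p3"]
        norm_triangle_ineq[of "(P p1 - P p2) + (P p2 - P p3)" "P p3 - P p4"] by simp
    also have "\<dots> \<le> 4 * R * (M * T / (R - T)\<^sup>2)" 
    proof -
      have "M * T / (R - T)\<^sup>2 * R + M * T / (R - T)\<^sup>2 * (2 * R) + M * T / (R - T)\<^sup>2 * R
          = 4 * R * (M * T / (R - T)\<^sup>2)" by algebra
      then show ?thesis using s1 s2 s3 unfolding d by linarith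
    qed
    finally have P14: "cmod (P p1 - P p4) \<le> 4 * R * (M * T / (R - T)\<^sup>2)" .
    have p14: "of_real R = p1" "of_real (-R) = p4" by (auto simp: p1_def p4_def complex_eq_iff)
    have "Im p1 \<ge> 0" "cmod p1 \<ge> R" "Im p4 \<ge> 0" "cmod p4 \<ge> R" using R by (auto simp: p1_def p4_def cmod_def)
    then have "cmod (V p1 * \<phi> T p1) \<le> M * T / (R - T)" "cmod (V p4 * \<phi> T p4) \<le> M * T / (R - T)"
      by (auto intro: Vphi)
    then have "cmod ((V p1 * \<phi> T p1 - V p4 * \<phi> T p4) - (P p1 - P p4)) \<le> 2 * (M * T / (R - T)) + 4 * R * (M * T / (R - T)\<^sup>2)"
      using norm_triangle_ineq4[of "V p1 * \<phi> T p1 - V p4 * \<phi> T p4" "P p1 - P p4"]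
        norm_triangle_ineq4[of "V p1 * \<phi> T p1" "V p4 * \<phi> T p4"] P14 by linarith
    moreover have "Q p1 - Q p4 = (V p1 * \<phi> T p1 - V p4 * \<phi> T p4) - (P p1 - P p4)"
      by (simp add: Q_def)
    ultimately show ?thesis unfolding intQ p14 by simp
  qed
  define s where "s = (\<lambda>n t. indicator {-((real n + 2)\<^sup>2)..(real n + 2)\<^sup>2} t *\<^sub>R (u (of_real t) * \<phi> (real n + 2) (of_real t)))"
  have meas: "(\<lambda>t. u (complex_of_real t)) \<in> borel_measurable borel"
    using borel_measurable_integrable[OF int] by simp
  have "(\<lambda>n. integral\<^sup>L lborel (s n)) \<longlonglongrightarrow> (LINT t|lborel. u (of_real t))"
  proof (rule integral_dominated_convergence[where w = "\<lambda>t. cmod (u (of_real t))"])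
    show "s n \<in> borel_measurable lborel" for n
    proof -
      have "continuous_on UNIV (\<lambda>t. \<phi> (real n + 2) (complex_of_real t))" unfolding \<phi>_def
        by (intro continuous_intros) (use den[of "real n + 2"] in auto)
      then have "(\<lambda>t. \<phi> (real n + 2) (complex_of_real t)) \<in> borel_measurable borel"
        by (rule borel_measurable_continuous_onI)
      then show ?thesis unfolding s_def using meas by measurable
    qed
    show "AE t in lborel. (\<lambda>n. s n t) \<longlonglongrightarrow> u (of_real t)"
    proof (rule AE_I2)
      fix t :: real
      have "(\<lambda>n. \<phi> (real n + 2) (of_real t)) \<longlonglongrightarrow> 1"
      proof -
        have "(\<lambda>n. \<i> / (of_real t * of_real (inverse (real n + 2)) + \<i>)) \<longlonglongrightarrow> \<i> / (of_real t * of_real 0 + \<i>)"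
        proof (intro tendsto_intros)
          show "(\<lambda>n. inverse (real n + 2)) \<longlonglongrightarrow> 0" by real_asymp
        qed simp
        moreover have "\<i> / (of_real t * of_real (inverse (real n + 2)) + \<i>) = \<phi> (real n + 2) (of_real t)" for n
        proof -
          define a where "a = complex_of_real (real n + 2)"
          have a: "a \<noteq> 0" unfolding a_def of_real_eq_0_iff by linarith
          have "\<phi> (real n + 2) (of_real t) = (a * \<i>) / (a * (of_real t * inverse a + \<i>))"
          proof -
            have "a * (of_real t * inverse a + \<i>) = of_real t + \<i> * a" using a by (simp add: field_simps)
            then show ?thesis unfolding \<phi>_def a_def[symmetric] by (simp add: mult.commute)
          qed
          also have "\<dots> = \<i> / (of_real t * inverse a + \<i>)"
            using a by (rule nonzero_mult_divide_mult_cancel_left)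
          finally show ?thesis by (simp only: a_def of_real_inverse)
        qed
        ultimately show ?thesis by simp
      qed
      then have "(\<lambda>n. u (of_real t) * \<phi> (real n + 2) (of_real t)) \<longlonglongrightarrow> u (of_real t) * 1"
        by (intro tendsto_intros)
      moreover have "\<forall>\<^sub>F n in sequentially. u (of_real t) * \<phi> (real n + 2) (of_real t) = s n t"
      proof -
        have "filterlim (\<lambda>n. (real n + 2)\<^sup>2) at_top sequentially" by real_asymp
        then have "\<forall>\<^sub>F n in sequentially. \<bar>t\<bar> \<le> (real n + 2)\<^sup>2" by (simp add: filterlim_at_top)
        then show ?thesis by eventually_elim (auto simp: s_def indicator_def abs_le_iff)
      qed
      ultimately show "(\<lambda>n. s n t) \<longlonglongrightarrow> u (of_real t)"
        using Lim_transform_eventually by fastforce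
    qed
    show "AE t in lborel. cmod (s n t) \<le> cmod (u (of_real t))" for n
    proof (rule AE_I2)
      fix t :: real
      define a where "a = real n + 2"
      have a: "a > 0" by (simp add: a_def)
      have "cmod (\<i> * of_real a) \<le> cmod (of_real t + \<i> * of_real a)"
        using abs_Im_le_cmod[of "of_real t + \<i> * of_real a"] a by (simp add: norm_mult)
      then have "cmod (\<phi> (real n + 2) (of_real t)) \<le> 1"
        using den[OF a, of "of_real t"] unfolding a_def[symmetric] by (simp add: \<phi>_def norm_divide)
      then show "cmod (s n t) \<le> cmod (u (of_real t))"
        by (auto simp: s_def norm_mult indicator_def mult_left_le)
    qed
  qed (use meas int in auto)
  moreover have "(\<lambda>n. integral\<^sup>L lborel (s n)) \<longlonglongrightarrow> 0"
  proof (rule Lim_null_comparison)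
    let ?b = "\<lambda>n. 2 * (M * (real n + 2) / ((real n + 2)\<^sup>2 - (real n + 2)))
        + 4 * (real n + 2)\<^sup>2 * (M * (real n + 2) / ((real n + 2)\<^sup>2 - (real n + 2))\<^sup>2)"
    show "\<forall>\<^sub>F n in sequentially. norm (integral\<^sup>L lborel (s n)) \<le> ?b n"
    proof (rule always_eventually, rule allI)
      fix n
      have "real n + 2 < (real n + 2)\<^sup>2" by (simp add: power2_eq_square algebra_simps add_pos_nonneg)
      then show "norm (integral\<^sup>L lborel (s n)) \<le> ?b n" unfolding s_def by (intro est) auto
    qed
    show "?b \<longlonglongrightarrow> 0" by real_asymp
  qed
  ultimately show ?thesis using LIMSEQ_unique by blast
qed

section \<open>Riesz sequences in a semi-inner product space\<close>

text \<open>The carrier is a set of functions closed under pointwise operations, and the form may be degenerate: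
this fits spaces of functions that are not quotiented by the functions of norm zero.\<close>

locale semi_inner_space =
  fixes V :: "(complex \<Rightarrow> complex) set" and ip :: "(complex \<Rightarrow> complex) \<Rightarrow> (complex \<Rightarrow> complex) \<Rightarrow> complex"
  assumes zero: "(\<lambda>z. 0) \<in> V"
    and add: "f \<in> V \<Longrightarrow> g \<in> V \<Longrightarrow> (\<lambda>z. f z + g z) \<in> V"
    and scale: "f \<in> V \<Longrightarrow> (\<lambda>z. c * f z) \<in> V"
    and ip_add: "f \<in> V \<Longrightarrow> g \<in> V \<Longrightarrow> h \<in> V \<Longrightarrow> ip (\<lambda>z. f z + g z) h = ip f h + ip g h"
    and ip_scale: "f \<in> V \<Longrightarrow> h \<in> V \<Longrightarrow> ip (\<lambda>z. c * f z) h = c * ip f h"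
    and ip_cnj: "f \<in> V \<Longrightarrow> g \<in> V \<Longrightarrow> ip g f = cnj (ip f g)"
    and ip_nonneg: "f \<in> V \<Longrightarrow> Re (ip f f) \<ge> 0"
begin

definition nrm :: "(complex \<Rightarrow> complex) \<Rightarrow> real" where
  "nrm f = sqrt (Re (ip f f))"

lemma nrm_nonneg: "f \<in> V \<Longrightarrow> nrm f \<ge> 0"
  by (simp add: nrm_def ip_nonneg)

lemma ip_self: "f \<in> V \<Longrightarrow> ip f f = of_real ((nrm f)\<^sup>2)"
  using ip_cnj[of f f] ip_nonneg[of f] by (auto simp: nrm_def complex_eq_iff)

lemma diff: "f \<in> V \<Longrightarrow> g \<in> V \<Longrightarrow> (\<lambda>z. f z - g z) \<in> V"
  using add[of f "\<lambda>z. (-1) * g z"] scale[of g "-1"] by simp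

lemma ip_add_right: "f \<in> V \<Longrightarrow> g \<in> V \<Longrightarrow> h \<in> V \<Longrightarrow> ip h (\<lambda>z. f z + g z) = ip h f + ip h g"
  by (simp add: ip_cnj[of _ h] add ip_add)

lemma ip_scale_right: "f \<in> V \<Longrightarrow> h \<in> V \<Longrightarrow> ip h (\<lambda>z. c * f z) = cnj c * ip h f"
  by (simp add: ip_cnj[of _ h] scale ip_scale)

lemma nrm_scale: "f \<in> V \<Longrightarrow> nrm (\<lambda>z. c * f z) = cmod c * nrm f"
proof -
  assume f: "f \<in> V"
  have "ip (\<lambda>z. c * f z) (\<lambda>z. c * f z) = of_real ((cmod c)\<^sup>2 * (nrm f)\<^sup>2)"
    using f by (simp add: ip_scale ip_scale_right scale ip_self complex_mult_cnj cmod_power2 mult.assoc[symmetric])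
  then show ?thesis using nrm_nonneg[OF f] by (simp add: nrm_def[of "\<lambda>z. c * f z"] real_sqrt_mult)
qed

text \<open>Positivity of \<open>\<langle>f + c g, f + c g\<rangle>\<close> at \<open>c = - t \<langle>f, g\<rangle>\<close>. The choice \<open>t = 1 / \<parallel>g\<parallel>\<^sup>2\<close> is optimal, and
large \<open>t\<close> settle the case \<open>\<parallel>g\<parallel> = 0\<close>.\<close>

lemma cauchy_schwarz:
  assumes f: "f \<in> V" and g: "g \<in> V"
  shows "cmod (ip f g) \<le> nrm f * nrm g"
proof -
  have *: "2 * t * (cmod (ip f g))\<^sup>2 \<le> (nrm f)\<^sup>2 + t\<^sup>2 * (cmod (ip f g))\<^sup>2 * (nrm g)\<^sup>2" for t :: real
  proof -
    define c where "c = - of_real t * ip f g"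
    have cg: "(\<lambda>z. c * g z) \<in> V" using g by (rule scale)
    have "0 \<le> Re (ip (\<lambda>z. f z + c * g z) (\<lambda>z. f z + c * g z))"
      by (intro ip_nonneg add f cg)
    also have "ip (\<lambda>z. f z + c * g z) (\<lambda>z. f z + c * g z) =
        ip f f + cnj c * ip f g + (c * cnj (ip f g) + c * cnj c * ip g g)"
      using f g cg by (simp add: ip_add ip_add_right ip_scale ip_scale_right add ip_cnj[of f g] algebra_simps)
    also have "Re \<dots> = (nrm f)\<^sup>2 - 2 * t * (cmod (ip f g))\<^sup>2 + t\<^sup>2 * (cmod (ip f g))\<^sup>2 * (nrm g)\<^sup>2"
    proof -
      have 1: "cnj c * ip f g = - of_real (t * (cmod (ip f g))\<^sup>2)"
        by (simp only: of_real_mult complex_norm_square) (simp add: c_def mult_ac)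
      have 2: "c * cnj (ip f g) = - of_real (t * (cmod (ip f g))\<^sup>2)"
        by (simp only: of_real_mult complex_norm_square) (simp add: c_def mult_ac)
      have 3: "c * cnj c = of_real (t\<^sup>2 * (cmod (ip f g))\<^sup>2)"
        by (simp only: of_real_mult complex_norm_square) (simp add: c_def power2_eq_square mult_ac)
      show ?thesis unfolding 1 2 3 ip_self[OF f] ip_self[OF g] by (simp del: of_real_mult of_real_power flip: of_real_mult)
    qed
    finally show ?thesis by linarith
  qed
  define p where "p = (cmod (ip f g))\<^sup>2"
  have p: "2 * t * p \<le> (nrm f)\<^sup>2 + t\<^sup>2 * p * (nrm g)\<^sup>2" for t using * by (simp add: p_def)
  have "p \<le> (nrm f)\<^sup>2 * (nrm g)\<^sup>2"
  proof (cases "nrm g = 0")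
    case True
    have "p \<le> 0"
    proof (rule ccontr)
      assume "\<not> p \<le> 0"
      then show False using p[of "((nrm f)\<^sup>2 + 1) / p"] True zero_le_power2[of "nrm f"] by simp
    qed
    then show ?thesis using True by simp
  next
    case False
    define G where "G = (nrm g)\<^sup>2"
    have G: "G > 0" using False by (simp add: G_def)
    have "2 * (1 / G) * p \<le> (nrm f)\<^sup>2 + (1 / G)\<^sup>2 * p * G" using p[of "1 / G"] by (simp add: G_def)
    also have "(1 / G)\<^sup>2 * p * G = p / G" using G by (simp add: power2_eq_square)
    finally have "p / G \<le> (nrm f)\<^sup>2" by simp
    then show ?thesis using G by (simp add: pos_divide_le_eq G_def)
  qed
  then have "(cmod (ip f g))\<^sup>2 \<le> (nrm f * nrm g)\<^sup>2" by (simp add: p_def power_mult_distrib)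
  then show ?thesis by (rule power2_le_imp_le) (simp add: nrm_nonneg f g)
qed

lemma nrm_triangle:
  assumes f: "f \<in> V" and g: "g \<in> V"
  shows "nrm (\<lambda>z. f z + g z) \<le> nrm f + nrm g"
proof (rule power2_le_imp_le)
  have "(nrm (\<lambda>z. f z + g z))\<^sup>2 = Re (ip (\<lambda>z. f z + g z) (\<lambda>z. f z + g z))"
    by (simp add: nrm_def ip_nonneg add f g)
  also have "\<dots> = (nrm f)\<^sup>2 + (nrm g)\<^sup>2 + 2 * Re (ip f g)"
    using f g by (simp add: ip_add ip_add_right add ip_cnj[of f g] ip_self)
  also have "\<dots> \<le> (nrm f)\<^sup>2 + (nrm g)\<^sup>2 + 2 * (nrm f * nrm g)"
    using cauchy_schwarz[OF f g] complex_Re_le_cmod[of "ip f g"] by linarith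
  finally show "(nrm (\<lambda>z. f z + g z))\<^sup>2 \<le> (nrm f + nrm g)\<^sup>2" by (simp add: power2_sum)
qed (simp add: nrm_nonneg f g)

lemma nrm_minus_commute:
  assumes "f \<in> V" "g \<in> V"
  shows "nrm (\<lambda>z. f z - g z) = nrm (\<lambda>z. g z - f z)"
  using nrm_scale[OF diff[OF assms], of "-1"] by simp

lemma nrm_triangle_diff:
  assumes "f \<in> V" "g \<in> V" "h \<in> V"
  shows "nrm (\<lambda>z. f z - h z) \<le> nrm (\<lambda>z. f z - g z) + nrm (\<lambda>z. g z - h z)"
  using nrm_triangle[OF diff[OF assms(1,2)] diff[OF assms(2,3)]] by simp

lemma sum_in: "finite A \<Longrightarrow> (\<And>n. n \<in> A \<Longrightarrow> f n \<in> V) \<Longrightarrow> (\<lambda>z. \<Sum>n\<in>A. c n * f n z) \<in> V"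
  by (induction A rule: finite_induct) (auto intro!: zero add scale)

lemma ip_sum:
  assumes "finite A" "\<And>n. n \<in> A \<Longrightarrow> f n \<in> V" "h \<in> V"
  shows "ip (\<lambda>z. \<Sum>n\<in>A. c n * f n z) h = (\<Sum>n\<in>A. c n * ip (f n) h)"
  using assms
proof (induction A rule: finite_induct)
  case empty
  then show ?case using ip_scale[OF zero, of h 0] by simp
qed (simp add: ip_add ip_scale scale sum_in)

lemma ip_sum_right:
  assumes "finite A" "\<And>n. n \<in> A \<Longrightarrow> f n \<in> V" "h \<in> V"
  shows "ip h (\<lambda>z. \<Sum>n\<in>A. c n * f n z) = (\<Sum>n\<in>A. cnj (c n) * ip h (f n))"
  using assms by (simp add: ip_cnj[of _ h] sum_in ip_sum)

end

locale riesz_sequence = semi_inner_space +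
  fixes \<phi> :: "'i \<Rightarrow> complex \<Rightarrow> complex" and a b :: real
  assumes phi: "\<phi> n \<in> V" and a: "a > 0" and b: "b > 0"
    and lower: "finite A \<Longrightarrow> a * (\<Sum>n\<in>A. (cmod (c n))\<^sup>2) \<le> (nrm (\<lambda>z. \<Sum>n\<in>A. c n * \<phi> n z))\<^sup>2"
    and upper: "finite A \<Longrightarrow> (nrm (\<lambda>z. \<Sum>n\<in>A. c n * \<phi> n z))\<^sup>2 \<le> b * (\<Sum>n\<in>A. (cmod (c n))\<^sup>2)"
begin

abbreviation comb :: "'i set \<Rightarrow> ('i \<Rightarrow> complex) \<Rightarrow> complex \<Rightarrow> complex" where
  "comb A c z \<equiv> \<Sum>n\<in>A. c n * \<phi> n z"

abbreviation partial_sum :: "(nat \<Rightarrow> 'i) \<Rightarrow> (nat \<Rightarrow> complex) \<Rightarrow> nat \<Rightarrow> complex \<Rightarrow> complex" where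
  "partial_sum e c N z \<equiv> \<Sum>k<N. c k * \<phi> (e k) z"

text \<open>The coefficients vanish outside \<open>A\<close> so that two approximations can be compared on the union of their
index sets.\<close>

abbreviation approximates :: "'i set \<Rightarrow> ('i \<Rightarrow> complex) \<Rightarrow> (complex \<Rightarrow> complex) \<Rightarrow> real \<Rightarrow> bool" where
  "approximates A c f \<epsilon> \<equiv> finite A \<and> (\<forall>n. n \<notin> A \<longrightarrow> c n = 0) \<and> nrm (\<lambda>z. f z - comb A c z) < \<epsilon>"

definition closed_span :: "(complex \<Rightarrow> complex) set" where
  "closed_span = {f \<in> V. \<forall>\<epsilon>>0. \<exists>A c. approximates A c f \<epsilon>}"

lemma comb_in: "finite A \<Longrightarrow> (\<lambda>z. comb A c z) \<in> V"
  by (simp add: sum_in phi)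

lemma comb_superset:
  assumes "finite B" "A \<subseteq> B" "\<forall>n. n \<notin> A \<longrightarrow> c n = 0"
  shows "comb B c z = comb A c z"
  using assms by (intro sum.mono_neutral_right) auto

lemma closed_span_subset: "closed_span \<subseteq> V"
  by (auto simp: closed_span_def)

lemma nrm_zero: "nrm (\<lambda>z. 0) = 0"
  using ip_scale[OF zero zero, of 0] by (simp add: nrm_def)

lemma phi_in_closed_span: "\<phi> n \<in> closed_span"
  unfolding closed_span_def
proof (intro CollectI conjI allI impI phi)
  fix \<epsilon> :: real assume "\<epsilon> > 0"
  then show "\<exists>A c. approximates A c (\<phi> n) \<epsilon>"
    by (intro exI[of _ "{n}"] exI[of _ "\<lambda>m. if m = n then 1 else 0"]) (simp add: nrm_zero)
qed

lemma zero_in_closed_span: "(\<lambda>z. 0) \<in> closed_span"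
  unfolding closed_span_def
proof (intro CollectI conjI allI impI zero)
  fix \<epsilon> :: real assume "\<epsilon> > 0"
  then show "\<exists>A c. approximates A c (\<lambda>z. 0) \<epsilon>"
    by (intro exI[of _ "{}"] exI[of _ "\<lambda>m. 0"]) (simp add: nrm_zero)
qed

lemma add_in_closed_span:
  assumes f: "f \<in> closed_span" and g: "g \<in> closed_span"
  shows "(\<lambda>z. f z + g z) \<in> closed_span"
  unfolding closed_span_def
proof (intro CollectI conjI allI impI)
  have fV: "f \<in> V" "g \<in> V" using f g closed_span_subset by auto
  then show "(\<lambda>z. f z + g z) \<in> V" by (intro add)
  fix \<epsilon> :: real assume "\<epsilon> > 0"
  then have e2: "\<epsilon> / 2 > 0" by simp
  obtain A c where A: "finite A" "\<forall>n. n \<notin> A \<longrightarrow> c n = 0" "nrm (\<lambda>z. f z - comb A c z) < \<epsilon> / 2"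
    using f e2 unfolding closed_span_def by blast
  obtain B d where B: "finite B" "\<forall>n. n \<notin> B \<longrightarrow> d n = 0" "nrm (\<lambda>z. g z - comb B d z) < \<epsilon> / 2"
    using g e2 unfolding closed_span_def by blast
  have eq: "(\<Sum>n\<in>A \<union> B. (c n + d n) * \<phi> n z) = comb A c z + comb B d z" for z
    using comb_superset[of "A \<union> B" A c z] comb_superset[of "A \<union> B" B d z] A B
    by (simp add: distrib_right sum.distrib)
  have "nrm (\<lambda>z. (f z - comb A c z) + (g z - comb B d z)) < \<epsilon>"
    using nrm_triangle[OF diff[OF fV(1) comb_in[OF A(1), of c]] diff[OF fV(2) comb_in[OF B(1), of d]]] A B by linarith
  note * = this
  show "\<exists>A c. approximates A c (\<lambda>z. f z + g z) \<epsilon>"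
  proof (intro exI[of _ "A \<union> B"] exI[of _ "\<lambda>n. c n + d n"] conjI)
    show "nrm (\<lambda>z. f z + g z - (\<Sum>n\<in>A \<union> B. (c n + d n) * \<phi> n z)) < \<epsilon>"
      unfolding eq using * by (simp add: algebra_simps)
  qed (use A B in auto)
qed

lemma scale_in_closed_span:
  assumes f: "f \<in> closed_span"
  shows "(\<lambda>z. k * f z) \<in> closed_span"
  unfolding closed_span_def
proof (intro CollectI conjI allI impI)
  have fV: "f \<in> V" using f closed_span_subset by auto
  then show "(\<lambda>z. k * f z) \<in> V" by (rule scale)
  fix \<epsilon> :: real assume "\<epsilon> > 0"
  then have e2: "\<epsilon> / (cmod k + 1) > 0" by (simp add: add_nonneg_pos)
  obtain A c where A: "finite A" "\<forall>n. n \<notin> A \<longrightarrow> c n = 0"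
    "nrm (\<lambda>z. f z - comb A c z) < \<epsilon> / (cmod k + 1)"
    using f e2 unfolding closed_span_def by blast
  have "nrm (\<lambda>z. k * (f z - comb A c z)) = cmod k * nrm (\<lambda>z. f z - comb A c z)"
    by (rule nrm_scale[OF diff[OF fV comb_in[OF A(1)]]])
  also have "\<dots> \<le> (cmod k + 1) * nrm (\<lambda>z. f z - comb A c z)"
    by (intro mult_right_mono nrm_nonneg diff fV comb_in A) auto
  also have "\<dots> < \<epsilon>" using A(3) pos_less_divide_eq[of "cmod k + 1"] by (simp add: add_nonneg_pos mult.commute)
  finally show "\<exists>A c. approximates A c (\<lambda>z. k * f z) \<epsilon>"
    using A by (intro exI[of _ A] exI[of _ "\<lambda>n. k * c n"]) (simp add: sum_distrib_left mult.assoc right_diff_distrib)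
qed

lemma closed_span_closed:
  assumes f: "f \<in> V" and u: "\<And>n::nat. u n \<in> closed_span"
    and lim: "(\<lambda>n. nrm (\<lambda>z. u n z - f z)) \<longlonglongrightarrow> 0"
  shows "f \<in> closed_span"
  unfolding closed_span_def
proof (intro CollectI conjI allI impI f)
  fix \<epsilon> :: real assume "\<epsilon> > 0"
  then have e2: "\<epsilon> / 2 > 0" by simp
  have uV: "u n \<in> V" for n using u closed_span_subset by auto
  obtain n where n: "nrm (\<lambda>z. u n z - f z) < \<epsilon> / 2"
    using order_tendstoD(2)[OF lim e2] eventually_happens' sequentially_bot by blast
  obtain A c where A: "finite A" "\<forall>n. n \<notin> A \<longrightarrow> c n = 0" "nrm (\<lambda>z. u n z - comb A c z) < \<epsilon> / 2"
    using u[of n] e2 unfolding closed_span_def by blast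
  have "nrm (\<lambda>z. f z - comb A c z) < \<epsilon>"
    using nrm_triangle_diff[OF f uV comb_in[OF A(1), of c], of n] n A(3) nrm_minus_commute[OF f uV, of n] by linarith
  then show "\<exists>A c. approximates A c f \<epsilon>"
    using A by blast
qed

text \<open>Duality with the upper Riesz bound: \<open>f\<close> is tested against the sum of the \<open>\<langle>f, \<phi> n\<rangle> \<phi> n\<close> over \<open>A\<close>.\<close>

lemma bessel:
  assumes f: "f \<in> V" and A: "finite A"
  shows "(\<Sum>n\<in>A. (cmod (ip f (\<phi> n)))\<^sup>2) \<le> b * (nrm f)\<^sup>2"
proof -
  define S where "S = (\<Sum>n\<in>A. (cmod (ip f (\<phi> n)))\<^sup>2)"
  define g where "g = (\<lambda>z. \<Sum>n\<in>A. ip f (\<phi> n) * \<phi> n z)"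
  have g: "g \<in> V" unfolding g_def by (rule comb_in[OF A])
  have "ip f g = of_real S"
    unfolding g_def S_def using A phi f
    by (subst ip_sum_right) (auto simp: complex_norm_square mult_ac simp del: of_real_power)
  moreover have S0: "S \<ge> 0" by (simp add: S_def sum_nonneg)
  ultimately have "S \<le> nrm f * nrm g" using cauchy_schwarz[OF f g] by simp
  then have "S\<^sup>2 \<le> (nrm f)\<^sup>2 * (nrm g)\<^sup>2" using S0 power_mono[of S _ 2] by (fastforce simp: power_mult_distrib)
  also have "\<dots> \<le> (nrm f)\<^sup>2 * (b * S)"
    unfolding g_def S_def by (intro mult_left_mono upper A) auto
  finally have *: "S * S \<le> (b * (nrm f)\<^sup>2) * S" by (simp add: power2_eq_square mult_ac)
  have "S \<le> b * (nrm f)\<^sup>2"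
  proof (cases "S = 0")
    case False
    then show ?thesis using * S0 by simp
  qed (use b in auto)
  then show ?thesis by (simp add: S_def)
qed

lemma frame_summable: "f \<in> V \<Longrightarrow> (\<lambda>n. (cmod (ip f (\<phi> n)))\<^sup>2) summable_on UNIV"
  by (rule nonneg_bdd_above_summable_on) (auto intro!: bdd_aboveI2 bessel)

lemma frame_upper: "f \<in> V \<Longrightarrow> (\<Sum>\<^sub>\<infinity>n. (cmod (ip f (\<phi> n)))\<^sup>2) \<le> b * (nrm f)\<^sup>2"
  by (rule infsum_le_finite_sums) (auto intro!: frame_summable bessel)

text \<open>If \<open>g = \<Sum> c n \<phi> n\<close> approximates \<open>f\<close>, then \<open>\<parallel>f\<parallel>\<^sup>2\<close> is close to \<open>\<langle>f, g\<rangle>\<close>, which is at most the \<open>\<ell>\<^sup>2\<close>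
norm of \<open>c\<close> times that of the coefficients \<open>\<langle>f, \<phi> n\<rangle>\<close>. The lower Riesz bound controls the former by
\<open>\<parallel>g\<parallel> / sqrt a\<close>, which is close to \<open>\<parallel>f\<parallel> / sqrt a\<close>.\<close>

lemma frame_lower:
  assumes f: "f \<in> closed_span"
  shows "a * (nrm f)\<^sup>2 \<le> (\<Sum>\<^sub>\<infinity>n. (cmod (ip f (\<phi> n)))\<^sup>2)"
proof -
  define S where "S = (\<Sum>\<^sub>\<infinity>n. (cmod (ip f (\<phi> n)))\<^sup>2)"
  have S0: "S \<ge> 0" by (simp add: S_def infsum_nonneg)
  have fV: "f \<in> V" using f closed_span_subset by auto
  have N0: "nrm f \<ge> 0" by (rule nrm_nonneg[OF fV])
  have *: "(nrm f)\<^sup>2 \<le> nrm f * \<epsilon> + (nrm f + \<epsilon>) / sqrt a * sqrt S" if \<epsilon>: "\<epsilon> > 0" for \<epsilon>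
  proof -
    obtain A c where A: "finite A" "nrm (\<lambda>z. f z - comb A c z) < \<epsilon>"
      using f \<epsilon> unfolding closed_span_def by blast
    define g where "g = (\<lambda>z. comb A c z)"
    have g: "g \<in> V" unfolding g_def by (rule comb_in[OF A(1)])
    have d: "(\<lambda>z. f z - g z) \<in> V" by (rule diff[OF fV g])
    have nd: "nrm (\<lambda>z. f z - g z) < \<epsilon>" using A by (simp add: g_def)
    have "ip f f = ip f (\<lambda>z. (f z - g z) + g z)" by simp
    also have "\<dots> = ip f (\<lambda>z. f z - g z) + ip f g" by (rule ip_add_right[OF d g fV])
    finally have "(nrm f)\<^sup>2 = Re (ip f (\<lambda>z. f z - g z)) + Re (ip f g)"
      unfolding ip_self[OF fV] by (metis Re_complex_of_real plus_complex.sel(1))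
    also have "\<dots> \<le> nrm f * \<epsilon> + cmod (ip f g)"
    proof (rule add_mono)
      have "Re (ip f (\<lambda>z. f z - g z)) \<le> nrm f * nrm (\<lambda>z. f z - g z)"
        using cauchy_schwarz[OF fV d] complex_Re_le_cmod order_trans by blast
      also have "\<dots> \<le> nrm f * \<epsilon>" using nd N0 by (intro mult_left_mono) auto
      finally show "Re (ip f (\<lambda>z. f z - g z)) \<le> nrm f * \<epsilon>" .
    qed (rule complex_Re_le_cmod)
    also have "cmod (ip f g) \<le> (nrm f + \<epsilon>) / sqrt a * sqrt S"
    proof -
      have "cmod (ip f g) \<le> (\<Sum>n\<in>A. cmod (c n) * cmod (ip f (\<phi> n)))"
        unfolding g_def using A(1) phi fV
        by (subst ip_sum_right) (auto intro!: order_trans[OF norm_sum] sum_mono simp: norm_mult)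
      also have "\<dots> \<le> sqrt (\<Sum>n\<in>A. (cmod (c n))\<^sup>2) * sqrt (\<Sum>n\<in>A. (cmod (ip f (\<phi> n)))\<^sup>2)"
        using L2_set_mult_ineq[where A = A and f = "\<lambda>n. cmod (c n)" and g = "\<lambda>n. cmod (ip f (\<phi> n))"] by (simp add: L2_set_def)
      also have "\<dots> \<le> ((nrm f + \<epsilon>) / sqrt a) * sqrt S"
      proof (rule mult_mono)
        have ng: "nrm g \<le> nrm f + \<epsilon>"
          using nrm_triangle[OF fV diff[OF g fV]] nd nrm_minus_commute[OF fV g] by simp
        have "a * (\<Sum>n\<in>A. (cmod (c n))\<^sup>2) \<le> (nrm g)\<^sup>2" unfolding g_def by (rule lower[OF A(1)])
        also have "\<dots> \<le> (nrm f + \<epsilon>)\<^sup>2" using ng nrm_nonneg[OF g] by (intro power_mono)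
        finally have "(\<Sum>n\<in>A. (cmod (c n))\<^sup>2) \<le> ((nrm f + \<epsilon>) / sqrt a)\<^sup>2"
          using a by (simp add: power_divide field_simps)
        then show "sqrt (\<Sum>n\<in>A. (cmod (c n))\<^sup>2) \<le> (nrm f + \<epsilon>) / sqrt a"
          using N0 \<epsilon> a by (intro real_le_lsqrt) auto
        show "sqrt (\<Sum>n\<in>A. (cmod (ip f (\<phi> n)))\<^sup>2) \<le> sqrt S"
          unfolding S_def using A(1) by (intro real_sqrt_le_mono finite_sum_le_infsum frame_summable fV) auto
      qed (use N0 \<epsilon> a in \<open>auto intro!: sum_nonneg\<close>)
      finally show ?thesis .
    qed
    finally show ?thesis by simp
  qed
  have "(nrm f)\<^sup>2 \<le> nrm f * 0 + (nrm f + 0) / sqrt a * sqrt S"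
  proof (rule le_limit_at_right_0)
    show "((\<lambda>\<epsilon>. nrm f * \<epsilon> + (nrm f + \<epsilon>) / sqrt a * sqrt S) \<longlongrightarrow> nrm f * 0 + (nrm f + 0) / sqrt a * sqrt S) (at_right 0)"
      using a by (intro tendsto_intros) auto
  qed (rule *)
  then have "nrm f * (nrm f * sqrt a) \<le> nrm f * sqrt S" using a by (simp add: field_simps power2_eq_square)
  then have "nrm f * sqrt a \<le> sqrt S" using N0 S0 by (cases "nrm f = 0") auto
  then have "(nrm f * sqrt a)\<^sup>2 \<le> (sqrt S)\<^sup>2" using N0 a by (intro power_mono) auto
  then show ?thesis using a S0 by (simp add: power_mult_distrib S_def mult.commute)
qed

text \<open>By the lower bound, the coefficients of a sequence of approximations of \<open>f\<close> are Cauchy. By the upper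
bound, their limits \<open>C\<close> expand \<open>f\<close> along all large finite sets of indices, which covers every
enumeration of the index set at once.\<close>

lemma unconditional_expansion:
  assumes f: "f \<in> closed_span"
  shows "\<exists>C. \<forall>\<epsilon>>0. \<exists>A. finite A \<and> (\<forall>B. finite B \<longrightarrow> A \<subseteq> B \<longrightarrow> nrm (\<lambda>z. f z - comb B C z) < \<epsilon>)"
proof -
  have fV: "f \<in> V" using f closed_span_subset by auto
  define \<delta> where "\<delta> = (\<lambda>j::nat. inverse (real (Suc j)))"
  have \<delta>0: "\<delta> j > 0" for j by (simp add: \<delta>_def)
  have \<delta>lim: "\<delta> \<longlonglongrightarrow> 0" unfolding \<delta>_def by (rule LIMSEQ_inverse_real_of_nat)
  have "\<forall>j. \<exists>A c. approximates A c f (\<delta> j)"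
    using f \<delta>0 unfolding closed_span_def by blast
  then obtain A c where A: "\<And>j. finite (A j)" and c0: "\<And>j n. n \<notin> A j \<Longrightarrow> c j n = 0"
    and appr: "\<And>j. nrm (\<lambda>z. f z - comb (A j) (c j) z) < \<delta> j" by metis
  have close: "a * (\<Sum>n\<in>B. (cmod (c i n - c j n))\<^sup>2) \<le> (\<delta> i + \<delta> j)\<^sup>2" if B: "finite B" for B i j
  proof -
    define D where "D = B \<union> A i \<union> A j"
    have D: "finite D" "B \<subseteq> D" "A i \<subseteq> D" "A j \<subseteq> D" using A B by (auto simp: D_def)
    have eq: "comb D (c k) z = comb (A k) (c k) z" if "A k \<subseteq> D" for k z
      using comb_superset[OF D(1) that, of "c k"] c0 by auto
    have "a * (\<Sum>n\<in>B. (cmod (c i n - c j n))\<^sup>2) \<le> a * (\<Sum>n\<in>D. (cmod (c i n - c j n))\<^sup>2)"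
      using a D by (intro mult_left_mono sum_mono2) auto
    also have "\<dots> \<le> (nrm (\<lambda>z. \<Sum>n\<in>D. (c i n - c j n) * \<phi> n z))\<^sup>2" by (rule lower[OF D(1)])
    also have "(\<lambda>z. \<Sum>n\<in>D. (c i n - c j n) * \<phi> n z) = (\<lambda>z. comb (A i) (c i) z - comb (A j) (c j) z)"
      by (simp add: left_diff_distrib sum_subtractf eq D)
    also have "(nrm \<dots>)\<^sup>2 \<le> (\<delta> i + \<delta> j)\<^sup>2"
    proof (rule power_mono)
      show "nrm (\<lambda>z. comb (A i) (c i) z - comb (A j) (c j) z) \<le> \<delta> i + \<delta> j"
        using nrm_triangle_diff[OF comb_in[OF A, of "c i" i] fV comb_in[OF A, of "c j" j]]
          appr[of i] appr[of j] nrm_minus_commute[OF fV comb_in[OF A, of "c i" i]] by linarith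
    qed (intro nrm_nonneg diff comb_in A)
    finally show ?thesis .
  qed
  have "\<exists>l. (\<lambda>i. c i n) \<longlonglongrightarrow> l" for n
  proof -
    have "Cauchy (\<lambda>i. c i n)"
    proof (rule CauchyI)
      fix e :: real assume e: "e > 0"
      have "\<forall>\<^sub>F i in sequentially. \<delta> i < e * sqrt a / 2"
        using e a by (intro order_tendstoD(2)[OF \<delta>lim]) simp
      then obtain N where N: "\<And>i. i \<ge> N \<Longrightarrow> \<delta> i < e * sqrt a / 2" unfolding eventually_sequentially by blast
      show "\<exists>M. \<forall>m\<ge>M. \<forall>k\<ge>M. norm (c m n - c k n) < e"
      proof (intro exI[of _ N] allI impI)
        fix m k assume mk: "m \<ge> N" "k \<ge> N"
        have "(sqrt a * cmod (c m n - c k n))\<^sup>2 \<le> (\<delta> m + \<delta> k)\<^sup>2"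
          using close[of "{n}" m k] a by (simp add: power_mult_distrib)
        then have "sqrt a * cmod (c m n - c k n) \<le> \<delta> m + \<delta> k"
          by (rule power2_le_imp_le) (use \<delta>0[of m] \<delta>0[of k] in linarith)
        also have "\<dots> < sqrt a * e" using N[OF mk(1)] N[OF mk(2)] by (simp add: mult.commute)
        finally show "norm (c m n - c k n) < e" using a by simp
      qed
    qed
    then show ?thesis by (simp add: Cauchy_convergent_iff convergent_def)
  qed
  then obtain C where C: "\<And>n. (\<lambda>i. c i n) \<longlonglongrightarrow> C n" by metis
  have closeC: "a * (\<Sum>n\<in>B. (cmod (c j n - C n))\<^sup>2) \<le> (\<delta> j)\<^sup>2" if B: "finite B" for B j
  proof (rule tendsto_le)
    show "(\<lambda>i. (\<delta> j + \<delta> i)\<^sup>2) \<longlonglongrightarrow> (\<delta> j)\<^sup>2"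
      using tendsto_power[OF tendsto_add[OF tendsto_const \<delta>lim, of "\<delta> j"], of 2] by simp
    show "(\<lambda>i. a * (\<Sum>n\<in>B. (cmod (c j n - c i n))\<^sup>2)) \<longlonglongrightarrow> a * (\<Sum>n\<in>B. (cmod (c j n - C n))\<^sup>2)"
      by (intro tendsto_intros C)
    show "\<forall>\<^sub>F i in sequentially. a * (\<Sum>n\<in>B. (cmod (c j n - c i n))\<^sup>2) \<le> (\<delta> j + \<delta> i)\<^sup>2"
      using close[OF B] by simp
  qed simp
  have main: "nrm (\<lambda>z. f z - comb B C z) < \<delta> j * (1 + sqrt (b / a))"
    if B: "finite B" "A j \<subseteq> B" for B j
  proof -
    have eq: "comb B (c j) z = comb (A j) (c j) z" for z
      using comb_superset[OF B, of "c j"] c0 by auto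
    have "(nrm (\<lambda>z. comb B (c j) z - comb B C z))\<^sup>2
        = (nrm (\<lambda>z. \<Sum>n\<in>B. (c j n - C n) * \<phi> n z))\<^sup>2"
      by (simp add: left_diff_distrib sum_subtractf)
    also have "\<dots> \<le> b * (\<Sum>n\<in>B. (cmod (c j n - C n))\<^sup>2)" by (rule upper[OF B(1)])
    also have "\<dots> \<le> b * ((\<delta> j)\<^sup>2 / a)"
      using closeC[OF B(1), of j] a b by (intro mult_left_mono) (auto simp: field_simps)
    also have "\<dots> = (\<delta> j * sqrt (b / a))\<^sup>2" using a b by (simp add: power_mult_distrib)
    finally have "nrm (\<lambda>z. comb B (c j) z - comb B C z) \<le> \<delta> j * sqrt (b / a)"
      by (rule power2_le_imp_le) (use \<delta>0[of j] a b in auto)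
    then show ?thesis
      using nrm_triangle_diff[OF fV comb_in[OF B(1), of "c j"] comb_in[OF B(1), of C]] appr[of j]
      by (simp add: eq distrib_left)
  qed
  show ?thesis
  proof (intro exI[of _ C] allI impI)
    fix \<epsilon> :: real assume \<epsilon>: "\<epsilon> > 0"
    have "(\<lambda>j. \<delta> j * (1 + sqrt (b / a))) \<longlonglongrightarrow> 0 * (1 + sqrt (b / a))" by (intro tendsto_intros \<delta>lim)
    then obtain j where j: "\<delta> j * (1 + sqrt (b / a)) < \<epsilon>"
      using order_tendstoD(2)[of _ 0 sequentially \<epsilon>] \<epsilon> eventually_happens' sequentially_bot by fastforce
    show "\<exists>A. finite A \<and> (\<forall>B. finite B \<longrightarrow> A \<subseteq> B \<longrightarrow> nrm (\<lambda>z. f z - comb B C z) < \<epsilon>)"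
      using A[of j] main[of _ j] j by (intro exI[of _ "A j"]) (auto intro: less_trans)
  qed
qed

lemma schauder_expansion:
  assumes f: "f \<in> closed_span" and e: "bij (e :: nat \<Rightarrow> 'i)"
  shows "\<exists>!c::nat \<Rightarrow> complex. (\<lambda>N. nrm (\<lambda>z. f z - partial_sum e c N z)) \<longlonglongrightarrow> 0"
proof -
  have fV: "f \<in> V" using f closed_span_subset by auto
  have inj: "inj_on e X" for X using e by (auto simp: bij_def inj_on_def)
  have reindex: "partial_sum e d N z = (\<Sum>n\<in>e ` {..<N}. d (inv e n) * \<phi> n z)" for d N z
    using e by (subst sum.reindex[OF inj]) (simp add: bij_def)
  have reindex2: "(\<Sum>k<N. (cmod (d k))\<^sup>2) = (\<Sum>n\<in>e ` {..<N}. (cmod (d (inv e n)))\<^sup>2)" for d N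
    using e by (subst sum.reindex[OF inj]) (simp add: bij_def)
  have V: "(\<lambda>z. \<Sum>k<N. d k * \<phi> (e k) z) \<in> V" for d N by (intro sum_in phi) auto
  obtain C where C: "\<And>\<epsilon>. \<epsilon> > 0 \<Longrightarrow> \<exists>A. finite A \<and> (\<forall>B. finite B \<longrightarrow> A \<subseteq> B \<longrightarrow> nrm (\<lambda>z. f z - comb B C z) < \<epsilon>)"
    using unconditional_expansion[OF f] by blast
  show ?thesis
  proof (rule ex_ex1I)
    show "\<exists>c. (\<lambda>N. nrm (\<lambda>z. f z - partial_sum e c N z)) \<longlonglongrightarrow> 0"
    proof (intro exI[of _ "C \<circ> e"] LIMSEQ_I)
      fix \<epsilon> :: real assume "\<epsilon> > 0"
      then obtain A where A: "finite A" "\<And>B. finite B \<Longrightarrow> A \<subseteq> B \<Longrightarrow> nrm (\<lambda>z. f z - comb B C z) < \<epsilon>"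
        using C by blast
      obtain N0 where N0: "inv e ` A \<subseteq> {..<N0}"
        using A(1) finite_nat_iff_bounded by blast
      show "\<exists>N0. \<forall>N\<ge>N0. norm (nrm (\<lambda>z. f z - (\<Sum>k<N. (C \<circ> e) k * \<phi> (e k) z)) - 0) < \<epsilon>"
      proof (intro exI[of _ N0] allI impI)
        fix N assume N: "N \<ge> N0"
        have "A \<subseteq> e ` {..<N}"
        proof
          fix x assume "x \<in> A"
          then have "inv e x < N" using N0 N by fastforce
          moreover have "x = e (inv e x)" using e by (simp add: bij_def surj_f_inv_f)
          ultimately show "x \<in> e ` {..<N}" by blast
        qed
        then have "nrm (\<lambda>z. f z - (\<Sum>n\<in>e ` {..<N}. C n * \<phi> n z)) < \<epsilon>" by (intro A) auto
        moreover have "(\<Sum>k<N. (C \<circ> e) k * \<phi> (e k) z) = (\<Sum>n\<in>e ` {..<N}. C n * \<phi> n z)" for z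
          by (subst sum.reindex[OF inj]) simp
        moreover have "nrm (\<lambda>z. f z - (\<Sum>k<N. (C \<circ> e) k * \<phi> (e k) z)) \<ge> 0"
          by (intro nrm_nonneg diff fV V)
        ultimately show "norm (nrm (\<lambda>z. f z - (\<Sum>k<N. (C \<circ> e) k * \<phi> (e k) z)) - 0) < \<epsilon>" by simp
      qed
    qed
    fix c d :: "nat \<Rightarrow> complex"
    assume c: "(\<lambda>N. nrm (\<lambda>z. f z - partial_sum e c N z)) \<longlonglongrightarrow> 0"
      and d: "(\<lambda>N. nrm (\<lambda>z. f z - partial_sum e d N z)) \<longlonglongrightarrow> 0"
    show "c = d"
    proof
      fix k
      have "a * (cmod (c k - d k))\<^sup>2 \<le> 0\<^sup>2"
      proof (rule tendsto_lowerbound)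
        show "(\<lambda>N. (nrm (\<lambda>z. f z - partial_sum e c N z) + nrm (\<lambda>z. f z - partial_sum e d N z))\<^sup>2) \<longlonglongrightarrow> 0\<^sup>2"
          using tendsto_power[OF tendsto_add[OF c d], of 2] by simp
        show "\<forall>\<^sub>F N in sequentially. a * (cmod (c k - d k))\<^sup>2 \<le>
            (nrm (\<lambda>z. f z - partial_sum e c N z) + nrm (\<lambda>z. f z - partial_sum e d N z))\<^sup>2"
          using eventually_gt_at_top[of k]
        proof eventually_elim
          case (elim N)
          have "a * (cmod (c k - d k))\<^sup>2 \<le> a * (\<Sum>k<N. (cmod (c k - d k))\<^sup>2)"
            using elim a by (intro mult_left_mono member_le_sum) auto
          also have "\<dots> \<le> (nrm (\<lambda>z. \<Sum>k<N. (c k - d k) * \<phi> (e k) z))\<^sup>2"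
            unfolding reindex[of "\<lambda>k. c k - d k"] reindex2[of "\<lambda>k. c k - d k"] by (rule lower) simp
          also have "(\<lambda>z. \<Sum>k<N. (c k - d k) * \<phi> (e k) z) = (\<lambda>z. partial_sum e c N z - partial_sum e d N z)"
            by (simp add: left_diff_distrib sum_subtractf)
          also have "(nrm \<dots>)\<^sup>2 \<le> (nrm (\<lambda>z. f z - partial_sum e c N z) + nrm (\<lambda>z. f z - partial_sum e d N z))\<^sup>2"
            using nrm_triangle_diff[OF V[of c N] fV V[of d N]] nrm_minus_commute[OF fV V[of c N]]
            by (intro power_mono nrm_nonneg diff V) auto
          finally show ?case .
        qed
      qed simp
      then show "c k = d k" using a by (simp add: mult_le_0_iff)
    qed
  qed
qed

end

section \<open>Functions of bounded type and nonpositive mean type\<close>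

lemma mean_type_le_0_iff: "mean_type f \<le> 0 \<longleftrightarrow> nonpos_type f"
proof
  assume *: "mean_type f \<le> 0"
  show "nonpos_type f" unfolding nonpos_type_def
  proof (intro allI impI)
    fix \<epsilon> :: real assume \<epsilon>: "\<epsilon> > 0"
    then have "\<forall>\<^sub>F y in at_top. (if f (\<i> * of_real y) = 0 then -\<infinity> else ereal (ln (cmod (f (\<i> * of_real y))) / y)) < ereal \<epsilon>"
      using * unfolding mean_type_def Limsup_le_iff by auto
    then show "\<forall>\<^sub>F y in at_top. cmod (f (\<i> * of_real y)) \<le> exp (\<epsilon> * y)"
      using eventually_gt_at_top[of 0]
    proof eventually_elim
      case (elim y)
      show ?case
      proof (cases "f (\<i> * of_real y) = 0")
        case False
        then have "ln (cmod (f (\<i> * of_real y))) < \<epsilon> * y" using elim by (simp add: field_simps)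
        then have "exp (ln (cmod (f (\<i> * of_real y)))) < exp (\<epsilon> * y)" by simp
        then show ?thesis using False by simp
      qed simp
    qed
  qed
next
  assume *: "nonpos_type f"
  show "mean_type f \<le> 0" unfolding mean_type_def Limsup_le_iff
  proof (intro allI impI)
    fix c :: ereal assume "0 < c"
    then obtain \<epsilon> :: real where \<epsilon>: "0 < \<epsilon>" "ereal \<epsilon> < c"
      using ereal_dense2[of 0 c] by auto
    have "\<forall>\<^sub>F y in at_top. cmod (f (\<i> * of_real y)) \<le> exp (\<epsilon> * y)"
      using * \<epsilon> by (auto simp: nonpos_type_def)
    then show "\<forall>\<^sub>F y in at_top. (if f (\<i> * of_real y) = 0 then -\<infinity> else ereal (ln (cmod (f (\<i> * of_real y))) / y)) < c"
      using eventually_gt_at_top[of 0]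
    proof eventually_elim
      case (elim y)
      show ?case
      proof (cases "f (\<i> * of_real y) = 0")
        case True
        then show ?thesis using \<epsilon>(2) by (cases c) auto
      next
        case False
        then have "ln (cmod (f (\<i> * of_real y))) \<le> ln (exp (\<epsilon> * y))" using elim
          by (subst ln_le_cancel_iff) auto
        then have "ereal (ln (cmod (f (\<i> * of_real y))) / y) \<le> ereal \<epsilon>" using elim(2) by (simp add: field_simps)
        then show ?thesis using le_less_trans[OF _ \<epsilon>(2)] False by simp
      qed
    qed
  qed
qed

lemma nonpos_type_bounded:
  assumes "\<forall>\<^sub>F y in at_top. cmod (u (\<i> * of_real y)) \<le> B"
  shows "nonpos_type u"
  unfolding nonpos_type_def
proof (intro allI impI)
  fix \<epsilon> :: real assume "\<epsilon> > 0"
  then have "filterlim (\<lambda>y. exp (\<epsilon> * y)) at_top at_top" by real_asymp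
  then have "\<forall>\<^sub>F y in at_top. B \<le> exp (\<epsilon> * y)" by (simp add: filterlim_at_top)
  with assms show "\<forall>\<^sub>F y in at_top. cmod (u (\<i> * of_real y)) \<le> exp (\<epsilon> * y)"
    by eventually_elim linarith
qed

lemma nonpos_type_mult:
  assumes "nonpos_type u" "nonpos_type v"
  shows "nonpos_type (\<lambda>z. u z * v z)"
  unfolding nonpos_type_def
proof (intro allI impI)
  fix \<epsilon> :: real assume "\<epsilon> > 0"
  then have "\<forall>\<^sub>F y in at_top. cmod (u (\<i> * of_real y)) \<le> exp (\<epsilon> / 2 * y)"
    "\<forall>\<^sub>F y in at_top. cmod (v (\<i> * of_real y)) \<le> exp (\<epsilon> / 2 * y)"
    using assms half_gt_zero[of \<epsilon>] unfolding nonpos_type_def by blast+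
  then show "\<forall>\<^sub>F y in at_top. cmod (u (\<i> * of_real y) * v (\<i> * of_real y)) \<le> exp (\<epsilon> * y)"
  proof eventually_elim
    case (elim y)
    then have "cmod (u (\<i> * of_real y) * v (\<i> * of_real y)) \<le> exp (\<epsilon> / 2 * y) * exp (\<epsilon> / 2 * y)"
      unfolding norm_mult by (intro mult_mono) auto
    then show ?case by (simp flip: exp_add)
  qed
qed

lemma nonpos_type_add:
  assumes "nonpos_type u" "nonpos_type v"
  shows "nonpos_type (\<lambda>z. u z + v z)"
  unfolding nonpos_type_def
proof (intro allI impI)
  fix \<epsilon> :: real assume \<epsilon>: "\<epsilon> > 0"
  then have "\<forall>\<^sub>F y in at_top. cmod (u (\<i> * of_real y)) \<le> exp (\<epsilon> / 2 * y)"
    "\<forall>\<^sub>F y in at_top. cmod (v (\<i> * of_real y)) \<le> exp (\<epsilon> / 2 * y)"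
    using assms half_gt_zero[of \<epsilon>] unfolding nonpos_type_def by blast+
  moreover have "\<forall>\<^sub>F y in at_top. 2 * exp (\<epsilon> / 2 * y) \<le> exp (\<epsilon> * y)" using \<epsilon> by real_asymp
  ultimately show "\<forall>\<^sub>F y in at_top. cmod (u (\<i> * of_real y) + v (\<i> * of_real y)) \<le> exp (\<epsilon> * y)"
  proof eventually_elim
    case (elim y)
    then show ?case using norm_triangle_ineq[of "u (\<i> * of_real y)" "v (\<i> * of_real y)"] by linarith
  qed
qed

lemma poisson_growth_mult:
  assumes "poisson_growth u" "poisson_growth v"
  shows "poisson_growth (\<lambda>z. u z * v z)"
proof -
  obtain C D where C: "C \<ge> 0" "\<And>z. Im z > 0 \<Longrightarrow> cmod (u z) \<le> exp (C * ((1 + (cmod z)\<^sup>2) / Im z))"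
    and D: "D \<ge> 0" "\<And>z. Im z > 0 \<Longrightarrow> cmod (v z) \<le> exp (D * ((1 + (cmod z)\<^sup>2) / Im z))"
    using assms unfolding poisson_growth_def by blast
  have "cmod (u z * v z) \<le> exp ((C + D) * ((1 + (cmod z)\<^sup>2) / Im z))" if "Im z > 0" for z
    unfolding norm_mult distrib_right exp_add using C(2)[OF that] D(2)[OF that] by (intro mult_mono) auto
  then show ?thesis unfolding poisson_growth_def using C(1) D(1) by (intro exI[of _ "C + D"]) auto
qed

lemma upper_half_alt: "upper_half = {z. Im z > 0}"
  by (simp add: upper_half_def)

lemma open_upper_half: "open upper_half"
  by (simp add: upper_half_alt open_halfspace_Im_gt)

lemma connected_upper_half: "connected upper_half"
  by (simp add: upper_half_alt convex_connected convex_halfspace_Im_gt)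

text \<open>This keeps the common denominator of a sum of two quotients from vanishing identically.\<close>

lemma holomorphic_mult_not_identically_0:
  assumes hol: "f holomorphic_on S" "g holomorphic_on S" and S: "open S" "connected S"
    and ex: "\<exists>z\<in>S. f z \<noteq> 0" "\<exists>z\<in>S. g z \<noteq> (0::complex)"
  shows "\<exists>z\<in>S. f z * g z \<noteq> 0"
proof (rule ccontr)
  assume *: "\<not> (\<exists>z\<in>S. f z * g z \<noteq> 0)"
  obtain a where a: "a \<in> S" "f a \<noteq> 0" using ex by blast
  define U where "U = S \<inter> {z \<in> S. f z \<noteq> 0}"
  have "open U" unfolding U_def
    using continuous_open_preimage[OF holomorphic_on_imp_continuous_on[OF hol(1)] S(1), of "- {0}"] S(1)
    by (auto simp: vimage_def Int_def intro!: open_Int) 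
  moreover have "a \<in> U" using a by (simp add: U_def)
  ultimately have "a islimpt U" by (simp add: open_imp_islimpt)
  moreover have "\<And>z. z \<in> U \<Longrightarrow> g z = 0" using * by (auto simp: U_def)
  ultimately have "g w = 0" if "w \<in> S" for w
    using analytic_continuation[OF hol(2) S, of U a w] a that by (auto simp: U_def)
  then show False using ex by auto
qed

lemma bounded_image_mult:
  fixes f g :: "'a \<Rightarrow> complex"
  assumes "bounded (f ` S)" "bounded (g ` S)"
  shows "bounded ((\<lambda>z. f z * g z) ` S)"
proof -
  obtain A B where "\<And>z. z \<in> S \<Longrightarrow> norm (f z) \<le> A" "\<And>z. z \<in> S \<Longrightarrow> norm (g z) \<le> B"
    using assms unfolding bounded_iff by auto
  then have "norm (f z * g z) \<le> \<bar>A\<bar> * \<bar>B\<bar>" if "z \<in> S" for z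
    unfolding norm_mult using that by (intro mult_mono) (auto intro: order_trans[OF _ abs_ge_self])
  then show ?thesis unfolding bounded_iff by auto
qed

lemma bounded_typeI:
  assumes "f holomorphic_on upper_half" "g holomorphic_on upper_half" "h holomorphic_on upper_half"
    "bounded (g ` upper_half)" "bounded (h ` upper_half)" "\<exists>z\<in>upper_half. h z \<noteq> 0"
    "\<And>z. z \<in> upper_half \<Longrightarrow> f z * h z = g z"
  shows "bounded_type f"
  using assms unfolding bounded_type_def by blast

lemma bounded_type_add:
  assumes "bounded_type u" "bounded_type v"
  shows "bounded_type (\<lambda>z. u z + v z)"
proof -
  obtain g1 h1 where u: "u holomorphic_on upper_half" "g1 holomorphic_on upper_half" "bounded (g1 ` upper_half)"
    "h1 holomorphic_on upper_half" "bounded (h1 ` upper_half)" "\<exists>z\<in>upper_half. h1 z \<noteq> 0"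
    "\<And>z. z \<in> upper_half \<Longrightarrow> u z * h1 z = g1 z"
    using assms(1) unfolding bounded_type_def by blast
  obtain g2 h2 where v: "v holomorphic_on upper_half" "g2 holomorphic_on upper_half" "bounded (g2 ` upper_half)"
    "h2 holomorphic_on upper_half" "bounded (h2 ` upper_half)" "\<exists>z\<in>upper_half. h2 z \<noteq> 0"
    "\<And>z. z \<in> upper_half \<Longrightarrow> v z * h2 z = g2 z"
    using assms(2) unfolding bounded_type_def by blast
  show ?thesis
  proof (rule bounded_typeI[of _ "\<lambda>z. g1 z * h2 z + g2 z * h1 z" "\<lambda>z. h1 z * h2 z"])
    show "(\<lambda>z. u z + v z) holomorphic_on upper_half" by (intro holomorphic_intros u v)
    show "(\<lambda>z. g1 z * h2 z + g2 z * h1 z) holomorphic_on upper_half" by (intro holomorphic_intros u v)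
    show "(\<lambda>z. h1 z * h2 z) holomorphic_on upper_half" by (intro holomorphic_intros u v)
    show "\<exists>z\<in>upper_half. h1 z * h2 z \<noteq> 0"
      by (rule holomorphic_mult_not_identically_0[OF u(4) v(4) open_upper_half connected_upper_half u(6) v(6)])
    show "bounded ((\<lambda>z. g1 z * h2 z + g2 z * h1 z) ` upper_half)"
      using u v by (intro bounded_plus_comp bounded_image_mult)
    show "bounded ((\<lambda>z. h1 z * h2 z) ` upper_half)" using u v by (intro bounded_image_mult)
    show "(u z + v z) * (h1 z * h2 z) = g1 z * h2 z + g2 z * h1 z" if "z \<in> upper_half" for z
      using u(7)[OF that, symmetric] v(7)[OF that, symmetric] by (simp add: algebra_simps)
  qed
qed

lemma bounded_type_mult_bounded:
  assumes "bounded_type u" and b: "b holomorphic_on upper_half" "bounded (b ` upper_half)"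
  shows "bounded_type (\<lambda>z. b z * u z)"
proof -
  obtain g h where u: "u holomorphic_on upper_half" "g holomorphic_on upper_half" "bounded (g ` upper_half)"
    "h holomorphic_on upper_half" "bounded (h ` upper_half)" "\<exists>z\<in>upper_half. h z \<noteq> 0"
    "\<And>z. z \<in> upper_half \<Longrightarrow> u z * h z = g z"
    using assms(1) unfolding bounded_type_def by blast
  show ?thesis
  proof (rule bounded_typeI[of _ "\<lambda>z. b z * g z" h])
    show "(\<lambda>z. b z * u z) holomorphic_on upper_half" "(\<lambda>z. b z * g z) holomorphic_on upper_half"
      by (intro holomorphic_intros u b)+
    show "bounded ((\<lambda>z. b z * g z) ` upper_half)" using u b by (intro bounded_image_mult)
    show "b z * u z * h z = b z * g z" if "z \<in> upper_half" for z using u(7)[OF that] by (simp add: mult.assoc)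
  qed (use u in auto)
qed

text \<open>For functions that extend holomorphically across the real axis, this is membership in the Smirnov
class of the upper half-plane.\<close>

definition smirnov :: "(complex \<Rightarrow> complex) \<Rightarrow> bool" where
  "smirnov u \<longleftrightarrow> bounded_type u \<and> nonpos_type u"

lemma smirnov_add: "smirnov u \<Longrightarrow> smirnov v \<Longrightarrow> smirnov (\<lambda>z. u z + v z)"
  by (simp add: smirnov_def bounded_type_add nonpos_type_add)

lemma smirnov_mult_bounded:
  assumes "smirnov u" and b: "b holomorphic_on upper_half" "\<And>z. Im z > 0 \<Longrightarrow> cmod (b z) \<le> B"
  shows "smirnov (\<lambda>z. b z * u z)"
  unfolding smirnov_def
proof
  have "bounded (b ` upper_half)" unfolding bounded_iff using b(2) by (auto simp: upper_half_alt)
  then show "bounded_type (\<lambda>z. b z * u z)"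
    using assms by (intro bounded_type_mult_bounded) (auto simp: smirnov_def)
  have "\<forall>\<^sub>F y in at_top. cmod (b (\<i> * of_real y)) \<le> B"
    using eventually_gt_at_top[of 0] by eventually_elim (simp add: b(2))
  then show "nonpos_type (\<lambda>z. b z * u z)"
    using nonpos_type_mult[OF nonpos_type_bounded[of b B]] assms(1) by (simp add: smirnov_def)
qed

lemma smirnov_cong:
  assumes "smirnov u" "\<And>z. Im z > 0 \<Longrightarrow> u z = v z"
  shows "smirnov v"
  unfolding smirnov_def
proof
  have "bounded_type u" using assms(1) by (simp add: smirnov_def)
  moreover have "v holomorphic_on upper_half \<longleftrightarrow> u holomorphic_on upper_half"
    by (rule holomorphic_cong) (use assms(2) in \<open>auto simp: upper_half_alt\<close>)
  ultimately show "bounded_type v" using assms(2) by (auto simp: bounded_type_def upper_half_alt)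
  show "nonpos_type v" unfolding nonpos_type_def
  proof (intro allI impI)
    fix \<epsilon> :: real assume "\<epsilon> > 0"
    then have "\<forall>\<^sub>F y in at_top. cmod (u (\<i> * of_real y)) \<le> exp (\<epsilon> * y)"
      using assms(1) by (auto simp: smirnov_def nonpos_type_def)
    then show "\<forall>\<^sub>F y in at_top. cmod (v (\<i> * of_real y)) \<le> exp (\<epsilon> * y)"
      using eventually_gt_at_top[of 0] by eventually_elim (simp add: assms(2)[symmetric])
  qed
qed

lemma dB_iff: "f \<in> dB E \<longleftrightarrow> f holomorphic_on UNIV \<and>
     integrable lborel (\<lambda>t::real. (cmod (f (of_real t) / E (of_real t)))\<^sup>2) \<and>
     smirnov (\<lambda>z. f z / E z) \<and> smirnov (\<lambda>z. star f z / E z)"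
  by (auto simp: dB_def mean_type_le_0_iff smirnov_def)

lemma star_of_real [simp]: "star f (of_real x) = cnj (f (of_real x))"
  by (simp add: star_def)

lemma star_holomorphic: "f holomorphic_on UNIV \<Longrightarrow> star f holomorphic_on UNIV"
  using holomorphic_on_compose_cnj_cnj[of f UNIV] surjI[of cnj cnj] by (simp add: star_def o_def)

lemma integrable_lorentz: "integrable lborel (\<lambda>t. 1 / (1 + (t - x)\<^sup>2) :: real)"
  and integral_lorentz: "(LINT t|lborel. 1 / (1 + (t - x)\<^sup>2)) = pi"
proof -
  have 1: "integrable lborel (\<lambda>t. 1 / (1 + t\<^sup>2) :: real)"
    using integrable_inverse_1_plus_square by (simp add: set_integrable_def einterval_def inverse_eq_divide)
  have 2: "(LINT t|lborel. 1 / (1 + t\<^sup>2)) = pi"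
    using LBINT_inverse_1_plus_square
    by (simp add: interval_lebesgue_integral_def set_lebesgue_integral_def einterval_def inverse_eq_divide)
  show "integrable lborel (\<lambda>t. 1 / (1 + (t - x)\<^sup>2) :: real)"
    using lborel_integrable_real_affine[OF 1, of 1 "-x"] by simp
  show "(LINT t|lborel. 1 / (1 + (t - x)\<^sup>2)) = pi"
    using lborel_integral_real_affine[of 1 "\<lambda>t. 1 / (1 + t\<^sup>2)" "-x"] 2 by simp
qed

lemma integrable_decay:
  fixes v :: "real \<Rightarrow> complex"
  assumes v: "continuous_on UNIV v" and w: "integrable lborel w" "\<And>t. w t \<ge> (0::real)" and B: "B \<ge> 0"
    and decay: "\<And>t. \<bar>t - x\<bar> \<ge> 1 \<Longrightarrow> cmod (v t) \<le> w t + B / (t - x)\<^sup>2"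
  shows "integrable lborel v"
proof -
  have "compact (v ` {x - 1..x + 1})"
    by (intro compact_continuous_image continuous_on_subset[OF v]) auto
  then have "bounded (v ` {x - 1..x + 1})" by (rule compact_imp_bounded)
  then obtain B1 where "\<forall>y\<in>v ` {x - 1..x + 1}. cmod y \<le> B1"
    unfolding bounded_iff by blast
  then have B1: "cmod (v t) \<le> B1" if "t \<in> {x - 1..x + 1}" for t using that by blast
  have B10: "B1 \<ge> 0" using order_trans[OF norm_ge_zero B1[of x]] by simp
  let ?w = "\<lambda>t. w t + (2 * B1 + 2 * B) * (1 / (1 + (t - x)\<^sup>2))"
  have "integrable lborel ?w" using w(1) integrable_lorentz[of x] by (intro Bochner_Integration.integrable_add integrable_mult_right)
  then show ?thesis
  proof (rule Bochner_Integration.integrable_bound)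
    show "v \<in> borel_measurable lborel" using v by (simp add: borel_measurable_continuous_onI)
    show "AE t in lborel. cmod (v t) \<le> norm (?w t)"
    proof (rule AE_I2)
      fix t
      define q where "q = 1 + (t - x)\<^sup>2"
      have q: "q > 0" by (simp add: q_def add_pos_nonneg)
      have "cmod (v t) \<le> ?w t"
      proof (cases "\<bar>t - x\<bar> \<ge> 1")
        case True
        then have s: "(t - x)\<^sup>2 \<ge> 1" using power_mono[of 1 "\<bar>t - x\<bar>" 2] by simp
        have "B / (t - x)\<^sup>2 \<le> 2 * B / q"
        proof -
          have "2 * B / (2 * (t - x)\<^sup>2) \<le> 2 * B / q"
            using s B q by (intro divide_left_mono mult_pos_pos) (auto simp: q_def)
          then show ?thesis by simp
        qed
        moreover have "2 * B1 / q \<ge> 0" using B10 q by simp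
        ultimately show ?thesis using decay[OF True] unfolding q_def[symmetric] by (simp add: add_divide_distrib)
      next
        case False
        then have "t \<in> {x - 1..x + 1}" by auto
        then have "cmod (v t) \<le> B1" by (rule B1)
        moreover have "q \<le> 2" using False abs_square_le_1[of "t - x"] by (simp add: q_def)
        then have "B1 * 1 \<le> (2 * B1) / q" using B10 q mult_left_mono[of q 2 B1] by (simp add: field_simps)
        moreover have "2 * B / q \<ge> 0" using B q by simp
        ultimately show ?thesis using w(2)[of t] unfolding q_def[symmetric] by (simp add: add_divide_distrib)
      qed
      then show "cmod (v t) \<le> norm (?w t)" by simp
    qed
  qed
qed

lemma integrable_product_L2:
  fixes f g :: "real \<Rightarrow> complex"
  assumes "f \<in> borel_measurable borel" "g \<in> borel_measurable borel"
    and "integrable lborel (\<lambda>t. (cmod (f t))\<^sup>2)" "integrable lborel (\<lambda>t. (cmod (g t))\<^sup>2)"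
  shows "integrable lborel (\<lambda>t. f t * g t)"
proof (rule Bochner_Integration.integrable_bound[OF Bochner_Integration.integrable_add[OF assms(3,4)]])
  show "(\<lambda>t. f t * g t) \<in> borel_measurable lborel" using assms(1,2) by simp
  have "cmod (f t * g t) \<le> (cmod (f t))\<^sup>2 + (cmod (g t))\<^sup>2" for t
    using sum_squares_bound[of "cmod (f t)" "cmod (g t)"] mult_nonneg_nonneg[OF norm_ge_zero norm_ge_zero, of "f t" "g t"]
    unfolding norm_mult by linarith
  then show "AE t in lborel. cmod (f t * g t) \<le> norm ((cmod (f t))\<^sup>2 + (cmod (g t))\<^sup>2)"
    by (intro AE_I2) simp
qed

lemma integral_product_eq_0:
  assumes hol: "u holomorphic_on S" "v holomorphic_on S" "{z. Im z \<ge> 0} \<subseteq> S"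
    and u: "smirnov u" "integrable lborel (\<lambda>t. (cmod (u (of_real t)))\<^sup>2)"
    and v: "smirnov v" "integrable lborel (\<lambda>t. (cmod (v (of_real t)))\<^sup>2)"
  shows "(LINT t|lborel. u (of_real t) * v (of_real t)) = 0"
proof -
  have cont: "continuous_on {z. Im z \<ge> 0} w" if "w holomorphic_on S" for w
    by (rule continuous_on_subset[OF holomorphic_on_imp_continuous_on[OF that] hol(3)])
  have meas: "(\<lambda>t. w (complex_of_real t)) \<in> borel_measurable borel" if "w holomorphic_on S" for w
    by (intro borel_measurable_continuous_onI continuous_on_compose2[OF cont[OF that]] continuous_intros) auto
  show ?thesis
  proof (rule integral_eq_0_upper_half_plane[of "\<lambda>z. u z * v z"])
    show "continuous_on {z. 0 \<le> Im z} (\<lambda>z. u z * v z)" by (intro continuous_intros cont hol)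
    show "(\<lambda>z. u z * v z) holomorphic_on {z. 0 < Im z}"
      by (rule holomorphic_on_subset[of _ S]) (use hol in \<open>auto intro!: holomorphic_intros\<close>)
    show "poisson_growth (\<lambda>z. u z * v z)" "nonpos_type (\<lambda>z. u z * v z)"
      using u v by (auto simp: smirnov_def intro: poisson_growth_mult nonpos_type_mult bounded_type_imp_poisson_growth)
    show "complex_integrable lborel (\<lambda>t. u (complex_of_real t) * v (complex_of_real t))"
      using u v by (intro integrable_product_L2 meas hol)
  qed
qed

text \<open>Subtracting a multiple of \<open>\<i> / (z - x + \<i>)\<close>, a function of the Hardy space with value \<open>1\<close> at \<open>x\<close>,
cancels the pole that division by \<open>z - x\<close> would create. This replaces the principal value of the
integral of \<open>h t / (t - x)\<close>.\<close>

lemma hardy_divided_difference: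
  fixes x :: real
  assumes h: "h holomorphic_on S" "open S" "{z. Im z \<ge> 0} \<subseteq> S"
    and sm: "smirnov h" and L2: "integrable lborel (\<lambda>t. (cmod (h (of_real t)))\<^sup>2)"
  obtains U where "integrable lborel U" "(LINT t|lborel. U t) = 0"
    "\<And>t. t \<noteq> x \<Longrightarrow> U t = (h (of_real t) - h (of_real x) * (\<i> / (of_real (t - x) + \<i>))) / of_real (t - x)"
proof -
  define c where "c = h (of_real x)"
  define q where "q = (\<lambda>z. \<i> / (z - of_real x + \<i>))"
  define w where "w = (\<lambda>z. h z - c * q z)"
  define U where "U = (\<lambda>z. if z = of_real x then deriv w (of_real x) else w z / (z - of_real x))"
  define S' where "S' = S - {of_real x - \<i>}"
  have S': "open S'" "{z. Im z \<ge> 0} \<subseteq> S'" using h by (auto simp: S'_def intro!: open_delete)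
  have den: "z - of_real x + \<i> \<noteq> 0" if "z \<in> S'" for z using that by (auto simp: S'_def algebra_simps)
  have holq: "q holomorphic_on S'" unfolding q_def by (intro holomorphic_intros) (use den in auto)
  have holw: "w holomorphic_on S'" unfolding w_def
    by (intro holomorphic_intros holq holomorphic_on_subset[OF h(1)]) (auto simp: S'_def)
  have "q (of_real x) = 1" by (simp add: q_def complex_eq_iff)
  then have wx: "w (of_real x) = 0" by (simp add: w_def c_def)
  have holU: "U holomorphic_on S'"
    by (rule pole_theorem_open_0[OF holw S'(1), of "of_real x"]) (use wx in \<open>auto simp: U_def\<close>)
  have contU: "continuous_on {z. Im z \<ge> 0} U"
    using holU S'(2) holomorphic_on_imp_continuous_on continuous_on_subset by blast
  have q1: "cmod (q z) \<le> 1" if "Im z \<ge> 0" for z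
  proof -
    have "1 \<le> cmod (z - of_real x + \<i>)"
      using abs_Im_le_cmod[of "z - of_real x + \<i>"] that by simp
    then show ?thesis by (simp add: q_def norm_divide divide_le_eq_1)
  qed
  have U_le: "cmod (U z) \<le> (cmod (h z) + cmod c) / Im z" if z: "Im z > 0" for z
  proof -
    have "cmod (w z) \<le> cmod (h z) + cmod c * cmod (q z)"
      using norm_triangle_ineq4[of "h z" "c * q z"] by (simp add: w_def norm_mult)
    also have "\<dots> \<le> cmod (h z) + cmod c" using q1[of z] z by (simp add: mult_left_le)
    finally have 1: "cmod (w z) \<le> cmod (h z) + cmod c" .
    have "Im z \<le> cmod (z - of_real x)" using abs_Im_le_cmod[of "z - of_real x"] z by simp
    then have "cmod (w z) / cmod (z - of_real x) \<le> (cmod (h z) + cmod c) / Im z"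
      using 1 z by (intro frac_le) auto
    moreover have "z \<noteq> of_real x" using z by auto
    ultimately show ?thesis by (simp add: U_def norm_divide)
  qed
  have "poisson_growth U"
  proof -
    obtain C where C: "C \<ge> 0" "\<And>z. Im z > 0 \<Longrightarrow> cmod (h z) \<le> exp (C * ((1 + (cmod z)\<^sup>2) / Im z))"
      using sm bounded_type_imp_poisson_growth unfolding smirnov_def poisson_growth_def by blast
    have "cmod (U z) \<le> exp ((C + cmod c + 1) * ((1 + (cmod z)\<^sup>2) / Im z))" if z: "Im z > 0" for z
    proof -
      define G where "G = (1 + (cmod z)\<^sup>2) / Im z"
      have "Im z \<le> cmod z" using abs_Im_le_cmod[of z] by simp
      also have "\<dots> \<le> 1 + (cmod z)\<^sup>2" using sum_squares_bound[of 1 "cmod z"] by (simp add: power2_eq_square) (smt (verit) mult_nonneg_nonneg norm_ge_zero)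
      finally have G1: "G \<ge> 1" using z by (simp add: G_def)
      have "1 / Im z \<le> G" unfolding G_def using z by (intro divide_right_mono) auto
      then have G2: "1 / Im z \<le> exp G" using exp_ge_add_one_self[of G] by linarith
      have "cmod c \<le> exp (cmod c) - 1" using exp_ge_add_one_self[of "cmod c"] by linarith
      also have "\<dots> \<le> exp (cmod c * G) - 1" using G1 mult_left_mono[OF G1, of "cmod c"] by simp
      finally have c: "cmod c \<le> exp (cmod c * G) - 1" .
      have "(exp (C * G) - 1) * (exp (cmod c * G) - 1) \<ge> 0"
        using C(1) G1 by (intro mult_nonneg_nonneg) auto
      then have "cmod (h z) + cmod c \<le> exp (C * G) * exp (cmod c * G)"
        using C(2)[OF z] c unfolding G_def[symmetric] by (simp add: algebra_simps)
      then have "(cmod (h z) + cmod c) * (1 / Im z) \<le> (exp (C * G) * exp (cmod c * G)) * exp G"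
        using G2 z by (intro mult_mono) auto
      also have "\<dots> = exp ((C + cmod c + 1) * G)" by (simp add: exp_add distrib_right)
      finally show ?thesis using U_le[OF z] by (simp add: G_def)
    qed
    then show ?thesis unfolding poisson_growth_def using C(1) by (intro exI[of _ "C + cmod c + 1"]) auto
  qed
  moreover have "nonpos_type U"
  proof -
    have "nonpos_type (\<lambda>z. of_real (cmod (h z)) + of_real (cmod c))"
      using sm by (intro nonpos_type_add nonpos_type_bounded[of "\<lambda>z. of_real (cmod c)" "cmod c"])
        (auto simp: smirnov_def nonpos_type_def)
    then have *: "\<forall>\<^sub>F y in at_top. cmod (h (\<i> * of_real y)) + cmod c \<le> exp (\<epsilon> * y)" if "\<epsilon> > 0" for \<epsilon>
      using that by (simp add: nonpos_type_def flip: of_real_add)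
    show ?thesis unfolding nonpos_type_def
    proof (intro allI impI)
      fix \<epsilon> :: real assume "\<epsilon> > 0"
      from *[OF this] show "\<forall>\<^sub>F y in at_top. cmod (U (\<i> * of_real y)) \<le> exp (\<epsilon> * y)"
        using eventually_ge_at_top[of 1]
      proof eventually_elim
        case (elim y)
        have "cmod (U (\<i> * of_real y)) \<le> (cmod (h (\<i> * of_real y)) + cmod c) / y"
          using U_le[of "\<i> * of_real y"] elim by simp
        also have "\<dots> \<le> cmod (h (\<i> * of_real y)) + cmod c"
          using elim(2) mult_left_mono[OF elim(2), of "cmod (h (\<i> * of_real y)) + cmod c"] by (simp add: field_simps)
        finally show ?case using elim by linarith
      qed
    qed
  qed
  moreover have int: "integrable lborel (\<lambda>t. U (of_real t))"
  proof (rule integrable_decay[OF _ L2])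
    show "continuous_on UNIV (\<lambda>t. U (complex_of_real t))"
      by (rule continuous_on_compose2[OF contU]) (auto intro!: continuous_intros)
    fix t :: real assume t: "1 \<le> \<bar>t - x\<bar>"
    define s where "s = \<bar>t - x\<bar>"
    have s: "s \<ge> 1" "(t - x)\<^sup>2 = s\<^sup>2" using t by (auto simp: s_def)
    have "s \<le> cmod (of_real t - of_real x + \<i>)"
      using abs_Re_le_cmod[of "of_real t - of_real x + \<i>"] by (simp add: s_def)
    then have "cmod (q (of_real t)) \<le> 1 / s" using s(1) by (simp add: q_def norm_divide frac_le)
    then have "cmod c * cmod (q (of_real t)) \<le> cmod c * (1 / s)" by (intro mult_left_mono) auto
    then have "cmod (w (of_real t)) \<le> cmod (h (of_real t)) + cmod c / s"
      using norm_triangle_ineq4[of "h (of_real t)" "c * q (of_real t)"] by (simp add: w_def norm_mult)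
    then have "cmod (w (of_real t)) / s \<le> (cmod (h (of_real t)) + cmod c / s) / s"
      using s by (intro divide_right_mono) auto
    moreover have "cmod (U (of_real t)) = cmod (w (of_real t)) / s"
      using t by (auto simp: U_def norm_divide s_def simp flip: of_real_diff)
    moreover have "cmod (h (of_real t)) / s \<le> (cmod (h (of_real t)))\<^sup>2 + (1 / s)\<^sup>2"
    proof -
      have "0 \<le> cmod (h (of_real t)) / s" using s by simp
      then show ?thesis using sum_squares_bound[of "cmod (h (of_real t))" "1 / s"] by simp
    qed
    ultimately show "cmod (U (of_real t)) \<le> (cmod (h (of_real t)))\<^sup>2 + (1 + cmod c) / (t - x)\<^sup>2"
      unfolding s(2) by (simp add: add_divide_distrib power_divide power2_eq_square)
  qed (auto simp: add_nonneg_nonneg)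
  ultimately have "(LINT t|lborel. U (of_real t)) = 0"
    by (intro integral_eq_0_upper_half_plane contU holomorphic_on_subset[OF holU]) (use S'(2) in auto)
  with int show ?thesis
    by (rule that) (auto simp: U_def w_def q_def c_def)
qed

section \<open>De Branges spaces and their kernels at real points\<close>

lemma entire_eq_off_point:
  assumes "f holomorphic_on UNIV" "g holomorphic_on UNIV" "\<And>z. z \<noteq> a \<Longrightarrow> f z = g z"
  shows "f z = g z"
proof (cases "z = a")
  case True
  have "(\<lambda>z. f z - g z) holomorphic_on UNIV" by (intro holomorphic_intros assms)
  then have "norm (f a - g a) \<le> 0" by (rule norm_le_at_puncture) (use assms(3) in auto)
  then show ?thesis using True by simp
qed (use assms in auto)

lemma entire_continuous_on_reals:
  assumes "f holomorphic_on UNIV"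
  shows "continuous_on S (\<lambda>t. f (complex_of_real t))"
proof (rule continuous_on_compose2[of UNIV f])
  show "continuous_on UNIV f" using assms by (rule holomorphic_on_imp_continuous_on)
  show "continuous_on S complex_of_real" by (rule continuous_on_of_real_id)
qed simp

text \<open>Without zeros on the real axis, \<open>E\<close> has no zeros in the closed upper half-plane, so quotients by \<open>E\<close>
are continuous up to the real axis.\<close>

locale hermite_biehler =
  fixes E :: "complex \<Rightarrow> complex"
  assumes HB: "E \<in> HB" and real_nz: "E (complex_of_real x) \<noteq> 0"
begin

lemma entire: "E holomorphic_on UNIV"
  using HB by (simp add: HB_def)

lemma star_lt: "Im z > 0 \<Longrightarrow> cmod (star E z) < cmod (E z)"
  using HB by (simp add: HB_def star_def upper_half_alt)

lemma closed_half_plane_cases: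
  assumes "Im z \<ge> 0"
  obtains x where "z = of_real x" | "Im z > 0"
proof (cases "Im z = 0")
  case True
  then have "z = of_real (Re z)" by (simp add: complex_eq_iff)
  then show ?thesis by (rule that(1))
qed (rule that(2), use assms in linarith)

lemma nonzero: "Im z \<ge> 0 \<Longrightarrow> E z \<noteq> 0"
proof (erule closed_half_plane_cases)
  assume "Im z > 0"
  then have "cmod (E z) > 0" using star_lt[of z] norm_ge_zero[of "star E z"] by linarith
  then show ?thesis by simp
qed (simp add: real_nz)

lemma star_le: "Im z \<ge> 0 \<Longrightarrow> cmod (star E z) \<le> cmod (E z)"
  by (erule closed_half_plane_cases) (auto simp: less_imp_le star_lt)

lemma measurable_quotient:
  assumes "f holomorphic_on UNIV"
  shows "(\<lambda>t. f (complex_of_real t) / E (of_real t)) \<in> borel_measurable borel"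
proof (rule borel_measurable_continuous_onI)
  show "continuous_on UNIV (\<lambda>t. f (complex_of_real t) / E (of_real t))"
    by (intro continuous_on_divide entire_continuous_on_reals assms entire) (simp add: real_nz)
qed

lemma dB_entire: "f \<in> dB E \<Longrightarrow> f holomorphic_on UNIV"
  by (simp add: dB_iff)

lemma dB_inner_alt:
  "dB_inner E f g = (LINT t|lborel. (f (of_real t) / E (of_real t)) * cnj (g (of_real t) / E (of_real t)))"
  unfolding dB_inner_def complex_norm_square by (intro Bochner_Integration.integral_cong) simp_all

lemma integrable_inner:
  assumes "f \<in> dB E" "g \<in> dB E"
  shows "complex_integrable lborel (\<lambda>t. (f (of_real t) / E (of_real t)) * cnj (g (of_real t) / E (of_real t)))"
proof (rule integrable_product_L2)
  show "(\<lambda>t. f (of_real t) / E (of_real t)) \<in> borel_measurable borel"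
    by (rule measurable_quotient[OF dB_entire[OF assms(1)]])
  have "cnj \<in> borel_measurable borel" by (intro borel_measurable_continuous_onI continuous_intros)
  then show "(\<lambda>t. cnj (g (of_real t) / E (of_real t))) \<in> borel_measurable borel"
    by (rule measurable_compose[OF measurable_quotient[OF dB_entire[OF assms(2)]]])
qed (use assms in \<open>simp_all add: dB_iff del: complex_cnj_divide\<close>)

lemma dB_add:
  assumes f: "f \<in> dB E" and g: "g \<in> dB E"
  shows "(\<lambda>z. f z + g z) \<in> dB E"
  unfolding dB_iff
proof (intro conjI)
  have fg: "f holomorphic_on UNIV" "g holomorphic_on UNIV" using f g by (simp_all add: dB_iff)
  then show ent: "(\<lambda>z. f z + g z) holomorphic_on UNIV" by (intro holomorphic_intros)
  have "smirnov (\<lambda>z. f z / E z + g z / E z)" "smirnov (\<lambda>z. star f z / E z + star g z / E z)"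
    using f g by (auto simp: dB_iff intro: smirnov_add)
  then show "smirnov (\<lambda>z. (f z + g z) / E z)" "smirnov (\<lambda>z. star (\<lambda>z. f z + g z) z / E z)"
    by (simp_all add: add_divide_distrib star_def)
  let ?w = "\<lambda>t. 2 * (cmod (f (of_real t) / E (of_real t)))\<^sup>2 + 2 * (cmod (g (of_real t) / E (of_real t)))\<^sup>2"
  have "integrable lborel ?w"
    using f g unfolding dB_iff by (intro Bochner_Integration.integrable_add integrable_mult_right) auto
  then show "integrable lborel (\<lambda>t. (cmod ((f (of_real t) + g (of_real t)) / E (of_real t)))\<^sup>2)"
  proof (rule Bochner_Integration.integrable_bound)
    show "(\<lambda>t. (cmod ((f (of_real t) + g (of_real t)) / E (of_real t)))\<^sup>2) \<in> borel_measurable lborel"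
      using measurable_quotient[OF ent] by simp
    show "AE t in lborel. norm ((cmod ((f (of_real t) + g (of_real t)) / E (of_real t)))\<^sup>2) \<le> norm (?w t)"
    proof (rule AE_I2)
      fix t
      define a where "a = f (of_real t) / E (of_real t)"
      define b where "b = g (of_real t) / E (of_real t)"
      have "(cmod (a + b))\<^sup>2 \<le> (cmod a + cmod b)\<^sup>2" by (intro power_mono norm_triangle_ineq) auto
      also have "\<dots> \<le> 2 * (cmod a)\<^sup>2 + 2 * (cmod b)\<^sup>2"
        using sum_squares_bound[of "cmod a" "cmod b"] by (simp add: power2_sum)
      finally show "norm ((cmod ((f (of_real t) + g (of_real t)) / E (of_real t)))\<^sup>2) \<le> norm (?w t)"
        by (simp add: a_def b_def add_divide_distrib)
    qed
  qed
qed

lemma dB_scale: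
  assumes f: "f \<in> dB E"
  shows "(\<lambda>z. c * f z) \<in> dB E"
  unfolding dB_iff
proof (intro conjI)
  show "(\<lambda>z. c * f z) holomorphic_on UNIV" using f by (auto simp: dB_iff intro!: holomorphic_intros)
  have "smirnov (\<lambda>z. c * (f z / E z))" "smirnov (\<lambda>z. cnj c * (star f z / E z))"
    using f unfolding dB_iff by (auto intro!: smirnov_mult_bounded[where B = "cmod c"] simp del: times_divide_eq_right)
  then show "smirnov (\<lambda>z. c * f z / E z)" "smirnov (\<lambda>z. star (\<lambda>z. c * f z) z / E z)"
    by (simp_all add: star_def)
  have "integrable lborel (\<lambda>t. (cmod c)\<^sup>2 * (cmod (f (of_real t) / E (of_real t)))\<^sup>2)"
    using f unfolding dB_iff by (intro integrable_mult_right) auto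
  then show "integrable lborel (\<lambda>t. (cmod (c * f (of_real t) / E (of_real t)))\<^sup>2)"
    by (simp add: norm_mult norm_divide power_mult_distrib power_divide)
qed

lemma smirnov_zero: "smirnov (\<lambda>z. 0)"
proof -
  have "bounded_type (\<lambda>z. 0)"
    by (rule bounded_typeI[of _ "\<lambda>z. 0" "\<lambda>z. 1"])
       (auto simp: upper_half_alt image_constant_conv intro!: exI[of _ \<i>])
  then show ?thesis by (auto simp: smirnov_def nonpos_type_def)
qed

lemma dB_zero: "(\<lambda>z. 0) \<in> dB E"
  using smirnov_zero by (simp add: dB_iff star_def)

sublocale sp: semi_inner_space "dB E" "dB_inner E"
proof
  show "(\<lambda>z. 0) \<in> dB E" by (rule dB_zero)
  show "(\<lambda>z. f z + g z) \<in> dB E" if "f \<in> dB E" "g \<in> dB E" for f g using that by (rule dB_add)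
  show "(\<lambda>z. c * f z) \<in> dB E" if "f \<in> dB E" for f c using that by (rule dB_scale)
  show "dB_inner E (\<lambda>z. f z + g z) h = dB_inner E f h + dB_inner E g h"
    if "f \<in> dB E" "g \<in> dB E" "h \<in> dB E" for f g h
    unfolding dB_inner_alt
    by (subst Bochner_Integration.integral_add[symmetric, OF integrable_inner[OF that(1,3)] integrable_inner[OF that(2,3)]])
       (simp add: add_divide_distrib distrib_right)
  show "dB_inner E (\<lambda>z. c * f z) h = c * dB_inner E f h" for f h c
    unfolding dB_inner_alt by (subst integral_mult_right_zero[symmetric]) (simp add: mult.assoc)
  show "dB_inner E g f = cnj (dB_inner E f g)" for f g
    unfolding dB_inner_alt by (subst Bochner_Integration.integral_cnj[symmetric]) (simp add: mult.commute)
  show "Re (dB_inner E f f) \<ge> 0" for f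
  proof -
    have "dB_inner E f f = (LINT t|lborel. complex_of_real ((cmod (f (of_real t) / E (of_real t)))\<^sup>2))"
      unfolding dB_inner_alt by (simp only: complex_norm_square)
    then show ?thesis by (simp del: of_real_power)
  qed
qed

lemma nrm_eq: "sp.nrm f = dB_norm E f"
proof -
  have "dB_inner E f f = (LINT t|lborel. complex_of_real ((cmod (f (of_real t) / E (of_real t)))\<^sup>2))"
    unfolding dB_inner_alt by (simp only: complex_norm_square)
  then show ?thesis by (simp add: sp.nrm_def dB_norm_def del: of_real_power)
qed

abbreviation K :: "real \<Rightarrow> complex \<Rightarrow> complex" where
  "K x \<equiv> dB_kernel E (complex_of_real x)"

text \<open>The kernel at a real point is \<open>K x z = numer x z / (2 * pi * \<i> * (x - z))\<close>.\<close>

definition numer :: "real \<Rightarrow> complex \<Rightarrow> complex" where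
  "numer x z = cnj (E (of_real x)) * E z - E (of_real x) * star E z"

lemma numer_entire: "numer x holomorphic_on UNIV"
  unfolding numer_def by (intro holomorphic_intros entire star_holomorphic)

lemma numer_at [simp]: "numer x (of_real x) = 0"
  by (simp add: numer_def mult.commute)

lemma kernel_alt:
  "K x z = (if z = of_real x then deriv (\<lambda>z. - numer x z / (2 * of_real pi * \<i>)) (of_real x)
     else numer x z / (2 * of_real pi * \<i> * (of_real x - z)))"
proof (cases "z = of_real x")
  case True
  let ?g = "\<lambda>z. - numer x z / (2 * of_real pi * \<i>)"
  have "?g holomorphic_on UNIV" by (intro holomorphic_intros numer_entire) auto
  then have "(?g has_field_derivative deriv ?g (of_real x)) (at (of_real x))"
    using holomorphic_derivI by blast
  then have "((\<lambda>z. (?g z - ?g (of_real x)) / (z - of_real x)) \<longlongrightarrow> deriv ?g (of_real x)) (at (of_real x))"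
    by (simp add: has_field_derivative_iff)
  moreover have "(?g z - ?g (of_real x)) / (z - of_real x) = dB_quot E (of_real x) z" if "z \<noteq> of_real x" for z
    using that by (simp add: dB_quot_def numer_def[symmetric] divide_simps) (simp add: algebra_simps)
  ultimately have "(dB_quot E (of_real x) \<longlongrightarrow> deriv ?g (of_real x)) (at (of_real x))"
    by (rule Lim_transform_within_open[OF _ open_UNIV UNIV_I]) auto
  then show ?thesis using True by (simp add: dB_kernel_def tendsto_Lim)
qed (simp add: dB_kernel_def dB_quot_def numer_def)

lemma numer_kernel: "numer x z = 2 * of_real pi * \<i> * (of_real x - z) * K x z"
  by (simp add: kernel_alt)

lemma kernel_entire: "K x holomorphic_on UNIV"
proof (rule pole_theorem_open_0[of "\<lambda>z. - numer x z / (2 * of_real pi * \<i>)" _ "of_real x"])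
  show "(\<lambda>z. - numer x z / (2 * of_real pi * \<i>)) holomorphic_on UNIV"
    by (intro holomorphic_intros numer_entire) auto
  show "- numer x z / (2 * of_real pi * \<i>) = (z - of_real x) * K x z" for z
  proof -
    define c where "c = 2 * complex_of_real pi * \<i>"
    have c: "c \<noteq> 0" by (simp add: c_def)
    have "- numer x z = c * ((z - of_real x) * K x z)"
      by (simp add: numer_kernel c_def algebra_simps)
    then show ?thesis using c unfolding c_def[symmetric] by simp
  qed
qed (auto simp: kernel_alt)

lemma star_kernel: "star (K x) = K x"
proof
  fix z
  show "star (K x) z = K x z"
  proof (rule entire_eq_off_point[OF star_holomorphic[OF kernel_entire] kernel_entire])
    fix z assume z: "z \<noteq> complex_of_real x"
    then have cz: "cnj z \<noteq> of_real x" by (metis complex_cnj_cnj complex_cnj_complex_of_real)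
    have "cnj (numer x (cnj z)) = - numer x z" by (simp add: numer_def star_def)
    then show "star (K x) z = K x z"
      using z cz by (simp add: star_def kernel_alt)
  qed
qed

text \<open>On the closed half-plane \<open>|star E z| \<le> |E z|\<close> bounds the numerator by \<open>2 * |E x| * |E z|\<close>, and
\<open>2 / (2 * pi) \<le> 1\<close>.\<close>

lemma kernel_quotient_bound:
  assumes z: "Im z \<ge> 0" "z \<noteq> of_real x"
  shows "cmod (K x z / E z) \<le> cmod (E (of_real x)) / cmod (z - of_real x)"
proof -
  define e where "e = cmod (E (of_real x))"
  have e: "e \<ge> 0" by (simp add: e_def)
  have "cmod (numer x z) \<le> e * cmod (E z) + e * cmod (star E z)"
    unfolding numer_def e_def by (rule order_trans[OF norm_triangle_ineq4]) (simp add: norm_mult)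
  also have "\<dots> \<le> 2 * e * cmod (E z)" using mult_left_mono[OF star_le[OF z(1)] e] by simp
  also have "\<dots> \<le> 2 * pi * (e * cmod (E z))"
    using pi_ge_two mult_right_mono[of 1 pi "e * cmod (E z)"] e by simp
  finally have *: "cmod (numer x z) \<le> 2 * pi * (e * cmod (E z))" .
  have "cmod (K x z / E z) = cmod (numer x z) / (2 * pi * cmod (z - of_real x) * cmod (E z))"
    using z by (simp add: kernel_alt norm_divide norm_mult norm_minus_commute)
  also have "\<dots> \<le> 2 * pi * (e * cmod (E z)) / (2 * pi * cmod (z - of_real x) * cmod (E z))"
    using * by (intro divide_right_mono) auto
  also have "\<dots> = e / cmod (z - of_real x)" using nonzero[OF z(1)] by simp
  finally show ?thesis by (simp add: e_def)
qed

lemma kernel_smirnov: "smirnov (\<lambda>z. K x z / E z)"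
  unfolding smirnov_def
proof
  define e where "e = cmod (E (of_real x))"
  have e: "e \<ge> 0" by (simp add: e_def)
  have den: "z + \<i> \<noteq> 0" "1 \<le> cmod (z + \<i>)" if "Im z > 0" for z
    using that abs_Im_le_cmod[of "z + \<i>"] by (auto simp: complex_eq_iff)
  have ne: "z \<noteq> of_real x" if "Im z > 0" for z using that by auto
  show "bounded_type (\<lambda>z. K x z / E z)"
  proof (rule bounded_typeI[of _ "\<lambda>z. K x z / E z * ((z - of_real x) / (z + \<i>))"
        "\<lambda>z. (z - of_real x) / (z + \<i>)"])
    have "K x holomorphic_on upper_half" "E holomorphic_on upper_half"
      using kernel_entire entire holomorphic_on_subset by blast+
    then show "(\<lambda>z. K x z / E z) holomorphic_on upper_half"
      "(\<lambda>z. K x z / E z * ((z - of_real x) / (z + \<i>))) holomorphic_on upper_half"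
      "(\<lambda>z. (z - of_real x) / (z + \<i>)) holomorphic_on upper_half"
      using den nonzero by (auto simp: upper_half_alt intro!: holomorphic_intros)
    show "bounded ((\<lambda>z. K x z / E z * ((z - of_real x) / (z + \<i>))) ` upper_half)"
    proof -
      have "cmod (K x z / E z * ((z - of_real x) / (z + \<i>))) \<le> e" if z: "Im z > 0" for z
      proof -
        have "cmod (K x z / E z) * (cmod (z - of_real x) / cmod (z + \<i>))
            \<le> e / cmod (z - of_real x) * (cmod (z - of_real x) / 1)"
          using kernel_quotient_bound[OF _ ne[OF z]] z den[OF z] e
          by (intro mult_mono frac_le) (auto simp: e_def)
        also have "\<dots> = e" using ne[OF z] by simp
        finally show ?thesis by (simp add: norm_mult norm_divide)
      qed
      then show ?thesis unfolding bounded_iff by (auto simp: upper_half_alt)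
    qed
    show "bounded ((\<lambda>z. (z - of_real x) / (z + \<i>)) ` upper_half)"
    proof -
      have "cmod ((z - of_real x) / (z + \<i>)) \<le> 1 + cmod (of_real x + \<i>)" if z: "Im z > 0" for z
      proof -
        have "cmod (z - of_real x) \<le> cmod (z + \<i>) * 1 + 1 * cmod (of_real x + \<i>)"
          using norm_triangle_ineq4[of "z + \<i>" "of_real x + \<i>"] by simp
        also have "\<dots> \<le> cmod (z + \<i>) * 1 + cmod (z + \<i>) * cmod (of_real x + \<i>)"
          using den(2)[OF z] by (intro add_left_mono mult_right_mono) auto
        finally have "cmod (z - of_real x) \<le> (1 + cmod (of_real x + \<i>)) * cmod (z + \<i>)" by (simp add: algebra_simps)
        then show ?thesis using den[OF z] by (simp add: norm_divide pos_divide_le_eq)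
      qed
      then show ?thesis unfolding bounded_iff by (auto simp: upper_half_alt)
    qed
    show "\<exists>z\<in>upper_half. (z - of_real x) / (z + \<i>) \<noteq> 0"
      by (rule bexI[of _ \<i>]) (auto simp: upper_half_alt complex_eq_iff)
  qed simp
  show "nonpos_type (\<lambda>z. K x z / E z)"
  proof (rule nonpos_type_bounded[where B = e])
    show "\<forall>\<^sub>F y in at_top. cmod (K x (\<i> * of_real y) / E (\<i> * of_real y)) \<le> e"
      using eventually_ge_at_top[of 1]
    proof eventually_elim
      case (elim y)
      have ne: "\<i> * of_real y \<noteq> of_real x" using elim by (auto simp: complex_eq_iff)
      have "1 \<le> cmod (\<i> * of_real y - of_real x)"
        using abs_Im_le_cmod[of "\<i> * of_real y - of_real x"] elim by simp
      then have "e / cmod (\<i> * of_real y - of_real x) \<le> e / 1" using e by (intro divide_left_mono) auto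
      then show ?case using kernel_quotient_bound[OF _ ne] elim by (simp add: e_def)
    qed
  qed
qed

lemma kernel_in_dB: "K x \<in> dB E"
  unfolding dB_iff star_kernel
proof (intro conjI kernel_entire kernel_smirnov)
  define e where "e = cmod (E (of_real x))"
  let ?k = "\<lambda>t. K x (of_real t) / E (of_real t)"
  have cont: "continuous_on UNIV ?k"
    by (intro continuous_on_divide entire_continuous_on_reals kernel_entire entire) (simp add: real_nz)
  have "integrable lborel (\<lambda>t. complex_of_real ((cmod (?k t))\<^sup>2))"
  proof (rule integrable_decay[of _ "\<lambda>t. 0" "e\<^sup>2" x])
    show "continuous_on UNIV (\<lambda>t. complex_of_real ((cmod (?k t))\<^sup>2))"
      by (intro continuous_on_of_real continuous_on_power continuous_on_norm cont)
    fix t :: real assume t: "1 \<le> \<bar>t - x\<bar>"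
    then have "(of_real t :: complex) \<noteq> of_real x" by auto
    then have "cmod (?k t) \<le> e / \<bar>t - x\<bar>"
      using kernel_quotient_bound[of "of_real t" x] by (simp add: e_def flip: of_real_diff)
    then have "(cmod (?k t))\<^sup>2 \<le> (e / \<bar>t - x\<bar>)\<^sup>2" by (intro power_mono) auto
    then show "cmod (complex_of_real ((cmod (?k t))\<^sup>2)) \<le> 0 + e\<^sup>2 / (t - x)\<^sup>2"
      by (simp add: power_divide norm_power)
  qed auto
  then show "integrable lborel (\<lambda>t. (cmod (?k t))\<^sup>2)" by (simp only: complex_of_real_integrable_eq)
qed

text \<open>On the real axis the integrand equals \<open>1 / (2 * pi * \<i> * (t - x))\<close> times
\<open>E x * (f / E) t - cnj (E x * (star f / E) t)\<close>. Subtracting from \<open>f / E\<close> and \<open>star f / E\<close> their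
values at \<open>x\<close> times \<open>q = \<i> / (t - x + \<i>)\<close> leaves functions with integral zero. What remains is
\<open>f x * (q - cnj q) / (t - x) = 2 * \<i> * f x / (1 + (t - x)\<^sup>2)\<close>, whose integral is \<open>2 * pi * \<i> * f x\<close>.\<close>

lemma reproducing:
  assumes f: "f \<in> dB E"
  shows "dB_inner E f (K x) = f (of_real x)"
proof -
  define S where "S = {z. E z \<noteq> 0}"
  have "open (E -` (- {0}))"
    by (intro open_vimage holomorphic_on_imp_continuous_on entire) auto
  then have S: "open S" "{z. Im z \<ge> 0} \<subseteq> S" using nonzero by (auto simp: S_def vimage_def)
  have quot: "(\<lambda>z. g z / E z) holomorphic_on S" if "g holomorphic_on UNIV" for g
    by (intro holomorphic_intros holomorphic_on_subset[OF that] holomorphic_on_subset[OF entire]) (auto simp: S_def)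
  define e where "e = E (of_real x)"
  have e: "e \<noteq> 0" by (simp add: e_def real_nz)
  define q where "q = (\<lambda>s. \<i> / (complex_of_real s + \<i>))"
  have f': "f holomorphic_on UNIV" "smirnov (\<lambda>z. f z / E z)" "smirnov (\<lambda>z. star f z / E z)"
    "integrable lborel (\<lambda>t. (cmod (f (of_real t) / E (of_real t)))\<^sup>2)"
    using f by (auto simp: dB_iff)
  obtain U1 where U1: "integrable lborel U1" "(LINT t|lborel. U1 t) = 0"
    and U1_eq: "\<And>t. t \<noteq> x \<Longrightarrow> U1 t = (f (of_real t) / E (of_real t) - f (of_real x) / e * q (t - x)) / of_real (t - x)"
    using hardy_divided_difference[OF quot[OF f'(1)] S f'(2) f'(4), of x] unfolding q_def e_def by blast
  have L2': "integrable lborel (\<lambda>t. (cmod (star f (of_real t) / E (of_real t)))\<^sup>2)"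
    using f'(4) by (simp add: norm_divide)
  obtain U2 where U2: "integrable lborel U2" "(LINT t|lborel. U2 t) = 0"
    and U2_eq: "\<And>t. t \<noteq> x \<Longrightarrow> U2 t = (star f (of_real t) / E (of_real t) - star f (of_real x) / e * q (t - x)) / of_real (t - x)"
    using hardy_divided_difference[OF quot[OF star_holomorphic[OF f'(1)]] S f'(3) L2', of x] unfolding q_def e_def by blast
  define R where "R = (\<lambda>t. (e * U1 t - cnj (e * U2 t) + 2 * \<i> * f (of_real x) * complex_of_real (1 / (1 + (t - x)\<^sup>2)))
      * (1 / (2 * of_real pi * \<i>)))"
  have "has_bochner_integral lborel R ((e * 0 - cnj (e * 0) + 2 * \<i> * f (of_real x) * of_real pi) * (1 / (2 * of_real pi * \<i>)))"
    unfolding R_def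
  proof (intro has_bochner_integral_mult_left has_bochner_integral_add has_bochner_integral_diff
      has_bochner_integral_mult_right has_bochner_integral_bounded_linear[OF bounded_linear_cnj]
      has_bochner_integral_bounded_linear[OF bounded_linear_of_real])
    show "has_bochner_integral lborel U1 0" "has_bochner_integral lborel U2 0"
      using U1 U2 by (auto simp: has_bochner_integral_iff)
    show "has_bochner_integral lborel (\<lambda>t. 1 / (1 + (t - x)\<^sup>2)) pi"
      using integrable_lorentz integral_lorentz by (auto simp: has_bochner_integral_iff)
  qed
  then have R: "integrable lborel R" "(LINT t|lborel. R t) = f (of_real x)"
    by (auto simp: has_bochner_integral_iff)
  have "dB_inner E f (K x) = (LINT t|lborel. R t)"
    unfolding dB_inner_alt
  proof (rule integral_cong_AE)
    show "R \<in> borel_measurable lborel" using R(1) by (rule borel_measurable_integrable)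
    show "(\<lambda>t. f (of_real t) / E (of_real t) * cnj (K x (of_real t) / E (of_real t))) \<in> borel_measurable lborel"
      using borel_measurable_integrable[OF integrable_inner[OF f kernel_in_dB]] .
    have "f (of_real t) / E (of_real t) * cnj (K x (of_real t) / E (of_real t)) = R t"
      if t: "t \<noteq> x" for t
    proof -
      define s where "s = t - x"
      define a where "a = E (of_real t)"
      define fx where "fx = f (of_real x)"
      define ft where "ft = f (of_real t)"
      have s: "s \<noteq> 0" using t by (simp add: s_def)
      have cs: "complex_of_real s \<noteq> 0" using s by simp
      have a: "a \<noteq> 0" by (simp add: a_def real_nz)
      have tx: "complex_of_real t \<noteq> of_real x" using t by simp
      have 1: "cnj (K x (of_real t)) = (e * cnj a - cnj e * a) / (2 * of_real pi * \<i> * of_real s)"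
      proof -
        have "cnj (K x (of_real t))
            = (e * cnj a - cnj e * a) / (- (2 * of_real pi * \<i> * (of_real x - of_real t)))"
          using tx by (simp add: kernel_alt numer_def e_def a_def mult.commute)
        also have "- (2 * of_real pi * \<i> * (of_real x - of_real t)) = 2 * of_real pi * \<i> * complex_of_real s"
          by (simp add: s_def algebra_simps)
        finally show ?thesis .
      qed
      have qq: "q s - cnj (q s) = 2 * \<i> * of_real s * complex_of_real (1 / (1 + s\<^sup>2))"
      proof -
        have d: "complex_of_real s + \<i> \<noteq> 0" "complex_of_real s - \<i> \<noteq> 0" by (auto simp: complex_eq_iff)
        have p: "complex_of_real (1 + s\<^sup>2) = (of_real s + \<i>) * (of_real s - \<i>)"
          by (simp add: algebra_simps power2_eq_square)
        have "q s - cnj (q s) = \<i> / (of_real s + \<i>) + \<i> / (of_real s - \<i>)" by (simp add: q_def)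
        also have "\<dots> = 2 * \<i> * of_real s / ((of_real s + \<i>) * (of_real s - \<i>))"
          using d by (simp add: add_frac_eq) (simp add: algebra_simps)
        finally show ?thesis unfolding p[symmetric] by (simp add: divide_inverse of_real_inverse)
      qed
      have P: "e * U1 t = (e * (ft / a) - fx * q s) / of_real s"
        using e unfolding U1_eq[OF t] s_def[symmetric] a_def[symmetric] fx_def[symmetric] ft_def[symmetric]
        by (simp add: right_diff_distrib)
      have Q: "cnj (e * U2 t) = (cnj e * (ft / cnj a) - fx * cnj (q s)) / of_real s"
        using e unfolding U2_eq[OF t] s_def[symmetric] a_def[symmetric] star_of_real fx_def[symmetric] ft_def[symmetric]
        by (simp add: right_diff_distrib)
      have "e * U1 t - cnj (e * U2 t)
          = ((e * (ft / a) - fx * q s) - (cnj e * (ft / cnj a) - fx * cnj (q s))) / of_real s"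
        unfolding P Q by (rule diff_divide_distrib[symmetric])
      also have "(e * (ft / a) - fx * q s) - (cnj e * (ft / cnj a) - fx * cnj (q s))
          = e * (ft / a) - cnj e * (ft / cnj a) - fx * (q s - cnj (q s))"
        by (simp add: right_diff_distrib del: times_divide_eq_right)
      finally have "e * U1 t - cnj (e * U2 t) = (e * (ft / a) - cnj e * (ft / cnj a) - fx * (q s - cnj (q s))) / of_real s" .
      then have "e * U1 t - cnj (e * U2 t) + 2 * \<i> * fx * complex_of_real (1 / (1 + s\<^sup>2))
          = (e * (ft / a) - cnj e * (ft / cnj a)) / of_real s"
        unfolding qq using cs by (simp add: diff_divide_distrib)
      then have "R t = (e * (ft / a) - cnj e * (ft / cnj a)) / of_real s * (1 / (2 * of_real pi * \<i>))"
        by (simp add: R_def s_def fx_def)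
      also have "e * (ft / a) - cnj e * (ft / cnj a) = ft / a * ((e * cnj a - cnj e * a) / cnj a)"
        using a by (simp add: field_simps)
      finally show ?thesis
        unfolding complex_cnj_divide 1 ft_def[symmetric] a_def[symmetric] by (simp add: mult_ac)
    qed
    then show "AE t in lborel. f (of_real t) / E (of_real t) * cnj (K x (of_real t) / E (of_real t)) = R t"
      using AE_lborel_singleton[of x] by (auto elim!: eventually_mono)
  qed
  with R show ?thesis by simp
qed

lemma kernel_diag: "K x (of_real x) = of_real ((dB_norm E (K x))\<^sup>2)"
  using reproducing[OF kernel_in_dB[of x], of x] sp.ip_self[OF kernel_in_dB[of x]] by (simp add: nrm_eq)

text \<open>If \<open>K x\<close> had norm \<open>0\<close>, every function of the space would vanish at \<open>x\<close>, in particular every \<open>K y\<close>.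
Then \<open>numer x\<close> would vanish on the real axis, hence identically, which contradicts
\<open>|star E z| < |E z|\<close> in the upper half-plane.\<close>

lemma kernel_norm_pos: "dB_norm E (K x) > 0"
proof (rule ccontr)
  assume "\<not> ?thesis"
  then have 0: "sp.nrm (K x) = 0"
    using sp.nrm_nonneg[OF kernel_in_dB[of x]] by (simp add: nrm_eq)
  have zero: "numer x (of_real y) = 0" for y
  proof -
    have "K y (of_real x) = 0"
      using sp.cauchy_schwarz[OF kernel_in_dB[of y] kernel_in_dB[of x]] reproducing[OF kernel_in_dB[of y], of x] 0 by simp
    then have "numer y (of_real x) = 0" by (simp add: numer_kernel)
    then show ?thesis by (simp add: numer_def algebra_simps)
  qed
  have "(0::complex) islimpt range of_real"
    unfolding islimpt_approachable
  proof (intro allI impI)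
    fix \<epsilon> :: real assume "\<epsilon> > 0"
    then show "\<exists>y\<in>range of_real. y \<noteq> 0 \<and> dist y (0::complex) < \<epsilon>"
      by (intro bexI[OF _ rangeI[of _ "\<epsilon> / 2"]]) auto
  qed
  then have "numer x \<i> = 0"
    using zero analytic_continuation[OF numer_entire open_UNIV connected_UNIV subset_UNIV UNIV_I _ _ UNIV_I]
    by blast
  then have "cnj (E (of_real x)) * E \<i> = E (of_real x) * star E \<i>" by (simp add: numer_def)
  from arg_cong[OF this, of cmod]
  have "cmod (E (of_real x)) * cmod (E \<i>) = cmod (E (of_real x)) * cmod (star E \<i>)" by (simp add: norm_mult)
  then show False using star_lt[of \<i>] real_nz[of x] by simp
qed

end

lemma hermite_biehler_mult:
  assumes "hermite_biehler E" "hermite_biehler F"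
  shows "hermite_biehler (\<lambda>z. E z * F z)"
proof
  interpret E: hermite_biehler E by fact
  interpret F: hermite_biehler F by fact
  show "(\<lambda>z. E z * F z) \<in> HB" unfolding HB_def
  proof (intro CollectI conjI ballI)
    show "(\<lambda>z. E z * F z) holomorphic_on UNIV" by (intro holomorphic_intros E.entire F.entire)
    fix z assume "z \<in> upper_half"
    then have z: "Im z > 0" by (simp add: upper_half_alt)
    have "cmod (star E z) * cmod (star F z) < cmod (E z) * cmod (F z)"
      using E.star_lt[OF z] F.star_lt[OF z] by (intro mult_strict_mono') auto
    then show "cmod (E (cnj z) * F (cnj z)) < cmod (E z * F z)" by (simp add: star_def norm_mult)
  qed
  show "E (of_real x) * F (of_real x) \<noteq> 0" for x using E.real_nz F.real_nz by simp
qed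

lemma kernel_mult:
  assumes "hermite_biehler E" "hermite_biehler F"
  shows "dB_kernel (\<lambda>z. E z * F z) (of_real x) z =
    cnj (F (of_real x)) * F z * dB_kernel E (of_real x) z + E (of_real x) * star E z * dB_kernel F (of_real x) z"
proof -
  interpret E: hermite_biehler E by fact
  interpret F: hermite_biehler F by fact
  interpret EF: hermite_biehler "\<lambda>z. E z * F z" by (rule hermite_biehler_mult[OF assms])
  show ?thesis
  proof (rule entire_eq_off_point[where a = "of_real x" and z = z and f = "dB_kernel (\<lambda>z. E z * F z) (of_real x)"
        and g = "\<lambda>z. cnj (F (of_real x)) * F z * dB_kernel E (of_real x) z + E (of_real x) * star E z * dB_kernel F (of_real x) z"])
    show "dB_kernel (\<lambda>z. E z * F z) (of_real x) holomorphic_on UNIV" by (rule EF.kernel_entire)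
    show "(\<lambda>z. cnj (F (of_real x)) * F z * dB_kernel E (of_real x) z + E (of_real x) * star E z * dB_kernel F (of_real x) z) holomorphic_on UNIV"
      by (intro holomorphic_intros E.kernel_entire F.kernel_entire F.entire star_holomorphic E.entire)
    fix z assume z: "z \<noteq> complex_of_real x"
    define d where "d = 2 * of_real pi * \<i> * (of_real x - z)"
    have d: "d \<noteq> 0" using z by (simp add: d_def)
    have "EF.numer x z = cnj (F (of_real x)) * F z * E.numer x z + E (of_real x) * star E z * F.numer x z"
      by (simp add: EF.numer_def E.numer_def F.numer_def star_def algebra_simps)
    then show "dB_kernel (\<lambda>z. E z * F z) (of_real x) z =
      cnj (F (of_real x)) * F z * dB_kernel E (of_real x) z + E (of_real x) * star E z * dB_kernel F (of_real x) z"
      using z by (simp add: EF.kernel_alt E.kernel_alt F.kernel_alt d_def[symmetric] add_divide_distrib)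
  qed
qed

section \<open>Products, orthogonality, and the Riesz basis\<close>

lemma dB_norm_power2:
  "(dB_norm E f)\<^sup>2 = (LINT t|lborel. (cmod (f (of_real t) / E (of_real t)))\<^sup>2)"
  unfolding dB_norm_def by (rule real_sqrt_pow2) (simp add: Bochner_Integration.integral_nonneg)

lemma (in hermite_biehler) star_quotient_holomorphic: "(\<lambda>z. star E z / E z) holomorphic_on upper_half"
proof (rule holomorphic_on_divide)
  show "star E holomorphic_on upper_half" "E holomorphic_on upper_half"
    using holomorphic_on_subset[OF star_holomorphic[OF entire]] holomorphic_on_subset[OF entire] by auto
qed (auto simp: upper_half_alt nonzero)

lemma (in hermite_biehler) star_quotient_bound: "Im z \<ge> 0 \<Longrightarrow> cmod (star E z / E z) \<le> 1"
  using star_le[of z] nonzero[of z] by (simp add: norm_divide)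

lemma (in hermite_biehler) gram:
  assumes "finite A"
  shows "complex_of_real ((dB_norm E (\<lambda>z. \<Sum>n\<in>A. c n * dB_kernel E (of_real (x n)) z))\<^sup>2)
    = (\<Sum>n\<in>A. \<Sum>m\<in>A. c n * cnj (c m) * dB_kernel E (of_real (x n)) (of_real (x m)))"
proof -
  let ?k = "\<lambda>n. dB_kernel E (of_real (x n))"
  let ?f = "\<lambda>z. \<Sum>n\<in>A. c n * ?k n z"
  have f: "?f \<in> dB E" using assms by (rule sp.sum_in) (rule kernel_in_dB)
  have "complex_of_real ((dB_norm E ?f)\<^sup>2) = dB_inner E ?f ?f" using sp.ip_self[OF f] by (simp add: nrm_eq)
  also have "\<dots> = (\<Sum>n\<in>A. c n * dB_inner E (?k n) ?f)" by (rule sp.ip_sum[OF assms kernel_in_dB f])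
  also have "\<dots> = (\<Sum>n\<in>A. c n * (\<Sum>m\<in>A. cnj (c m) * dB_inner E (?k n) (?k m)))"
    by (intro sum.cong refl arg_cong2[of _ _ _ _ "(*)"] sp.ip_sum_right[OF assms kernel_in_dB kernel_in_dB])
  also have "\<dots> = (\<Sum>n\<in>A. \<Sum>m\<in>A. c n * cnj (c m) * ?k n (of_real (x m)))"
    by (simp add: sum_distrib_left mult.assoc reproducing kernel_in_dB)
  finally show ?thesis .
qed

locale hermite_biehler_pair = E: hermite_biehler E + F: hermite_biehler F for E F
begin

sublocale EF: hermite_biehler "\<lambda>z. E z * F z"
  by (rule hermite_biehler_mult) unfold_locales

lemma left_summand_in_dB:
  assumes f: "f \<in> dB E"
  shows "(\<lambda>z. F z * f z) \<in> dB (\<lambda>z. E z * F z)"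
  unfolding dB_iff
proof (intro conjI)
  show "(\<lambda>z. F z * f z) holomorphic_on UNIV" using f by (intro holomorphic_intros F.entire) (simp add: dB_iff)
  show "integrable lborel (\<lambda>t. (cmod (F (of_real t) * f (of_real t) / (E (of_real t) * F (of_real t))))\<^sup>2)"
    using f by (simp add: dB_iff F.real_nz)
  have "smirnov (\<lambda>z. f z / E z)" using f by (simp add: dB_iff)
  then show "smirnov (\<lambda>z. F z * f z / (E z * F z))"
    by (rule smirnov_cong) (simp add: F.nonzero)
  have "smirnov (\<lambda>z. star F z / F z * (star f z / E z))"
    using f F.star_quotient_bound
    by (intro smirnov_mult_bounded[where B = 1] F.star_quotient_holomorphic) (auto simp: dB_iff)
  then show "smirnov (\<lambda>z. star (\<lambda>z. F z * f z) z / (E z * F z))"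
    by (simp add: star_def mult.commute)
qed

lemma right_summand_in_dB:
  assumes g: "g \<in> dB F"
  shows "(\<lambda>z. star E z * g z) \<in> dB (\<lambda>z. E z * F z)"
  unfolding dB_iff
proof (intro conjI)
  show "(\<lambda>z. star E z * g z) holomorphic_on UNIV"
    using g by (intro holomorphic_intros star_holomorphic E.entire) (simp add: dB_iff)
  show "integrable lborel (\<lambda>t. (cmod (star E (of_real t) * g (of_real t) / (E (of_real t) * F (of_real t))))\<^sup>2)"
    using g by (simp add: dB_iff E.real_nz norm_mult norm_divide)
  have "smirnov (\<lambda>z. star E z / E z * (g z / F z))"
    using g E.star_quotient_bound
    by (intro smirnov_mult_bounded[where B = 1] E.star_quotient_holomorphic) (auto simp: dB_iff)
  then show "smirnov (\<lambda>z. star E z * g z / (E z * F z))" by simp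
  have "smirnov (\<lambda>z. star g z / F z)" using g by (simp add: dB_iff)
  then show "smirnov (\<lambda>z. star (\<lambda>z. star E z * g z) z / (E z * F z))"
    by (rule smirnov_cong) (simp add: star_def E.nonzero)
qed

lemma sum_in_dB:
  "f \<in> dB E \<Longrightarrow> g \<in> dB F \<Longrightarrow> (\<lambda>z. F z * f z + star E z * g z) \<in> dB (\<lambda>z. E z * F z)"
  by (intro EF.dB_add left_summand_in_dB right_summand_in_dB)

text \<open>On the real axis \<open>|star E / E| = 1\<close>, and the cross term is the real part of the integral of
\<open>(star f / E) * (g / F)\<close>, a product of two square integrable functions of the Smirnov class, which
vanishes.\<close>

lemma pythagoras:
  assumes f: "f \<in> dB E" and g: "g \<in> dB F"
  shows "(dB_norm (\<lambda>z. E z * F z) (\<lambda>z. F z * f z + star E z * g z))\<^sup>2 = (dB_norm E f)\<^sup>2 + (dB_norm F g)\<^sup>2"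
proof -
  let ?a = "\<lambda>t. (cmod (f (complex_of_real t) / E (of_real t)))\<^sup>2"
  let ?b = "\<lambda>t. (cmod (g (complex_of_real t) / F (of_real t)))\<^sup>2"
  let ?c = "\<lambda>t. star f (complex_of_real t) / E (of_real t) * (g (of_real t) / F (of_real t))"
  have ab: "integrable lborel ?a" "integrable lborel ?b" using f g by (auto simp: dB_iff)
  have a': "integrable lborel (\<lambda>t. (cmod (star f (complex_of_real t) / E (of_real t)))\<^sup>2)"
    using ab(1) by (simp add: norm_divide)
  have ent: "star f holomorphic_on UNIV" "g holomorphic_on UNIV"
    using f g by (auto simp: dB_iff intro: star_holomorphic)
  have c: "integrable lborel ?c"
    by (intro integrable_product_L2 E.measurable_quotient F.measurable_quotient ent a' ab(2))
  have c0: "(LINT t|lborel. ?c t) = 0"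
  proof (rule integral_product_eq_0[of "\<lambda>z. star f z / E z" "{z. E z \<noteq> 0} \<inter> {z. F z \<noteq> 0}" "\<lambda>z. g z / F z"])
    show "(\<lambda>z. star f z / E z) holomorphic_on {z. E z \<noteq> 0} \<inter> {z. F z \<noteq> 0}"
      by (intro holomorphic_on_divide holomorphic_on_subset[OF ent(1)] holomorphic_on_subset[OF E.entire]) auto
    show "(\<lambda>z. g z / F z) holomorphic_on {z. E z \<noteq> 0} \<inter> {z. F z \<noteq> 0}"
      by (intro holomorphic_on_divide holomorphic_on_subset[OF ent(2)] holomorphic_on_subset[OF F.entire]) auto
    show "{z. 0 \<le> Im z} \<subseteq> {z. E z \<noteq> 0} \<inter> {z. F z \<noteq> 0}" using E.nonzero F.nonzero by auto
  qed (use f g a' ab in \<open>auto simp: dB_iff\<close>)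
  have "(LINT t|lborel. (cmod ((F (of_real t) * f (of_real t) + star E (of_real t) * g (of_real t)) / (E (of_real t) * F (of_real t))))\<^sup>2)
      = (LINT t|lborel. ?a t + ?b t + 2 * Re (?c t))"
  proof (intro Bochner_Integration.integral_cong refl)
    fix t
    define e where "e = E (of_real t)"
    define p where "p = f (of_real t) / e"
    define r where "r = g (of_real t) / F (of_real t)"
    have e: "e \<noteq> 0" by (simp add: e_def E.real_nz)
    define w where "w = cnj e / e"
    have w: "cmod w = 1" using e by (simp add: w_def norm_divide)
    have 1: "(F (of_real t) * f (of_real t) + star E (of_real t) * g (of_real t)) / (E (of_real t) * F (of_real t)) = p + w * r"
      using F.real_nz[of t] e by (simp add: p_def r_def w_def e_def[symmetric] add_divide_distrib)
    have 2: "?c t = cnj p * w * r" using e by (simp add: p_def r_def w_def e_def)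
    have "(cmod (p + w * r))\<^sup>2 = (cmod p)\<^sup>2 + (cmod (w * r))\<^sup>2 + 2 * Re (cnj p * (w * r))"
      unfolding cmod_power2 by (simp add: power2_eq_square algebra_simps)
    also have "cmod (w * r) = cmod r" by (simp add: norm_mult w)
    finally show "(cmod ((F (of_real t) * f (of_real t) + star E (of_real t) * g (of_real t)) / (E (of_real t) * F (of_real t))))\<^sup>2
        = ?a t + ?b t + 2 * Re (?c t)"
      unfolding 1 2 by (simp add: p_def e_def r_def mult.assoc)
  qed
  also have "\<dots> = (LINT t|lborel. ?a t) + (LINT t|lborel. ?b t) + 2 * Re (LINT t|lborel. ?c t)"
  proof -
    have "has_bochner_integral lborel (\<lambda>t. ?a t + ?b t + 2 * Re (?c t))
        ((LINT t|lborel. ?a t) + (LINT t|lborel. ?b t) + 2 * Re (LINT t|lborel. ?c t))"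
      by (intro has_bochner_integral_add has_bochner_integral_mult_right
          has_bochner_integral_bounded_linear[OF bounded_linear_Re] has_bochner_integral_integrable ab c)
    then show ?thesis by (rule has_bochner_integral_integral_eq)
  qed
  finally show ?thesis unfolding dB_norm_power2 c0 by simp
qed

end

text \<open>Two inner products on the same space represent the same functionals, by the vectors \<open>k1 n\<close> and
\<open>k2 n\<close>. For combinations \<open>f1\<close>, \<open>f2\<close> of the representers with equal coefficients this gives
\<open>ip1 f1 f1 = ip2 f1 f2\<close>. In other terms, \<open>f2 \<mapsto> f1\<close> is the adjoint of the identity map from the
first space to the second.\<close>

lemma representer_combination_le:
  assumes V: "semi_inner_space V ip1" "semi_inner_space V ip2"
    and k: "\<And>n. k1 n \<in> V" "\<And>n. k2 n \<in> V"
    and rep: "\<And>f n. f \<in> V \<Longrightarrow> ip1 f (k1 n) = ip2 f (k2 n)"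
    and le: "\<And>f. f \<in> V \<Longrightarrow> semi_inner_space.nrm ip2 f \<le> b * semi_inner_space.nrm ip1 f"
    and b: "b \<ge> 0" and A: "finite A"
  shows "semi_inner_space.nrm ip1 (\<lambda>z. \<Sum>n\<in>A. c n * k1 n z) \<le> b * semi_inner_space.nrm ip2 (\<lambda>z. \<Sum>n\<in>A. c n * k2 n z)"
proof -
  interpret S1: semi_inner_space V ip1 by fact
  interpret S2: semi_inner_space V ip2 by fact
  let ?f1 = "\<lambda>z. \<Sum>n\<in>A. c n * k1 n z"
  let ?f2 = "\<lambda>z. \<Sum>n\<in>A. c n * k2 n z"
  have f: "?f1 \<in> V" "?f2 \<in> V" using A k by (auto intro!: S1.sum_in)
  have "ip1 ?f1 ?f1 = (\<Sum>n\<in>A. cnj (c n) * ip1 ?f1 (k1 n))" by (rule S1.ip_sum_right[OF A k(1) f(1)])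
  also have "\<dots> = (\<Sum>n\<in>A. cnj (c n) * ip2 ?f1 (k2 n))" by (simp add: rep[OF f(1)])
  also have "\<dots> = ip2 ?f1 ?f2" by (rule S2.ip_sum_right[OF A k(2) f(1), symmetric])
  finally have "complex_of_real ((S1.nrm ?f1)\<^sup>2) = ip2 ?f1 ?f2" unfolding S1.ip_self[OF f(1)] .
  from arg_cong[OF this, of cmod] have "(S1.nrm ?f1)\<^sup>2 = cmod (ip2 ?f1 ?f2)"
    by (simp del: of_real_power)
  also have "\<dots> \<le> S2.nrm ?f1 * S2.nrm ?f2" by (rule S2.cauchy_schwarz[OF f])
  also have "\<dots> \<le> b * S1.nrm ?f1 * S2.nrm ?f2"
    by (intro mult_right_mono le f S2.nrm_nonneg)
  finally have "S1.nrm ?f1 * S1.nrm ?f1 \<le> S1.nrm ?f1 * (b * S2.nrm ?f2)"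
    by (simp add: power2_eq_square mult_ac)
  moreover have "S1.nrm ?f1 \<ge> 0" "S2.nrm ?f2 \<ge> 0" by (intro S1.nrm_nonneg S2.nrm_nonneg f)+
  ultimately show ?thesis using b by (cases "S1.nrm ?f1 = 0") auto
qed

context hermite_biehler
begin

text \<open>At a real zero of \<open>E + star E\<close> the number \<open>E x\<close> is purely imaginary, so the numerator of the kernel is
a multiple of \<open>E + star E\<close> itself. Other zeros of \<open>E + star E\<close> are therefore zeros of \<open>K x\<close>, and
\<open>K x x \<noteq> 0\<close> forces the zero at \<open>x\<close> to be simple.\<close>

lemma numer_at_zero:
  assumes "E (of_real x) + star E (of_real x) = 0"
  shows "numer x z = cnj (E (of_real x)) * (E z + star E z)"
proof -
  have "E (of_real x) = - cnj (E (of_real x))" using assms by (simp add: eq_neg_iff_add_eq_0)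
  then have "E (of_real x) * star E z = - cnj (E (of_real x)) * star E z" by (rule arg_cong)
  then show ?thesis unfolding numer_def by (simp add: distrib_left)
qed

lemma zero_sequence_zeros:
  assumes zs: "zero_sequence (\<lambda>z. E z + star E z) lam"
  shows "E (of_real (lam n)) + star E (of_real (lam n)) = 0" and "inj lam"
proof -
  let ?A = "\<lambda>z. E z + star E z"
  have holA: "?A holomorphic_on UNIV" by (intro holomorphic_intros entire star_holomorphic)
  have "?A \<i> \<noteq> 0"
    using star_lt[of \<i>] by (auto simp: add_eq_0_iff)
  then have nz: "\<exists>\<^sub>F z in at w. ?A z \<noteq> 0" for w
    using non_zero_neighbour_alt[OF holA open_UNIV connected_UNIV, of w \<i>]
    by (intro eventually_frequently) (auto elim: eventually_mono)
  have card: "finite {m. complex_of_real (lam m) = of_real (lam n)}"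
    "int (card {m. complex_of_real (lam m) = of_real (lam n)}) = zorder ?A (of_real (lam n))" for n
    using zs unfolding zero_sequence_def by blast+
  show zero: "?A (of_real (lam n)) = 0" for n
  proof -
    have "card {m. complex_of_real (lam m) = of_real (lam n)} > 0"
      using card(1)[of n] by (subst card_gt_0_iff) auto
    then have "zorder ?A (of_real (lam n)) > 0" using card(2)[of n] by linarith
    then show ?thesis using zorder_pos_iff[OF holA open_UNIV UNIV_I nz] by blast
  qed
  have simple: "zorder ?A (of_real (lam n)) = 1" for n
  proof (rule zorder_zero_eqI')
    let ?x = "complex_of_real (lam n)"
    show "?A analytic_on {?x}" using holA by (auto simp: analytic_on_holomorphic)
    show "(deriv ^^ i) ?A ?x = 0" if "i < nat 1" for i using that zero by simp
    have "deriv ?A ?x \<noteq> 0"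
    proof
      assume d: "deriv ?A ?x = 0"
      have "(?A has_field_derivative 0) (at ?x)"
        using holomorphic_derivI[OF holA open_UNIV UNIV_I, of ?x] d by simp
      then have "((\<lambda>z. - (cnj (E ?x) * ?A z) / (2 * of_real pi * \<i>)) has_field_derivative
          - (cnj (E ?x) * 0) / (2 * of_real pi * \<i>)) (at ?x)"
        by (intro DERIV_cdivide DERIV_minus DERIV_cmult)
      then have "dB_kernel E ?x ?x = 0"
        by (simp add: kernel_alt numer_at_zero[OF zero] DERIV_imp_deriv)
      then show False using kernel_diag[of "lam n"] kernel_norm_pos[of "lam n"] by simp
    qed
    then show "(deriv ^^ nat 1) ?A ?x \<noteq> 0" by simp
  qed simp
  show "inj lam"
  proof (rule injI)
    fix m n assume "lam m = lam n"
    then have "{m, n} \<subseteq> {m. complex_of_real (lam m) = of_real (lam n)}" by simp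
    then have "card {m, n} \<le> card {m. complex_of_real (lam m) = of_real (lam n)}"
      using card(1) by (intro card_mono)
    also have "\<dots> = 1" using card(2)[of n] simple[of n] by simp
    finally show "m = n" by (cases "m = n") auto
  qed
qed

lemma kernels_orthogonal:
  assumes "E (of_real x) + star E (of_real x) = 0" "E (of_real y) + star E (of_real y) = 0" "x \<noteq> y"
  shows "dB_kernel E (of_real x) (of_real y) = 0"
  using numer_at_zero[OF assms(1), of "of_real y"] numer_kernel[of x "of_real y"] assms(2,3) by simp

end

theorem corollary2:
  fixes E\<^sub>0 E F :: "complex \<Rightarrow> complex" and lam :: "int \<Rightarrow> real"
  assumes "E\<^sub>0 \<in> HB"
    and "sampling_sequence E\<^sub>0 lam"
    and "E \<in> HB" and "F \<in> HB"
    and "equal_with_equiv_norms E\<^sub>0 E"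
    and "zero_sequence (\<lambda>z. E z * F z + star E z * star F z) lam"
    and "\<forall>x::real. E\<^sub>0 (of_real x) \<noteq> 0 \<and> E (of_real x) \<noteq> 0 \<and> F (of_real x) \<noteq> 0"
  shows "\<exists>K\<^sub>0. dB_closed_subspace (\<lambda>z. E\<^sub>0 z * F z) K\<^sub>0 \<and>
     dB_riesz_basis (\<lambda>z. E\<^sub>0 z * F z) K\<^sub>0
       (\<lambda>n z. cnj (F (of_real (lam n))) * F z * dB_kernel E\<^sub>0 (of_real (lam n)) z
                / csqrt (dB_kernel (\<lambda>z. E z * F z) (of_real (lam n)) (of_real (lam n)))
            + E (of_real (lam n)) * star E\<^sub>0 z * dB_kernel F (of_real (lam n)) z
                / csqrt (dB_kernel (\<lambda>z. E z * F z) (of_real (lam n)) (of_real (lam n))))"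
proof -
  interpret E0F: hermite_biehler_pair E\<^sub>0 F by unfold_locales (use assms in auto)
  interpret EF: hermite_biehler_pair E F by unfold_locales (use assms in auto)
  define P where "P = (\<lambda>z. E\<^sub>0 z * F z)"
  interpret P: hermite_biehler P unfolding P_def by (rule E0F.EF.hermite_biehler_axioms)
  obtain a b where ab: "0 < a" "0 < b" and dB_eq: "dB E\<^sub>0 = dB E"
    and equiv: "\<And>f. f \<in> dB E \<Longrightarrow> a * dB_norm E\<^sub>0 f \<le> dB_norm E f" "\<And>f. f \<in> dB E \<Longrightarrow> dB_norm E f \<le> b * dB_norm E\<^sub>0 f"
    using assms(5) unfolding equal_with_equiv_norms_def by auto
  define x where "x = (\<lambda>n. complex_of_real (lam n))"
  define N where "N = (\<lambda>n. dB_norm (\<lambda>z. E z * F z) (dB_kernel (\<lambda>z. E z * F z) (x n)))"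
  have N: "N n > 0" for n unfolding N_def x_def by (rule EF.EF.kernel_norm_pos)
  have diag: "dB_kernel (\<lambda>z. E z * F z) (x n) (x n) = of_real ((N n)\<^sup>2)" for n
    unfolding N_def x_def by (rule EF.EF.kernel_diag)
  have sq: "csqrt (dB_kernel (\<lambda>z. E z * F z) (x n) (x n)) = of_real (N n)" for n
    using less_imp_le[OF N[of n]] by (simp add: diag csqrt_of_real_nonneg del: of_real_power)
  have zs: "zero_sequence (\<lambda>z. E z * F z + star (\<lambda>z. E z * F z) z) lam"
    using assms(6) by (simp add: star_def)
  have ortho: "dB_kernel (\<lambda>z. E z * F z) (x n) (x m) = 0" if "n \<noteq> m" for n m
    unfolding x_def
  proof (rule EF.EF.kernels_orthogonal[OF EF.EF.zero_sequence_zeros(1)[OF zs] EF.EF.zero_sequence_zeros(1)[OF zs]])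
    show "lam n \<noteq> lam m" using injD[OF EF.EF.zero_sequence_zeros(2)[OF zs]] that by blast
  qed
  define \<phi> where "\<phi> = (\<lambda>n z. cnj (F (x n)) * F z * dB_kernel E\<^sub>0 (x n) z / of_real (N n)
      + E (x n) * star E\<^sub>0 z * dB_kernel F (x n) z / of_real (N n))"
  define \<alpha> where "\<alpha> = (\<lambda>c n. c n * cnj (F (x n)) / complex_of_real (N n))"
  define \<beta> where "\<beta> = (\<lambda>c n. c n * E (x n) / complex_of_real (N n))"
  define f0 where "f0 = (\<lambda>c A z. \<Sum>n\<in>A. \<alpha> c n * dB_kernel E\<^sub>0 (x n) z)"
  define f1 where "f1 = (\<lambda>c A z. \<Sum>n\<in>A. \<alpha> c n * dB_kernel E (x n) z)"
  define g where "g = (\<lambda>c A z. \<Sum>n\<in>A. \<beta> c n * dB_kernel F (x n) z)"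
  have comb: "(\<lambda>z. \<Sum>n\<in>A. c n * \<phi> n z) = (\<lambda>z. F z * f0 c A z + star E\<^sub>0 z * g c A z)" for c A
    unfolding \<phi>_def f0_def g_def \<alpha>_def \<beta>_def sum_distrib_left sum.distrib[symmetric]
    by (intro ext sum.cong refl) (simp add: distrib_left mult_ac)
  have k: "dB_kernel E\<^sub>0 (x n) \<in> dB E\<^sub>0" "dB_kernel E (x n) \<in> dB E" "dB_kernel F (x n) \<in> dB F" for n
    unfolding x_def by (rule E0F.E.kernel_in_dB EF.E.kernel_in_dB E0F.F.kernel_in_dB)+
  have f0: "f0 c A \<in> dB E\<^sub>0" if "finite A" for c A
    unfolding f0_def by (rule E0F.E.sp.sum_in[OF that k(1)])
  have g: "g c A \<in> dB F" if "finite A" for c A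
    unfolding g_def by (rule E0F.F.sp.sum_in[OF that k(3)])
  have \<phi>_in: "\<phi> n \<in> dB P" for n
  proof -
    have "(\<lambda>z. F z * f0 (\<lambda>_. 1) {n} z + star E\<^sub>0 z * g (\<lambda>_. 1) {n} z) \<in> dB P"
      unfolding P_def by (intro E0F.sum_in_dB f0 g) auto
    then show ?thesis by (simp flip: comb)
  qed
  have norm_comb: "(dB_norm P (\<lambda>z. \<Sum>n\<in>A. c n * \<phi> n z))\<^sup>2 = (dB_norm E\<^sub>0 (f0 c A))\<^sup>2 + (dB_norm F (g c A))\<^sup>2"
    if "finite A" for c A
    unfolding comb P_def by (rule E0F.pythagoras[OF f0[OF that] g[OF that]])
  have parseval: "(dB_norm E (f1 c A))\<^sup>2 + (dB_norm F (g c A))\<^sup>2 = (\<Sum>n\<in>A. (cmod (c n))\<^sup>2)" if A: "finite A" for c A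
  proof -
    have "complex_of_real ((dB_norm E (f1 c A))\<^sup>2 + (dB_norm F (g c A))\<^sup>2)
        = (\<Sum>n\<in>A. \<Sum>m\<in>A. \<alpha> c n * cnj (\<alpha> c m) * dB_kernel E (x n) (x m))
        + (\<Sum>n\<in>A. \<Sum>m\<in>A. \<beta> c n * cnj (\<beta> c m) * dB_kernel F (x n) (x m))"
      unfolding of_real_add f1_def g_def x_def
      by (intro arg_cong2[of _ _ _ _ "(+)"] EF.E.gram E0F.F.gram A)
    also have "\<dots> = (\<Sum>n\<in>A. \<Sum>m\<in>A. \<alpha> c n * cnj (\<alpha> c m) * dB_kernel E (x n) (x m)
        + \<beta> c n * cnj (\<beta> c m) * dB_kernel F (x n) (x m))"
      by (simp add: sum.distrib)
    also have "\<dots> = (\<Sum>n\<in>A. \<Sum>m\<in>A. c n * cnj (c m) / of_real (N n * N m) * dB_kernel (\<lambda>z. E z * F z) (x n) (x m))"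
    proof (intro sum.cong refl)
      fix n m
      have star_x: "star E (x m) = cnj (E (x m))" by (simp add: x_def)
      have "dB_kernel (\<lambda>z. E z * F z) (x n) (x m)
          = cnj (F (x n)) * F (x m) * dB_kernel E (x n) (x m) + E (x n) * cnj (E (x m)) * dB_kernel F (x n) (x m)"
        using kernel_mult[OF EF.E.hermite_biehler_axioms E0F.F.hermite_biehler_axioms, of "lam n" "x m"]
        unfolding star_x x_def[symmetric] by (simp add: x_def)
      then show "\<alpha> c n * cnj (\<alpha> c m) * dB_kernel E (x n) (x m) + \<beta> c n * cnj (\<beta> c m) * dB_kernel F (x n) (x m)
          = c n * cnj (c m) / of_real (N n * N m) * dB_kernel (\<lambda>z. E z * F z) (x n) (x m)"
        by (simp add: \<alpha>_def \<beta>_def distrib_left mult_ac)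
    qed
    also have "\<dots> = (\<Sum>n\<in>A. \<Sum>m\<in>A. if m = n then c n * cnj (c n) else 0)"
      using N by (intro sum.cong refl) (auto simp: ortho diag power2_eq_square less_imp_neq[symmetric])
    also have "\<dots> = complex_of_real (\<Sum>n\<in>A. (cmod (c n))\<^sup>2)"
      using A by (simp add: sum.delta complex_norm_square del: of_real_power)
    finally show ?thesis unfolding of_real_eq_iff .
  qed
  have rep: "dB_inner E\<^sub>0 f (dB_kernel E\<^sub>0 (x n)) = dB_inner E f (dB_kernel E (x n))" if "f \<in> dB E" for f n
    unfolding x_def using that by (simp add: E0F.E.reproducing EF.E.reproducing dB_eq)
  have ip0: "semi_inner_space (dB E) (dB_inner E\<^sub>0)" using E0F.E.sp.semi_inner_space_axioms by (simp add: dB_eq)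
  have k0: "dB_kernel E\<^sub>0 (x n) \<in> dB E" for n using k(1) unfolding dB_eq .
  have up: "dB_norm E\<^sub>0 (f0 c A) \<le> b * dB_norm E (f1 c A)" if A: "finite A" for c A
  proof -
    have "EF.E.sp.nrm f \<le> b * E0F.E.sp.nrm f" if "f \<in> dB E" for f
      using equiv(2)[OF that] by (simp only: EF.E.nrm_eq E0F.E.nrm_eq)
    then have "E0F.E.sp.nrm (\<lambda>z. \<Sum>n\<in>A. \<alpha> c n * dB_kernel E\<^sub>0 (x n) z)
        \<le> b * EF.E.sp.nrm (\<lambda>z. \<Sum>n\<in>A. \<alpha> c n * dB_kernel E (x n) z)"
      using representer_combination_le[where ?k1.0 = "\<lambda>n. dB_kernel E\<^sub>0 (x n)" and ?k2.0 = "\<lambda>n. dB_kernel E (x n)"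
          and V = "dB E" and ?ip1.0 = "dB_inner E\<^sub>0" and ?ip2.0 = "dB_inner E" and b = b and A = A and c = "\<alpha> c",
          OF ip0 EF.E.sp.semi_inner_space_axioms k0 k(2) rep _ less_imp_le[OF ab(2)] A] by blast
    then show ?thesis by (simp only: EF.E.nrm_eq E0F.E.nrm_eq f0_def f1_def)
  qed
  have lo: "dB_norm E (f1 c A) \<le> 1 / a * dB_norm E\<^sub>0 (f0 c A)" if A: "finite A" for c A
  proof -
    have "E0F.E.sp.nrm f \<le> 1 / a * EF.E.sp.nrm f" if "f \<in> dB E" for f
      using equiv(1)[OF that] ab(1) by (simp add: EF.E.nrm_eq E0F.E.nrm_eq field_simps)
    moreover have "0 \<le> 1 / a" using ab by simp
    ultimately have "EF.E.sp.nrm (\<lambda>z. \<Sum>n\<in>A. \<alpha> c n * dB_kernel E (x n) z)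
        \<le> 1 / a * E0F.E.sp.nrm (\<lambda>z. \<Sum>n\<in>A. \<alpha> c n * dB_kernel E\<^sub>0 (x n) z)"
      using representer_combination_le[where ?k2.0 = "\<lambda>n. dB_kernel E\<^sub>0 (x n)" and ?k1.0 = "\<lambda>n. dB_kernel E (x n)"
          and V = "dB E" and ?ip2.0 = "dB_inner E\<^sub>0" and ?ip1.0 = "dB_inner E" and b = "1 / a" and A = A and c = "\<alpha> c",
          OF EF.E.sp.semi_inner_space_axioms ip0 k(2) k0 rep[symmetric] _ _ A] by blast
    then show ?thesis by (simp only: EF.E.nrm_eq E0F.E.nrm_eq f0_def f1_def)
  qed
  have norm_nonneg: "dB_norm E f \<ge> 0" for E f by (simp add: dB_norm_def Bochner_Integration.integral_nonneg)
  \<comment> \<open>The second summand contributes the constant 1, the first one the squared constants of the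
    equivalence of norms.\<close>
  define lower where "lower = min 1 (a\<^sup>2)"
  define upper where "upper = max 1 (b\<^sup>2)"
  have bounds: "lower > 0" "upper > 0" "lower \<le> upper"
    using ab by (auto simp: lower_def upper_def)
  interpret R: riesz_sequence "dB P" "dB_inner P" \<phi> lower upper
  proof (intro riesz_sequence.intro P.sp.semi_inner_space_axioms riesz_sequence_axioms.intro \<phi>_in bounds)
    fix A :: "int set" and c assume A: "finite A"
    define X where "X = (dB_norm E\<^sub>0 (f0 c A))\<^sup>2"
    define Y where "Y = (dB_norm E (f1 c A))\<^sup>2"
    define Z where "Z = (dB_norm F (g c A))\<^sup>2"
    have Z: "Z \<ge> 0" and Y: "Y \<ge> 0" by (auto simp: Z_def Y_def)
    have XY: "X \<le> b\<^sup>2 * Y"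
      using power_mono[OF up[OF A, of c] norm_nonneg, of 2] by (simp add: X_def Y_def power_mult_distrib)
    have "a * dB_norm E (f1 c A) \<le> dB_norm E\<^sub>0 (f0 c A)" using lo[OF A, of c] ab by (simp add: field_simps)
    from power_mono[OF this, of 2] have YX: "a\<^sup>2 * Y \<le> X"
      using ab norm_nonneg by (simp add: X_def Y_def power_mult_distrib)
    have nc: "(P.sp.nrm (\<lambda>z. \<Sum>n\<in>A. c n * \<phi> n z))\<^sup>2 = X + Z" "(\<Sum>n\<in>A. (cmod (c n))\<^sup>2) = Y + Z"
      using norm_comb[OF A, of c] parseval[OF A, of c] by (simp_all add: P.nrm_eq X_def Y_def Z_def)
    have "lower * Y \<le> a\<^sup>2 * Y" "lower * Z \<le> 1 * Z" "b\<^sup>2 * Y \<le> upper * Y" "1 * Z \<le> upper * Z"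
      using Y Z by (intro mult_right_mono; simp add: lower_def upper_def)+
    then show "lower * (\<Sum>n\<in>A. (cmod (c n))\<^sup>2) \<le> (P.sp.nrm (\<lambda>z. \<Sum>n\<in>A. c n * \<phi> n z))\<^sup>2"
      "(P.sp.nrm (\<lambda>z. \<Sum>n\<in>A. c n * \<phi> n z))\<^sup>2 \<le> upper * (\<Sum>n\<in>A. (cmod (c n))\<^sup>2)"
      unfolding nc distrib_left using XY YX by linarith+
  qed
  have "dB_closed_subspace P R.closed_span"
    unfolding dB_closed_subspace_def P.nrm_eq[symmetric]
  proof (intro conjI allI ballI impI)
    show "R.closed_span \<subseteq> dB P" by (rule R.closed_span_subset)
    show "(\<lambda>z. 0) \<in> R.closed_span" by (rule R.zero_in_closed_span)
    show "(\<lambda>z. f z + g z) \<in> R.closed_span" if "f \<in> R.closed_span" "g \<in> R.closed_span" for f g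
      using that by (rule R.add_in_closed_span)
    show "(\<lambda>z. c * f z) \<in> R.closed_span" if "f \<in> R.closed_span" for c f
      using that by (rule R.scale_in_closed_span)
    show "f \<in> R.closed_span"
      if "f \<in> dB P" "\<forall>n::nat. u n \<in> R.closed_span" "(\<lambda>n. P.sp.nrm (\<lambda>z. u n z - f z)) \<longlonglongrightarrow> 0" for u f
      by (rule R.closed_span_closed[OF that(1) _ that(3)]) (use that(2) in blast)
  qed
  moreover have "dB_frame P R.closed_span \<phi>"
  proof -
    have "\<forall>f\<in>R.closed_span. (\<lambda>n. (cmod (dB_inner P f (\<phi> n)))\<^sup>2) summable_on UNIV \<and>
        lower * (P.sp.nrm f)\<^sup>2 \<le> (\<Sum>\<^sub>\<infinity>n. (cmod (dB_inner P f (\<phi> n)))\<^sup>2) \<and>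
        (\<Sum>\<^sub>\<infinity>n. (cmod (dB_inner P f (\<phi> n)))\<^sup>2) \<le> upper * (P.sp.nrm f)\<^sup>2"
    proof (intro ballI conjI)
      fix f assume f: "f \<in> R.closed_span"
      then have fP: "f \<in> dB P" using R.closed_span_subset by blast
      show "(\<lambda>n. (cmod (dB_inner P f (\<phi> n)))\<^sup>2) summable_on UNIV" by (rule R.frame_summable[OF fP])
      show "lower * (P.sp.nrm f)\<^sup>2 \<le> (\<Sum>\<^sub>\<infinity>n. (cmod (dB_inner P f (\<phi> n)))\<^sup>2)" by (rule R.frame_lower[OF f])
      show "(\<Sum>\<^sub>\<infinity>n. (cmod (dB_inner P f (\<phi> n)))\<^sup>2) \<le> upper * (P.sp.nrm f)\<^sup>2" by (rule R.frame_upper[OF fP])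
    qed
    with bounds show ?thesis unfolding dB_frame_def P.nrm_eq[symmetric]
      using R.phi_in_closed_span by blast
  qed
  moreover have "dB_schauder_basis P R.closed_span (\<lambda>k. \<phi> (e k))" if "bij e" for e
    unfolding dB_schauder_basis_def P.nrm_eq[symmetric]
    by (intro conjI allI ballI R.phi_in_closed_span R.schauder_expansion[OF _ that])
  moreover have "\<phi> = (\<lambda>n z. cnj (F (of_real (lam n))) * F z * dB_kernel E\<^sub>0 (of_real (lam n)) z
                / csqrt (dB_kernel (\<lambda>z. E z * F z) (of_real (lam n)) (of_real (lam n)))
            + E (of_real (lam n)) * star E\<^sub>0 z * dB_kernel F (of_real (lam n)) z
                / csqrt (dB_kernel (\<lambda>z. E z * F z) (of_real (lam n)) (of_real (lam n))))"
    unfolding \<phi>_def sq[symmetric] x_def ..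
  ultimately show ?thesis unfolding dB_riesz_basis_def P_def by blast
qed

end
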